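(* Let $(b^H_t,w_t)^{\mathrm T}_{t\ge0}$ be the mixed fractional Brownian motion in $\mathbb R^{d_1+d_2}$ with Hurst parameter $1/3<H<1/2$. Then, for any $2<p<3$ such that $Hp>1$, the sequence of smooth rough paths $(B^H(m),W(m))=(1,(B^H(m),W(m))^1,(B^H(m),W(m))^2)$ lying above the dyadic polygonal approximations of $(b^H,w)^{\mathrm T}$ converges almost surely in $p$-variation (i.e. in the distance $d_p$), as $m\to\infty$, to a unique geometric rough path $(B^H,W)=(1,(B^H,W)^1,(B^H,W)^2)\in G\Omega_p(\mathbb R^{d_1+d_2})$.
   Context: Time runs over $[0,1]$. $(b^H_t)$ is an $\mathbb R^{d_1}$-valued fractional Brownian motion: independent components, each centred Gaussian with covariance $\frac12(t^{2H}+s^{2H}-|t-s|^{2H})$. $(w_t)$ is an $\mathbb R^{d_2}$-valued standard Brownian motion independent of $b^H$. The mixed fBm is $(b^H,w)^{\mathrm T}$. For $m\in\mathbb N$, $(b^H(m),w(m))^{\mathrm T}$ is the process obtained by linear interpolation of $(b^H,w)^{\mathrm T}$ on the dyadic grid $t^m_l=l/2^m$, $0\le l\le 2^m$, and $(B^H(m),W(m))$ is the smooth rough path whose first and second levels are the iterated integrals of $(b^H(m),w(m))^{\mathrm T}$. Rough paths: for $2<p<3$ and a finite-dimensional space $B$, a $p$-rough path is a continuous map $X=(1,X^1,X^2)$ from $\{0\le s\le t\le1\}$ to $\mathbb R\oplus B\oplus B^{\otimes2}$ with $X_{s,t}=X_{s,u}\otimes X_{u,t}$ for $s\le u\le t$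 and $\|X^j\|_{p/j\text{-var}}<\infty$, $j=1,2$, where $\|A\|_{r\text{-var}}=(\sup_{\mathcal P}\sum_i|A_{t_{i-1},t_i}|^r)^{1/r}$. The distance is $d_p(X,Y)=\sum_{j=1}^2\|X^j-Y^j\|_{p/j\text{-var}}$. A smooth rough path is one given by $X^j_{s,t}=\int_{s\le t_1\le\cdots\le t_j\le t}dx_{t_1}\otimes\cdots\otimes dx_{t_j}$ for a continuous finite variation path $x$. $G\Omega_p(B)$ is the $d_p$-closure of the set of smooth rough paths. *)

theory Defs
  imports "HOL-Probability.Probability"
begin

section \<open>Rough paths\<close>

text \<open>
  With \<open>B\<close> the Euclidean space of dimension \<open>CARD('d)\<close>, the triple \<open>(a, b, c)\<close> stands for the
  element of the level-two truncated tensor algebra with components \<open>a\<close>, \<open>b\<close> in \<open>B\<close> and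
  \<open>c\<close> in \<open>B \<otimes> B\<close>; the elementary tensor of the basis vectors \<open>i\<close>, \<open>j\<close> has coordinate \<open>$ i $ j\<close>,
  so the norm of the type of \<open>c\<close> is the Hilbert-Schmidt norm.
\<close>

type_synonym 'd tensor2 = "real \<times> (real ^ 'd) \<times> (real ^ 'd ^ 'd)"

definition lev0 :: "'d::finite tensor2 \<Rightarrow> real" where
  "lev0 a = fst a"

definition lev1 :: "'d::finite tensor2 \<Rightarrow> real ^ 'd" where
  "lev1 a = fst (snd a)"

definition lev2 :: "'d::finite tensor2 \<Rightarrow> real ^ 'd ^ 'd" where
  "lev2 a = snd (snd a)"

definition outer :: "real ^ 'd \<Rightarrow> real ^ 'd \<Rightarrow> real ^ 'd ^ 'd::finite" where
  "outer u v = (\<chi> i j. u $ i * v $ j)"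

definition tmult :: "'d::finite tensor2 \<Rightarrow> 'd tensor2 \<Rightarrow> 'd tensor2" where
  "tmult a b =
     (lev0 a * lev0 b,
      lev0 a *\<^sub>R lev1 b + lev0 b *\<^sub>R lev1 a,
      lev0 a *\<^sub>R lev2 b + outer (lev1 a) (lev1 b) + lev0 b *\<^sub>R lev2 a)"

definition simplex01 :: "(real \<times> real) set" where
  "simplex01 = {(s, t). 0 \<le> s \<and> s \<le> t \<and> t \<le> 1}"

text \<open>A partition of \<open>[0,1]\<close> is \<open>0 = \<tau> 0 < \<dots> < \<tau> n = 1\<close>.\<close>

definition var_sums :: "real \<Rightarrow> (real \<Rightarrow> real \<Rightarrow> 'a::real_normed_vector) \<Rightarrow> real set" where
  "var_sums r A =
     {(\<Sum>i<n. norm (A (\<tau> i) (\<tau> (Suc i))) powr r) | n \<tau>.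
        \<tau> 0 = 0 \<and> \<tau> n = 1 \<and> strict_mono_on {..n} \<tau>}"

definition finite_var :: "real \<Rightarrow> (real \<Rightarrow> real \<Rightarrow> 'a::real_normed_vector) \<Rightarrow> bool" where
  "finite_var r A \<longleftrightarrow> bdd_above (var_sums r A)"

text \<open>Real-valued supremum: meaningful only under \<^term>\<open>finite_var r A\<close>.\<close>

definition var_norm :: "real \<Rightarrow> (real \<Rightarrow> real \<Rightarrow> 'a::real_normed_vector) \<Rightarrow> real" where
  "var_norm r A = (Sup (var_sums r A)) powr (1 / r)"

definition rough_path :: "real \<Rightarrow> (real \<Rightarrow> real \<Rightarrow> 'd::finite tensor2) \<Rightarrow> bool" where
  "rough_path p X \<longleftrightarrow>
     continuous_on simplex01 (\<lambda>(s, t). X s t) \<and>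
     (\<forall>(s, t) \<in> simplex01. lev0 (X s t) = 1) \<and>
     (\<forall>s u t. 0 \<le> s \<and> s \<le> u \<and> u \<le> t \<and> t \<le> 1 \<longrightarrow> X s t = tmult (X s u) (X u t)) \<and>
     finite_var p (\<lambda>s t. lev1 (X s t)) \<and>
     finite_var (p / 2) (\<lambda>s t. lev2 (X s t))"

definition rp_dist ::
  "real \<Rightarrow> (real \<Rightarrow> real \<Rightarrow> 'd::finite tensor2) \<Rightarrow> (real \<Rightarrow> real \<Rightarrow> 'd tensor2) \<Rightarrow> real" where
  "rp_dist p X Y =
     var_norm p (\<lambda>s t. lev1 (X s t) - lev1 (Y s t)) +
     var_norm (p / 2) (\<lambda>s t. lev2 (X s t) - lev2 (Y s t))"

text \<open>
  Riemann-Stieltjes integral: the limit of the tagged sums as the mesh tends to zero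
  (a constant gauge, not an arbitrary one as for the Henstock-Kurzweil integral).
\<close>

definition has_rs_integral ::
  "(real \<Rightarrow> real) \<Rightarrow> (real \<Rightarrow> real) \<Rightarrow> real \<Rightarrow> real \<Rightarrow> real \<Rightarrow> bool" where
  "has_rs_integral f g a b I \<longleftrightarrow>
     (\<forall>\<epsilon>>0. \<exists>\<delta>>0. \<forall>D. D tagged_division_of {a..b} \<and> (\<lambda>x. ball x \<delta>) fine D \<longrightarrow>
        \<bar>(\<Sum>(x, K)\<in>D. f x * (g (Sup K) - g (Inf K))) - I\<bar> < \<epsilon>)"

definition rs_integral :: "(real \<Rightarrow> real) \<Rightarrow> (real \<Rightarrow> real) \<Rightarrow> real \<Rightarrow> real \<Rightarrow> real" where
  "rs_integral f g a b = (THE I. has_rs_integral f g a b I)"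

text \<open>
  The first iterated integral of \<open>dx\<close> over \<open>[s,t]\<close> is the increment of \<open>x\<close>; the \<open>(i,j)\<close> coordinate
  of the second one is the integral of \<open>dx\<^sup>i(t\<^sub>1) dx\<^sup>j(t\<^sub>2)\<close> over \<open>s \<le> t\<^sub>1 \<le> t\<^sub>2 \<le> t\<close>.
\<close>

definition smooth_lift :: "(real \<Rightarrow> real ^ 'd) \<Rightarrow> real \<Rightarrow> real \<Rightarrow> 'd::finite tensor2" where
  "smooth_lift x s t =
     (1, x t - x s,
      \<chi> i j. rs_integral (\<lambda>r. x r $ i - x s $ i) (\<lambda>r. x r $ j) s t)"

definition smooth_rough_path :: "(real \<Rightarrow> real \<Rightarrow> 'd::finite tensor2) \<Rightarrow> bool" where
  "smooth_rough_path X \<longleftrightarrow>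
     (\<exists>x. continuous_on {0..1} x \<and> finite_var 1 (\<lambda>s t. x t - x s) \<and>
        (\<forall>(s, t) \<in> simplex01. X s t = smooth_lift x s t))"

text \<open>
  The closure of the smooth rough paths within the space of \<open>p\<close>-rough paths. Only the values on
  \<^term>\<open>simplex01\<close> are relevant.
\<close>

definition geometric_rough_path :: "real \<Rightarrow> (real \<Rightarrow> real \<Rightarrow> 'd::finite tensor2) \<Rightarrow> bool" where
  "geometric_rough_path p X \<longleftrightarrow>
     rough_path p X \<and> (\<forall>\<epsilon>>0. \<exists>Y. smooth_rough_path Y \<and> rp_dist p Y X < \<epsilon>)"


section \<open>Mixed fractional Brownian motion on \<open>[0,1]\<close>\<close>

text \<open>Point masses are Gaussian; the library's normal density needs a positive deviation.\<close>

definition centred_gaussian_rv :: "'w measure \<Rightarrow> ('w \<Rightarrow> real) \<Rightarrow> bool" where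
  "centred_gaussian_rv M Z \<longleftrightarrow>
     Z \<in> borel_measurable M \<and>
     ((AE \<omega> in M. Z \<omega> = 0) \<or>
      (\<exists>\<sigma>>0. distributed M lborel Z (\<lambda>x. ennreal (normal_density 0 \<sigma> x))))"

definition centred_gaussian_process :: "'w measure \<Rightarrow> (real \<Rightarrow> 'w \<Rightarrow> real) \<Rightarrow> bool" where
  "centred_gaussian_process M X \<longleftrightarrow>
     (\<forall>F c. finite F \<and> F \<subseteq> {0..1} \<longrightarrow> centred_gaussian_rv M (\<lambda>\<omega>. \<Sum>t\<in>F. c t * X t \<omega>))"

definition process_sigma ::
  "'w measure \<Rightarrow> (real \<Rightarrow> 'w \<Rightarrow> 'a::topological_space) \<Rightarrow> 'w set set" where
  "process_sigma M X =
     sigma_sets (space M) {X t -` A \<inter> space M | t A. t \<in> {0..1} \<and> A \<in> sets borel}"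

definition independent_components ::
  "'w measure \<Rightarrow> (real \<Rightarrow> 'w \<Rightarrow> real ^ 'd::finite) \<Rightarrow> bool" where
  "independent_components M X \<longleftrightarrow>
     prob_space.indep_sets M (\<lambda>i. process_sigma M (\<lambda>t \<omega>. X t \<omega> $ i)) UNIV"

definition fBm_1d :: "'w measure \<Rightarrow> real \<Rightarrow> (real \<Rightarrow> 'w \<Rightarrow> real) \<Rightarrow> bool" where
  "fBm_1d M H b \<longleftrightarrow>
     centred_gaussian_process M b \<and>
     (\<forall>s\<in>{0..1}. \<forall>t\<in>{0..1}.
        prob_space.expectation M (\<lambda>\<omega>. b s \<omega> * b t \<omega>) =
        (t powr (2 * H) + s powr (2 * H) - \<bar>t - s\<bar> powr (2 * H)) / 2)"

definition fBm :: "'w measure \<Rightarrow> real \<Rightarrow> (real \<Rightarrow> 'w \<Rightarrow> real ^ 'd::finite) \<Rightarrow> bool" where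
  "fBm M H b \<longleftrightarrow>
     independent_components M b \<and> (\<forall>i. fBm_1d M H (\<lambda>t \<omega>. b t \<omega> $ i))"

definition BM_1d :: "'w measure \<Rightarrow> (real \<Rightarrow> 'w \<Rightarrow> real) \<Rightarrow> bool" where
  "BM_1d M w \<longleftrightarrow>
     (\<forall>t\<in>{0..1}. w t \<in> borel_measurable M) \<and>
     (AE \<omega> in M. w 0 \<omega> = 0) \<and>
     (\<forall>n \<tau>. strict_mono_on {..n} \<tau> \<and> \<tau> ` {..n} \<subseteq> {0..1} \<longrightarrow>
        prob_space.indep_vars M (\<lambda>_. borel) (\<lambda>i \<omega>. w (\<tau> (Suc i)) \<omega> - w (\<tau> i) \<omega>) {..<n}) \<and>
     (\<forall>s t. 0 \<le> s \<and> s < t \<and> t \<le> 1 \<longrightarrow>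
        distributed M lborel (\<lambda>\<omega>. w t \<omega> - w s \<omega>)
          (\<lambda>x. ennreal (normal_density 0 (sqrt (t - s)) x))) \<and>
     (AE \<omega> in M. continuous_on {0..1} (\<lambda>t. w t \<omega>))"

definition BM :: "'w measure \<Rightarrow> (real \<Rightarrow> 'w \<Rightarrow> real ^ 'd::finite) \<Rightarrow> bool" where
  "BM M w \<longleftrightarrow>
     independent_components M w \<and> (\<forall>i. BM_1d M (\<lambda>t \<omega>. w t \<omega> $ i))"

definition independent_processes ::
  "'w measure \<Rightarrow> (real \<Rightarrow> 'w \<Rightarrow> 'a::topological_space) \<Rightarrow>
   (real \<Rightarrow> 'w \<Rightarrow> 'b::topological_space) \<Rightarrow> bool" where
  "independent_processes M X Y \<longleftrightarrow>
     prob_space.indep_set M (process_sigma M X) (process_sigma M Y)"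

definition vec_append :: "real ^ 'd1 \<Rightarrow> real ^ 'd2 \<Rightarrow> real ^ ('d1::finite + 'd2::finite)" where
  "vec_append u v = (\<chi> k. case k of Inl i \<Rightarrow> u $ i | Inr j \<Rightarrow> v $ j)"

text \<open>
  Linear interpolation of \<open>x\<close> on the grid \<open>l / 2 ^ m\<close>. At \<open>t = 1\<close> the grid point beyond \<open>1\<close> gets
  weight \<open>0\<close>, so only values of \<open>x\<close> on \<open>[0,1]\<close> matter.
\<close>

definition dyadic_interp :: "nat \<Rightarrow> (real \<Rightarrow> 'a::real_normed_vector) \<Rightarrow> real \<Rightarrow> 'a" where
  "dyadic_interp m x t =
     linepath (x (of_int \<lfloor>2 ^ m * t\<rfloor> / 2 ^ m)) (x ((of_int \<lfloor>2 ^ m * t\<rfloor> + 1) / 2 ^ m))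
       (frac (2 ^ m * t))"

end

theory Submission
  imports Defs
begin

text \<open>
  Write \<open>X m\<close> for the lift of the \<open>m\<close>-th polygonal path. The lifts converge because the differences of
  \<open>X (m + 1)\<close> and \<open>X m\<close> over dyadic intervals are small in mean, and because smallness over dyadic
  intervals alone controls the variation over all partitions.

  The probabilistic half concerns a dyadic interval \<open>I\<close> of level \<open>n\<close>. If \<open>n > m\<close>, both paths are affine on
  \<open>I\<close>, and the difference is expressed by increments over the dyadic ancestors of \<open>I\<close>, contracted by the
  ratio of the lengths. If \<open>n \<le> m\<close>, the first levels agree on \<open>I\<close> and the second levels differ by a sum of
  \<open>2 ^ (m - n)\<close> Levy areas of the triangles cut off by the refinement (\<open>lev2_refinement\<close>). The area matrices are
  antisymmetric, and their entries off the diagonal are sums of products of increments of two independent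
  coordinates, so the second moment of an entry is a double sum of products of covariances. For a Hurst parameter
  below \<open>1 / 2\<close> the covariances of an increment with all increments of the same level are
  absolutely summable, uniformly in the level and relative to the variance (\<open>fgn_cov_row_sum\<close>). Therefore this double sum grows
  linearly in the number of cells (\<open>second_moment_cross_sum\<close>). With \<open>\<delta> = (H * p - 1) / 2\<close>, the fourth moment of the first
  level and the second moment of the second level are at most a multiple of
  \<open>2 powr (- (4 / p) * (n + \<delta> * (n + m)))\<close> (\<open>fluct_moment\<close>). Hence the powers of order \<open>p / 4\<close> of these
  quantities are almost surely summable over all dyadic intervals and all \<open>m\<close>, even with weights that grow
  geometrically in \<open>n + m\<close>.

  The sum of these weighted powers over the dyadic intervals inside \<open>[s,t]\<close> is superadditive in \<open>[s,t]\<close>, that is, a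
  control \<open>V\<close> (\<open>AE_control\<close>). By construction the difference of the \<open>j\<close>-th levels over a dyadic interval is at
  most \<open>\<rho> ^ (n + m) * V powr (j / p)\<close> for some \<open>\<rho> < 1\<close>. In the deterministic half an arbitrary
  interval is written as a chain of dyadic ones with at most two of each level; the Chen relation and the factor
  \<open>\<rho> ^ n\<close> carry the estimate over to all intervals at the cost of a constant (\<open>chain_level1\<close>,
  \<open>chain_level2\<close>). Superadditivity of \<open>V\<close> then bounds the variation norms, with geometric decay in \<open>m\<close>.
  So the lifts converge pointwise and in \<open>d\<^sub>p\<close>, and the limit inherits the Chen relation, continuity and
  finite variation (\<open>dyadic_estimates_limit\<close>). It is geometric as a limit of smooth rough paths, measurable as a
  pointwise limit, and unique because \<open>d\<^sub>p\<close> dominates the pointwise distance (\<open>rough_path_limit_unique\<close>).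
\<close>

section \<open>Riemann--Stieltjes integrals from primitives\<close>

text \<open>
  The increments of a primitive of \<open>f dg\<close> agree with the left-point Riemann--Stieltjes sums up to an
  error quadratic in the length of the interval. Such an error disappears in the sum over a fine partition,
  and, unlike differentiability off the kinks of \<open>g\<close>, the condition can be glued across kinks
  without exceptional points.
\<close>

definition rs_primitive ::
  "real \<Rightarrow> (real \<Rightarrow> real) \<Rightarrow> (real \<Rightarrow> real) \<Rightarrow> (real \<Rightarrow> real) \<Rightarrow> real \<Rightarrow> real \<Rightarrow> bool" where
  "rs_primitive C f g F a b \<longleftrightarrow>
     0 \<le> C \<and>
     (\<forall>u v. a \<le> u \<and> u \<le> v \<and> v \<le> b \<longrightarrow>
        \<bar>F v - F u - f u * (g v - g u)\<bar> \<le> C * (v - u)\<^sup>2)"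

lemma rs_primitiveD:
  assumes "rs_primitive C f g F a b" "a \<le> u" "u \<le> v" "v \<le> b"
  shows "\<bar>F v - F u - f u * (g v - g u)\<bar> \<le> C * (v - u)\<^sup>2"
  using assms unfolding rs_primitive_def by blast

lemma rs_primitive_subinterval:
  assumes "rs_primitive C f g F a b" "a \<le> c" "d \<le> b"
  shows "rs_primitive C f g F c d"
  using assms unfolding rs_primitive_def by force

lemma rs_primitive_shift:
  assumes "rs_primitive C f g F a b"
  shows "rs_primitive C (\<lambda>r. f r - c) g (\<lambda>r. F r - c * g r) a b"
proof -
  have eq: "F v - c * g v - (F u - c * g u) - (f u - c) * (g v - g u) = F v - F u - f u * (g v - g u)"
    for u v by (simp add: algebra_simps)
  show ?thesis unfolding rs_primitive_def eq by (rule assms[unfolded rs_primitive_def])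
qed

lemma rs_primitive_mono:
  assumes "rs_primitive C f g F a b" "C \<le> D"
  shows "rs_primitive D f g F a b"
proof -
  have "C * (v - u)\<^sup>2 \<le> D * (v - u)\<^sup>2" for u v
    using assms(2) by (intro mult_right_mono) auto
  then show ?thesis using assms unfolding rs_primitive_def by (blast intro: order_trans)
qed

lemma lipschitz_increment_product:
  fixes f g :: "real \<Rightarrow> real"
  assumes f: "L-lipschitz_on {a..b} f" and g: "L-lipschitz_on {a..b} g"
    and "{u..v} \<subseteq> {a..b}" "q \<in> {u..v}" "r \<in> {u..v}" "s \<in> {u..v}" "t \<in> {u..v}"
  shows "\<bar>(f q - f r) * (g s - g t)\<bar> \<le> L\<^sup>2 * (v - u)\<^sup>2"
proof -
  have L: "0 \<le> L" using f by (rule lipschitz_on_nonneg)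
  have inc: "\<bar>h y - h z\<bar> \<le> L * (v - u)"
    if "L-lipschitz_on {a..b} h" "y \<in> {u..v}" "z \<in> {u..v}" for h :: "real \<Rightarrow> real" and y z
  proof -
    have "\<bar>h y - h z\<bar> \<le> L * \<bar>y - z\<bar>"
      using lipschitz_onD[OF that(1), of y z] that(2,3) assms(3) by (auto simp: dist_real_def)
    also have "\<dots> \<le> L * (v - u)" using that(2,3) L by (intro mult_left_mono) auto
    finally show ?thesis .
  qed
  have "\<bar>f q - f r\<bar> * \<bar>g s - g t\<bar> \<le> (L * (v - u)) * (L * (v - u))"
    by (rule mult_mono[OF inc[OF f] inc[OF g]]) (use assms L in auto)
  also have "\<dots> = L\<^sup>2 * (v - u)\<^sup>2" by (simp only: power_mult_distrib flip: power2_eq_square)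
  finally show ?thesis by (simp only: abs_mult)
qed

lemma fine_subset_ball:
  assumes "(\<lambda>x. ball x d) fine D" "d \<le> e"
  shows "(\<lambda>x. ball x e) fine D"
  using assms subset_ball[OF assms(2)] unfolding fine_def by blast

lemma has_rs_integral_unique:
  assumes I: "has_rs_integral f g a b I" and J: "has_rs_integral f g a b J"
  shows "I = J"
proof (rule ccontr)
  assume "I \<noteq> J"
  define e where "e = \<bar>I - J\<bar> / 2"
  have "e > 0" using \<open>I \<noteq> J\<close> by (simp add: e_def)
  let ?S = "\<lambda>D. \<Sum>(x, K)\<in>D. f x * (g (Sup K) - g (Inf K))"
  obtain d1 where d1: "d1 > 0"
    "\<forall>D. D tagged_division_of {a..b} \<and> (\<lambda>x. ball x d1) fine D \<longrightarrow> \<bar>?S D - I\<bar> < e"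
    using I[unfolded has_rs_integral_def, rule_format, OF \<open>e > 0\<close>] by (elim exE conjE)
  obtain d2 where d2: "d2 > 0"
    "\<forall>D. D tagged_division_of {a..b} \<and> (\<lambda>x. ball x d2) fine D \<longrightarrow> \<bar>?S D - J\<bar> < e"
    using J[unfolded has_rs_integral_def, rule_format, OF \<open>e > 0\<close>] by (elim exE conjE)
  have "min d1 d2 > 0" using d1 d2 by simp
  obtain D where D: "D tagged_division_of {a..b}" "(\<lambda>x. ball x (min d1 d2)) fine D"
    using fine_division_exists_real[OF gauge_ball[OF \<open>min d1 d2 > 0\<close>]] by blast
  have "(\<lambda>x. ball x d1) fine D" "(\<lambda>x. ball x d2) fine D"
    by (rule fine_subset_ball[OF D(2)]; simp)+
  then have "\<bar>?S D - I\<bar> < e" "\<bar>?S D - J\<bar> < e" 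
    using d1(2)[rule_format, OF conjI, OF D(1)] d2(2)[rule_format, OF conjI, OF D(1)] by blast+
  moreover have "\<not> (\<bar>r - I\<bar> < e \<and> \<bar>r - J\<bar> < e)" for r
  proof -
    have "\<bar>I - J\<bar> \<le> \<bar>r - I\<bar> + \<bar>r - J\<bar>" by simp
    moreover have "\<bar>I - J\<bar> = 2 * e" by (simp add: e_def)
    ultimately show ?thesis by linarith
  qed
  ultimately show False by blast
qed

text \<open>
  The local errors of a primitive, summed over a division of mesh \<open>\<delta>\<close>, are of order \<open>\<delta>\<close>. Moving the
  evaluation point from the left end point to the tag changes a term by a product of two Lipschitz increments,
  which is again quadratic.
\<close>

lemma has_rs_integral_primitive:
  assumes prim: "rs_primitive C f g F a b" and "a \<le> b"
    and f: "L-lipschitz_on {a..b} f" and g: "L-lipschitz_on {a..b} g"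
  shows "has_rs_integral f g a b (F b - F a)"
  unfolding has_rs_integral_def
proof (intro allI impI)
  fix \<epsilon> :: real assume "\<epsilon> > 0"
  define D where "D = C + L\<^sup>2"
  have C: "D \<ge> 0" using prim by (simp add: rs_primitive_def D_def)
  define \<delta> where "\<delta> = \<epsilon> / (2 * (D * (b - a) + 1))"
  have den: "D * (b - a) + 1 > 0" using C \<open>a \<le> b\<close> by (simp add: add_nonneg_pos)
  have "\<delta> > 0" unfolding \<delta>_def using \<open>\<epsilon> > 0\<close> den by simp
  have small: "D * (2 * \<delta>) * (b - a) < \<epsilon>"
  proof -
    have "D * (2 * \<delta>) * (b - a) = \<epsilon> * (D * (b - a) / (D * (b - a) + 1))"
      unfolding \<delta>_def using den by (simp add: field_simps)
    also have "\<dots> < \<epsilon> * 1"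
      using den \<open>\<epsilon> > 0\<close> by (intro mult_strict_left_mono) (simp_all add: field_simps)
    finally show ?thesis by simp
  qed
  have "\<bar>(\<Sum>(x, K)\<in>P. f x * (g (Sup K) - g (Inf K))) - (F b - F a)\<bar> < \<epsilon>"
    if P: "P tagged_division_of {a..b}" "(\<lambda>x. ball x \<delta>) fine P" for P
  proof -
    have tele: "(\<Sum>(x, K)\<in>P. G (Sup K) - G (Inf K)) = G b - G a" for G :: "real \<Rightarrow> real"
      by (rule additive_tagged_division_1[OF \<open>a \<le> b\<close> P(1)])
    have "\<bar>(\<Sum>(x, K)\<in>P. f x * (g (Sup K) - g (Inf K))) - (F b - F a)\<bar>
        = norm (\<Sum>(x, K)\<in>P. f x * (g (Sup K) - g (Inf K)) - (F (Sup K) - F (Inf K)))"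
      unfolding tele[of F, symmetric] by (simp add: sum_subtractf[symmetric] split_def)
    also have "\<dots> \<le> (\<Sum>(x, K)\<in>P. D * (2 * \<delta>) * (Sup K - Inf K))"
    proof (rule sum_norm_le, clarify)
      fix x K assume xK: "(x, K) \<in> P"
      obtain u v where K: "K = {u..v}" "x \<in> K" "K \<subseteq> {a..b}"
        using P(1) xK by (metis box_real(2) tagged_division_ofD(2,3,4))
      have le: "a \<le> u" "u \<le> x" "x \<le> v" "v \<le> b" using K by auto
      have "K \<subseteq> ball x \<delta>" using P(2) xK by (auto simp: fine_def)
      then have "u \<in> ball x \<delta>" "v \<in> ball x \<delta>"
        using K(1) le by (meson atLeastAtMost_iff order_refl order_trans subsetD)+
      then have vu: "v - u \<le> 2 * \<delta>" by (auto simp: dist_real_def)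
      have SI: "Sup K = v" "Inf K = u" using K le by auto
      have "F v - F u - f x * (g v - g u) = (F v - F u - f u * (g v - g u)) + (f u - f x) * (g v - g u)"
        by (simp add: algebra_simps)
      then have "\<bar>F v - F u - f x * (g v - g u)\<bar> \<le> C * (v - u)\<^sup>2 + L\<^sup>2 * (v - u)\<^sup>2"
        using rs_primitiveD[OF prim le(1) order_trans[OF le(2,3)] le(4)]
          lipschitz_increment_product[OF f g, of u v u x v u] le by fastforce
      also have "\<dots> = D * (v - u)\<^sup>2" by (simp add: D_def algebra_simps)
      also have "\<dots> \<le> D * ((2 * \<delta>) * (v - u))"
        using C vu le unfolding power2_eq_square by (intro mult_left_mono mult_right_mono) auto
      finally show "norm (f x * (g (Sup K) - g (Inf K)) - (F (Sup K) - F (Inf K)))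
          \<le> D * (2 * \<delta>) * (Sup K - Inf K)"
        unfolding SI real_norm_def by (simp add: abs_minus_commute mult.assoc)
    qed
    also have "\<dots> = D * (2 * \<delta>) * (\<Sum>(x, K)\<in>P. Sup K - Inf K)"
      by (simp add: sum_distrib_left split_def)
    also have "\<dots> = D * (2 * \<delta>) * (b - a)" using tele[of "\<lambda>x. x"] by simp
    finally show ?thesis using small by linarith
  qed
  then show "\<exists>\<delta>>0. \<forall>P. P tagged_division_of {a..b} \<and> (\<lambda>x. ball x \<delta>) fine P \<longrightarrow>
      \<bar>(\<Sum>(x, K)\<in>P. f x * (g (Sup K) - g (Inf K))) - (F b - F a)\<bar> < \<epsilon>"
    using \<open>\<delta> > 0\<close> by blast
qed

lemma rs_integral_primitive:
  assumes "rs_primitive C f g F a b" "a \<le> b" "L-lipschitz_on {a..b} f" "L-lipschitz_on {a..b} g"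
  shows "rs_integral f g a b = F b - F a"
  unfolding rs_integral_def
  using has_rs_integral_primitive[OF assms] has_rs_integral_unique by blast

text \<open>
  An interval containing the junction is split there; the left-point sums of the two parts differ from
  that of the whole by a product of two increments, hence again quadratically.
\<close>

lemma rs_primitive_glue:
  assumes F: "rs_primitive C f g F a c" and G: "rs_primitive C f g G c b"
    and f: "L-lipschitz_on {a..b} f" and g: "L-lipschitz_on {a..b} g"
  shows "rs_primitive (2 * C + L\<^sup>2) f g (\<lambda>t. if t \<le> c then F t else F c + (G t - G c)) a b"
    (is "rs_primitive _ _ _ ?P _ _")
  unfolding rs_primitive_def
proof (intro conjI allI impI)
  have C: "C \<ge> 0" using F by (simp add: rs_primitive_def)
  then show "0 \<le> 2 * C + L\<^sup>2" by simp
  fix u v assume *: "a \<le> u \<and> u \<le> v \<and> v \<le> b"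
  have weaken: "C * (v - u)\<^sup>2 \<le> (2 * C + L\<^sup>2) * (v - u)\<^sup>2" using C by (intro mult_right_mono) auto
  consider "v \<le> c" | "c \<le> u" "c < v" | "u < c" "c < v" by linarith
  then show "\<bar>?P v - ?P u - f u * (g v - g u)\<bar> \<le> (2 * C + L\<^sup>2) * (v - u)\<^sup>2"
  proof cases
    case 1
    have "\<bar>F v - F u - f u * (g v - g u)\<bar> \<le> C * (v - u)\<^sup>2"
      using * 1 by (intro rs_primitiveD[OF F]) auto
    then show ?thesis using weaken 1 * by simp
  next
    case 2
    have "\<bar>G v - G u - f u * (g v - g u)\<bar> \<le> C * (v - u)\<^sup>2"
      using * 2 by (intro rs_primitiveD[OF G]) auto
    moreover have "?P v - ?P u = G v - G u" using 2 by (cases "u = c") auto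
    ultimately show ?thesis using weaken by simp
  next
    case 3
    have sq: "(c - u)\<^sup>2 \<le> (v - u)\<^sup>2" "(v - c)\<^sup>2 \<le> (v - u)\<^sup>2" using 3 by (auto intro: power_mono)
    have "\<bar>F c - F u - f u * (g c - g u)\<bar> \<le> C * (c - u)\<^sup>2"
      using * 3 by (intro rs_primitiveD[OF F]) auto
    then have e1: "\<bar>F c - F u - f u * (g c - g u)\<bar> \<le> C * (v - u)\<^sup>2"
      using mult_left_mono[OF sq(1) C] by linarith
    have "\<bar>G v - G c - f c * (g v - g c)\<bar> \<le> C * (v - c)\<^sup>2"
      using * 3 by (intro rs_primitiveD[OF G]) auto
    then have e2: "\<bar>G v - G c - f c * (g v - g c)\<bar> \<le> C * (v - u)\<^sup>2"
      using mult_left_mono[OF sq(2) C] by linarith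
    have e3: "\<bar>(f c - f u) * (g v - g c)\<bar> \<le> L\<^sup>2 * (v - u)\<^sup>2"
      by (rule lipschitz_increment_product[OF f g]) (use * 3 in auto)
    have "?P v - ?P u = F c + (G v - G c) - F u" using 3 by auto
    moreover have "F c + (G v - G c) - F u - f u * (g v - g u)
        = (F c - F u - f u * (g c - g u)) + (G v - G c - f c * (g v - g c)) + (f c - f u) * (g v - g c)"
      by (simp add: algebra_simps)
    ultimately show ?thesis using e1 e2 e3 unfolding distrib_right by linarith
  qed
qed

lemma rs_primitive_affine:
  fixes f g :: "real \<Rightarrow> real"
  assumes f: "\<And>t. a \<le> t \<Longrightarrow> t \<le> b \<Longrightarrow> f t = f0 + \<alpha> * (t - a)"
    and g: "\<And>t. a \<le> t \<Longrightarrow> t \<le> b \<Longrightarrow> g t = g0 + \<beta> * (t - a)"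
  shows "rs_primitive \<bar>\<alpha> * \<beta>\<bar> f g (\<lambda>t. f0 * \<beta> * (t - a) + \<alpha> * \<beta> * (t - a)\<^sup>2 / 2) a b"
  unfolding rs_primitive_def
proof (intro conjI allI impI)
  show "0 \<le> \<bar>\<alpha> * \<beta>\<bar>" by simp
  fix u v assume *: "a \<le> u \<and> u \<le> v \<and> v \<le> b"
  have "f0 * \<beta> * (v - a) + \<alpha> * \<beta> * (v - a)\<^sup>2 / 2 - (f0 * \<beta> * (u - a) + \<alpha> * \<beta> * (u - a)\<^sup>2 / 2)
      - f u * (g v - g u) = (\<alpha> * \<beta>) * ((v - u)\<^sup>2 / 2)"
    using * by (simp add: f g power2_eq_square field_simps)
  also have "\<bar>\<dots>\<bar> = \<bar>\<alpha> * \<beta>\<bar> * ((v - u)\<^sup>2 / 2)" by (simp add: abs_mult)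
  also have "\<dots> \<le> \<bar>\<alpha> * \<beta>\<bar> * (v - u)\<^sup>2" by (intro mult_left_mono) auto
  finally show "\<bar>f0 * \<beta> * (v - a) + \<alpha> * \<beta> * (v - a)\<^sup>2 / 2
      - (f0 * \<beta> * (u - a) + \<alpha> * \<beta> * (u - a)\<^sup>2 / 2) - f u * (g v - g u)\<bar>
      \<le> \<bar>\<alpha> * \<beta>\<bar> * (v - u)\<^sup>2" .
qed

section \<open>Dyadic polygonal paths\<close>

lemma dyadic_endpoints:
  assumes "k < 2 ^ n"
  shows "0 \<le> real k / 2 ^ n" "real k / 2 ^ n \<le> (real k + 1) / 2 ^ n" "(real k + 1) / 2 ^ n \<le> 1"
    "real k / 2 ^ n \<le> 1" "0 \<le> (real k + 1) / 2 ^ n"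
proof -
  have "real (Suc k) \<le> 2 ^ n" using assms by (simp del: of_nat_Suc)
  then show "(real k + 1) / 2 ^ n \<le> 1" by simp
  show "real k / 2 ^ n \<le> 1" using assms by simp
qed (simp_all add: divide_right_mono)

lemma dyadic_interp_cell:
  assumes "real l / 2 ^ m \<le> t" "t \<le> (real l + 1) / 2 ^ m"
  shows "dyadic_interp m x t
    = x (real l / 2 ^ m) + (2 ^ m * t - real l) *\<^sub>R (x ((real l + 1) / 2 ^ m) - x (real l / 2 ^ m))"
proof -
  have *: "real l \<le> 2 ^ m * t" "2 ^ m * t \<le> real l + 1" using assms by (auto simp: field_simps)
  show ?thesis
  proof (cases "2 ^ m * t = real l + 1")
    case True
    have "\<lfloor>real l + 1\<rfloor> = int l + 1" by linarith
    then show ?thesis unfolding dyadic_interp_def True by (simp add: linepath_def frac_def add.commute)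
  next
    case False
    then have fl: "\<lfloor>2 ^ m * t\<rfloor> = int l" using * by (intro floor_unique) auto
    define r where "r = 2 ^ m * t - real l"
    have "frac (2 ^ m * t) = r" using fl by (simp add: frac_def r_def)
    then show ?thesis unfolding dyadic_interp_def fl r_def[symmetric]
      by (simp add: linepath_def algebra_simps)
  qed
qed

lemma dyadic_interp_grid:
  assumes "n \<le> m"
  shows "dyadic_interp m x (real k / 2 ^ n) = x (real k / 2 ^ n)"
proof -
  have "real k / 2 ^ n = real (k * 2 ^ (m - n)) / 2 ^ m"
    using assms by (simp add: field_simps flip: power_add)
  then show ?thesis
    using dyadic_interp_cell[of "k * 2 ^ (m - n)" m "real k / 2 ^ n" x] by (simp add: divide_right_mono)
qed

lemma ex_dyadic_cell:
  assumes "0 \<le> t" "t \<le> 1"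
  obtains l where "l < 2 ^ m" "real l / 2 ^ m \<le> t" "t \<le> (real l + 1) / 2 ^ m"
proof (cases "t = 1")
  case True
  then show ?thesis using that[of "2 ^ m - 1"] by (simp add: of_nat_diff field_simps)
next
  case False
  define l where "l = nat \<lfloor>2 ^ m * t\<rfloor>"
  have "real l = \<lfloor>2 ^ m * t\<rfloor>" using assms by (simp add: l_def)
  then have l: "real l \<le> 2 ^ m * t" "2 ^ m * t < real l + 1" by linarith+
  have "2 ^ m * t < 2 ^ m" using False assms by simp
  then have "real l < 2 ^ m" using l by linarith
  then have "l < 2 ^ m" by (metis of_nat_less_numeral_power_cancel_iff)
  then show ?thesis using that l by (simp add: field_simps)
qed

text \<open>
  Both the Lipschitz bound and the primitives of the coordinates are obtained one cell at
  a time, since the polygonal path is affine on each cell.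
\<close>

lemma dyadic_interp_lipschitz: "\<exists>L. L-lipschitz_on {0..1} (dyadic_interp m x)"
proof -
  have "\<exists>L. L-lipschitz_on {0..real l / 2 ^ m} (dyadic_interp m x)" if "l \<le> 2 ^ m" for l
  proof (induction l)
    case 0
    show ?case by (intro exI[of _ 0]) (simp add: lipschitz_on_def)
  next
    case (Suc l)
    then obtain L where L: "L-lipschitz_on {0..real l / 2 ^ m} (dyadic_interp m x)" by blast
    define d where "d = x ((real l + 1) / 2 ^ m) - x (real l / 2 ^ m)"
    have "(2 ^ m * norm d)-lipschitz_on {real l / 2 ^ m..real (Suc l) / 2 ^ m} (dyadic_interp m x)"
    proof (rule lipschitz_onI)
      fix s t assume s: "s \<in> {real l / 2 ^ m..real (Suc l) / 2 ^ m}"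
        and t: "t \<in> {real l / 2 ^ m..real (Suc l) / 2 ^ m}"
      have "dyadic_interp m x s - dyadic_interp m x t = (2 ^ m * (s - t)) *\<^sub>R d"
        using s t by (subst (1 2) dyadic_interp_cell[of l])
          (auto simp: d_def add.commute right_diff_distrib simp flip: scaleR_left_diff_distrib)
      then show "dist (dyadic_interp m x s) (dyadic_interp m x t) \<le> 2 ^ m * norm d * dist s t"
        by (simp add: dist_norm abs_mult)
    qed simp
    from lipschitz_on_concat_max[OF L this]
    have "(max L (2 ^ m * norm d))-lipschitz_on {0..real (Suc l) / 2 ^ m} (dyadic_interp m x)" by simp
    then show ?case by blast
  qed
  from this[of "2 ^ m"] show ?thesis by simp
qed

lemma lipschitz_component:
  assumes "L-lipschitz_on S y"
  shows "L-lipschitz_on S (\<lambda>t. y t $ i)"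
  using assms unfolding lipschitz_on_def
  by (metis (no_types, lifting) dist_vec_nth_le order_trans)

lemma dyadic_interp_primitive:
  fixes x :: "real \<Rightarrow> real ^ 'd::finite"
  shows "\<exists>F C. rs_primitive C (\<lambda>t. dyadic_interp m x t $ i) (\<lambda>t. dyadic_interp m x t $ j) F 0 1"
proof -
  obtain L where L: "L-lipschitz_on {0..1} (dyadic_interp m x)" using dyadic_interp_lipschitz by blast
  let ?f = "\<lambda>i t. dyadic_interp m x t $ i"
  have "\<exists>F C. rs_primitive C (?f i) (?f j) F 0 (real l / 2 ^ m)" if "l \<le> 2 ^ m" for l
    using that
  proof (induction l)
    case 0
    have "rs_primitive 0 (?f i) (?f j) (\<lambda>_. 0) 0 0"
      unfolding rs_primitive_def
    proof (intro conjI allI impI)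
      fix u v :: real assume "0 \<le> u \<and> u \<le> v \<and> v \<le> 0"
      then have "v = u" by linarith
      then show "\<bar>0 - 0 - ?f i u * (?f j v - ?f j u)\<bar> \<le> 0 * (v - u)\<^sup>2" by simp
    qed simp
    then show ?case by auto
  next
    case (Suc l)
    then obtain F C where F: "rs_primitive C (?f i) (?f j) F 0 (real l / 2 ^ m)" by auto
    define d where "d = x ((real l + 1) / 2 ^ m) - x (real l / 2 ^ m)"
    have aff: "?f k t = x (real l / 2 ^ m) $ k + (2 ^ m * d $ k) * (t - real l / 2 ^ m)"
      if "real l / 2 ^ m \<le> t" "t \<le> real (Suc l) / 2 ^ m" for k t
      using that by (subst dyadic_interp_cell[of l]) (auto simp: d_def field_simps)
    obtain D G where G: "rs_primitive D (?f i) (?f j) G (real l / 2 ^ m) (real (Suc l) / 2 ^ m)"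
      using rs_primitive_affine[OF aff aff] by blast
    have "real (Suc l) \<le> 2 ^ m" using Suc.prems by (simp del: of_nat_Suc)
    then have "real (Suc l) / 2 ^ m \<le> 1" by simp
    then have "L-lipschitz_on {0..real (Suc l) / 2 ^ m} (?f k)" for k
      by (intro lipschitz_component lipschitz_on_subset[OF L]) auto
    from rs_primitive_glue[OF rs_primitive_mono[OF F max.cobounded1[of C D]]
        rs_primitive_mono[OF G max.cobounded2[of D C]] this this]
    show ?case by blast
  qed
  from this[of "2 ^ m"] show ?thesis by simp
qed

section \<open>Multiplicative functionals and controls\<close>

lemma norm_outer: "norm (outer u v) = norm u * norm (v :: real ^ 'd::finite)"
proof -
  have "outer u v $ i = (u $ i) *\<^sub>R v" for i by (simp add: outer_def vec_eq_iff)
  then show ?thesis by (simp add: norm_vec_def[of "outer u v"] norm_vec_def[of u] L2_set_left_distrib)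
qed

lemma bounded_bilinear_outer:
  "bounded_bilinear (outer :: real ^ 'd \<Rightarrow> real ^ 'd \<Rightarrow> real ^ 'd ^ 'd::finite)"
proof
  show "\<exists>K. \<forall>(a :: real ^ 'd) b. norm (outer a b) \<le> norm a * norm b * K"
    by (intro exI[of _ 1]) (simp add: norm_outer)
qed (simp_all add: outer_def vec_eq_iff algebra_simps)

lemmas outer_simps =
  bounded_bilinear.add_left[OF bounded_bilinear_outer]
  bounded_bilinear.add_right[OF bounded_bilinear_outer]
  bounded_bilinear.diff_left[OF bounded_bilinear_outer]
  bounded_bilinear.diff_right[OF bounded_bilinear_outer]
  bounded_bilinear.zero_left[OF bounded_bilinear_outer]
  bounded_bilinear.zero_right[OF bounded_bilinear_outer]

lemma tensor2_eq_iff: "x = y \<longleftrightarrow> lev0 x = lev0 y \<and> lev1 x = lev1 y \<and> lev2 x = lev2 y"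
  by (auto simp: lev0_def lev1_def lev2_def prod_eq_iff)

lemma lev_Pair [simp]: "lev0 (a, b, c) = a" "lev1 (a, b, c) = b" "lev2 (a, b, c) = c"
  by (simp_all add: lev0_def lev1_def lev2_def)

definition multiplicative :: "(real \<Rightarrow> real \<Rightarrow> 'd::finite tensor2) \<Rightarrow> bool" where
  "multiplicative X \<longleftrightarrow>
     (\<forall>s t. 0 \<le> s \<longrightarrow> s \<le> t \<longrightarrow> t \<le> 1 \<longrightarrow> lev0 (X s t) = 1) \<and>
     (\<forall>s u t. 0 \<le> s \<longrightarrow> s \<le> u \<longrightarrow> u \<le> t \<longrightarrow> t \<le> 1 \<longrightarrow> X s t = tmult (X s u) (X u t))"

lemma multiplicative_lev0:
  assumes "multiplicative X" "0 \<le> s" "s \<le> t" "t \<le> 1"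
  shows "lev0 (X s t) = 1"
  using assms unfolding multiplicative_def by blast

lemma multiplicative_lev:
  assumes "multiplicative X" "0 \<le> s" "s \<le> u" "u \<le> t" "t \<le> 1"
  shows "lev1 (X s t) = lev1 (X s u) + lev1 (X u t)"
    and "lev2 (X s t) = lev2 (X s u) + lev2 (X u t) + outer (lev1 (X s u)) (lev1 (X u t))"
proof -
  have "X s t = tmult (X s u) (X u t)" "lev0 (X s u) = 1" "lev0 (X u t) = 1"
    using assms unfolding multiplicative_def by (blast intro: order_trans)+
  then show "lev1 (X s t) = lev1 (X s u) + lev1 (X u t)"
    "lev2 (X s t) = lev2 (X s u) + lev2 (X u t) + outer (lev1 (X s u)) (lev1 (X u t))"
    by (simp_all add: tmult_def)
qed

lemma multiplicativeI:
  assumes "\<And>s t. 0 \<le> s \<Longrightarrow> s \<le> t \<Longrightarrow> t \<le> 1 \<Longrightarrow> lev0 (X s t) = 1"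
    and "\<And>s u t. 0 \<le> s \<Longrightarrow> s \<le> u \<Longrightarrow> u \<le> t \<Longrightarrow> t \<le> 1 \<Longrightarrow>
      lev1 (X s t) = lev1 (X s u) + lev1 (X u t)"
    and "\<And>s u t. 0 \<le> s \<Longrightarrow> s \<le> u \<Longrightarrow> u \<le> t \<Longrightarrow> t \<le> 1 \<Longrightarrow>
      lev2 (X s t) = lev2 (X s u) + lev2 (X u t) + outer (lev1 (X s u)) (lev1 (X u t))"
  shows "multiplicative X"
  unfolding multiplicative_def
proof (intro conjI allI impI)
  fix s t :: real assume "0 \<le> s" "s \<le> t" "t \<le> 1"
  then show "lev0 (X s t) = 1" by (rule assms(1))
next
  fix s u t :: real assume *: "0 \<le> s" "s \<le> u" "u \<le> t" "t \<le> 1"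
  have "lev0 (X s t) = 1" "lev0 (X s u) = 1" "lev0 (X u t) = 1" using * by (auto intro!: assms(1))
  then show "X s t = tmult (X s u) (X u t)"
    using assms(2,3)[OF *] by (simp add: tensor2_eq_iff tmult_def add.commute add.left_commute)
qed

lemma multiplicative_diag:
  assumes "multiplicative X" "0 \<le> s" "s \<le> 1"
  shows "lev1 (X s s) = 0" "lev2 (X s s) = 0"
proof -
  show *: "lev1 (X s s) = 0" using multiplicative_lev(1)[OF assms(1), of s s s] assms by simp
  show "lev2 (X s s) = 0" using multiplicative_lev(2)[OF assms(1), of s s s] assms *
    by (simp add: outer_simps)
qed

lemma rough_path_iff:
  "rough_path p X \<longleftrightarrow> continuous_on simplex01 (\<lambda>(s, t). X s t) \<and> multiplicative X \<and>
     finite_var p (\<lambda>s t. lev1 (X s t)) \<and> finite_var (p / 2) (\<lambda>s t. lev2 (X s t))"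
  unfolding rough_path_def multiplicative_def simplex01_def by blast

text \<open>
  A functional whose \<open>r\<close>-th power is dominated by a control has finite \<open>r\<close>-variation, as superadditivity
  bounds every partition sum by the value of the control on \<open>[0,1]\<close>.
\<close>

definition control :: "(real \<Rightarrow> real \<Rightarrow> real) \<Rightarrow> bool" where
  "control V \<longleftrightarrow>
     (\<forall>s t. 0 \<le> s \<longrightarrow> s \<le> t \<longrightarrow> t \<le> 1 \<longrightarrow> 0 \<le> V s t) \<and>
     (\<forall>s u t. 0 \<le> s \<longrightarrow> s \<le> u \<longrightarrow> u \<le> t \<longrightarrow> t \<le> 1 \<longrightarrow> V s u + V u t \<le> V s t)"

lemma control_nonneg: "control V \<Longrightarrow> 0 \<le> s \<Longrightarrow> s \<le> t \<Longrightarrow> t \<le> 1 \<Longrightarrow> 0 \<le> V s t"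
  unfolding control_def by blast

lemma control_superadditive:
  "control V \<Longrightarrow> 0 \<le> s \<Longrightarrow> s \<le> u \<Longrightarrow> u \<le> t \<Longrightarrow> t \<le> 1 \<Longrightarrow> V s u + V u t \<le> V s t"
  unfolding control_def by blast

lemma control_mono:
  assumes "control V" "0 \<le> s" "s \<le> s'" "s' \<le> t'" "t' \<le> t" "t \<le> 1"
  shows "V s' t' \<le> V s t"
  using control_superadditive[OF assms(1), of s s' t] control_superadditive[OF assms(1), of s' t' t]
    control_nonneg[OF assms(1), of s s'] control_nonneg[OF assms(1), of t' t] assms by linarith

lemma control_add:
  assumes "control V" "control W"
  shows "control (\<lambda>s t. V s t + W s t)"
  unfolding control_def
proof (intro conjI allI impI)
  fix s t :: real assume "0 \<le> s" "s \<le> t" "t \<le> 1"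
  then show "0 \<le> V s t + W s t" using assms by (simp add: control_nonneg)
next
  fix s u t :: real assume "0 \<le> s" "s \<le> u" "u \<le> t" "t \<le> 1"
  then show "V s u + W s u + (V u t + W u t) \<le> V s t + W s t"
    using control_superadditive[OF assms(1), of s u t] control_superadditive[OF assms(2), of s u t]
    by simp
qed

lemma control_length: "0 \<le> K \<Longrightarrow> control (\<lambda>s t. K * (t - s))"
  unfolding control_def by (auto simp: algebra_simps intro: mult_right_mono)

lemma var_sums_le_control:
  assumes V: "control V" and K: "0 \<le> K"
    and le: "\<And>s t. 0 \<le> s \<Longrightarrow> s \<le> t \<Longrightarrow> t \<le> 1 \<Longrightarrow> norm (A s t) powr r \<le> K * V s t"
    and S: "S \<in> var_sums r A"
  shows "S \<le> K * V 0 1"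
proof -
  obtain n \<tau> where S_eq: "S = (\<Sum>i<n. norm (A (\<tau> i) (\<tau> (Suc i))) powr r)"
    and \<tau>: "\<tau> 0 = 0" "\<tau> n = 1" "strict_mono_on {..n} \<tau>"
    using S unfolding var_sums_def by blast
  have mono: "\<tau> i \<le> \<tau> j" if "i \<le> j" "j \<le> n" for i j
    using strict_mono_onD[OF \<tau>(3), of i j] that by (cases "i = j") auto
  have bounds: "0 \<le> \<tau> i" "\<tau> i \<le> 1" if "i \<le> n" for i
    using mono[of 0 i] mono[of i n] \<tau> that by auto
  have step: "(\<Sum>i<k. V (\<tau> i) (\<tau> (Suc i))) \<le> V 0 (\<tau> k)" if "k \<le> n" for k
    using that
  proof (induction k)
    case 0
    then show ?case using control_nonneg[OF V] \<tau> by simp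
  next
    case (Suc k)
    have "V 0 (\<tau> k) + V (\<tau> k) (\<tau> (Suc k)) \<le> V 0 (\<tau> (Suc k))"
      using Suc.prems by (intro control_superadditive[OF V] bounds mono) auto
    then show ?case using Suc by simp
  qed
  have "S \<le> (\<Sum>i<n. K * V (\<tau> i) (\<tau> (Suc i)))"
    unfolding S_eq by (intro sum_mono le bounds mono) auto
  also have "\<dots> \<le> K * V 0 1"
    unfolding sum_distrib_left[symmetric] using step[of n] \<tau> K by (intro mult_left_mono) auto
  finally show ?thesis .
qed

lemma var_sums_nonempty: "\<exists>S \<in> var_sums r A. 0 \<le> S"
proof
  show "norm (A 0 1) powr r \<in> var_sums r A"
    unfolding var_sums_def
    by (rule CollectI, rule exI[of _ 1], rule exI[of _ real]) (auto simp: strict_mono_on_def)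
qed simp

lemma finite_var_control:
  assumes "control V" "0 \<le> K"
    and "\<And>s t. 0 \<le> s \<Longrightarrow> s \<le> t \<Longrightarrow> t \<le> 1 \<Longrightarrow> norm (A s t) powr r \<le> K * V s t"
  shows "finite_var r A"
  using var_sums_le_control[OF assms] unfolding finite_var_def bdd_above_def by blast

lemma var_norm_le_control:
  assumes V: "control V" and "0 \<le> K" "r > 0"
    and le: "\<And>s t. 0 \<le> s \<Longrightarrow> s \<le> t \<Longrightarrow> t \<le> 1 \<Longrightarrow> norm (A s t) \<le> K * V s t powr (1 / r)"
  shows "finite_var r A" and "var_norm r A \<le> K * V 0 1 powr (1 / r)"
proof -
  have powr: "(K * V s t powr (1 / r)) powr r = K powr r * V s t" if "0 \<le> s" "s \<le> t" "t \<le> 1" for s t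
    using control_nonneg[OF V that] assms by (simp add: powr_mult powr_powr)
  have le': "norm (A s t) powr r \<le> K powr r * V s t" if "0 \<le> s" "s \<le> t" "t \<le> 1" for s t
    using powr_mono2[OF _ _ le[OF that], of r] powr[OF that] \<open>r > 0\<close> by simp
  show "finite_var r A" by (rule finite_var_control[OF V _ le']) auto
  have bd: "S \<le> K powr r * V 0 1" if "S \<in> var_sums r A" for S
    by (rule var_sums_le_control[OF V _ le' that]) auto
  obtain S where S: "S \<in> var_sums r A" "0 \<le> S" using var_sums_nonempty by blast
  have "0 \<le> Sup (var_sums r A)"
    using S bd by (meson bdd_aboveI cSup_upper order_trans)
  moreover have "Sup (var_sums r A) \<le> K powr r * V 0 1"
    using S bd by (intro cSup_least) auto
  ultimately have "var_norm r A \<le> (K powr r * V 0 1) powr (1 / r)"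
    unfolding var_norm_def using \<open>r > 0\<close> by (intro powr_mono2) auto
  also have "\<dots> = K * V 0 1 powr (1 / r)"
    using control_nonneg[OF V, of 0 1] assms by (simp add: powr_mult powr_powr)
  finally show "var_norm r A \<le> K * V 0 1 powr (1 / r)" .
qed

lemma var_norm_nonneg: "0 \<le> var_norm r A"
  by (simp add: var_norm_def)

lemma norm_le_var_norm:
  assumes fin: "finite_var r A" and "r > 0" and st: "0 \<le> s" "s < t" "t \<le> 1"
  shows "norm (A s t) \<le> var_norm r A"
proof -
  \<comment> \<open>The partition formed by \<open>0\<close>, \<open>s\<close>, \<open>t\<close>, \<open>1\<close>, with repeated points removed.\<close>
  define ys where "ys = (if s = 0 then [] else [0::real])"
  define zs where "zs = (if t = 1 then [] else [1::real])"
  define xs where "xs = ys @ s # t # zs"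
  have sorted: "sorted_wrt (<) xs" using st by (auto simp: xs_def ys_def zs_def)
  define n where "n = length xs - 1"
  have len: "length xs = Suc n" by (simp add: n_def xs_def)
  have "xs ! 0 = 0" by (auto simp: xs_def ys_def)
  moreover have "xs ! n = 1" by (auto simp: n_def xs_def ys_def zs_def)
  moreover have "strict_mono_on {..n} (nth xs)"
    using sorted_wrt_nth_less[OF sorted] len by (intro strict_mono_onI) auto
  ultimately have mem: "(\<Sum>i<n. norm (A (xs ! i) (xs ! Suc i)) powr r) \<in> var_sums r A"
    unfolding var_sums_def by blast
  have idx: "length ys \<in> {..<n}" "xs ! length ys = s" "xs ! Suc (length ys) = t"
    by (auto simp: n_def xs_def nth_append)
  have "norm (A s t) powr r \<le> (\<Sum>i<n. norm (A (xs ! i) (xs ! Suc i)) powr r)"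
    using member_le_sum[OF idx(1), of "\<lambda>i. norm (A (xs ! i) (xs ! Suc i)) powr r"] idx by simp
  also have "\<dots> \<le> Sup (var_sums r A)"
    using mem fin by (intro cSup_upper) (auto simp: finite_var_def)
  finally have "(norm (A s t) powr r) powr (1 / r) \<le> var_norm r A"
    unfolding var_norm_def using \<open>r > 0\<close> by (intro powr_mono2) auto
  then show ?thesis using \<open>r > 0\<close> by (simp add: powr_powr)
qed

lemma powr_add_le:
  fixes a b r :: real
  assumes "0 \<le> a" "0 \<le> b" "0 \<le> r"
  shows "(a + b) powr r \<le> 2 powr r * (a powr r + b powr r)"
proof -
  have "(a + b) powr r \<le> (2 * max a b) powr r" using assms by (intro powr_mono2) auto
  also have "\<dots> = 2 powr r * max a b powr r" using assms by (simp add: powr_mult)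
  also have "\<dots> \<le> 2 powr r * (a powr r + b powr r)"
    by (intro mult_left_mono) (auto simp: max_def)
  finally show ?thesis .
qed

lemma finite_var_diff:
  assumes A: "finite_var r A" and B: "finite_var r B" and "0 \<le> r"
  shows "finite_var r (\<lambda>s t. A s t - B s t)"
proof -
  obtain K L where K: "\<And>S. S \<in> var_sums r A \<Longrightarrow> S \<le> K" and L: "\<And>S. S \<in> var_sums r B \<Longrightarrow> S \<le> L"
    using A B unfolding finite_var_def bdd_above_def by blast
  have "S \<le> 2 powr r * (K + L)" if S: "S \<in> var_sums r (\<lambda>s t. A s t - B s t)" for S
  proof -
    obtain n \<tau> where S_eq: "S = (\<Sum>i<n. norm (A (\<tau> i) (\<tau> (Suc i)) - B (\<tau> i) (\<tau> (Suc i))) powr r)"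
      and \<tau>: "\<tau> 0 = 0" "\<tau> n = 1" "strict_mono_on {..n} \<tau>"
      using S unfolding var_sums_def by blast
    have "S \<le> (\<Sum>i<n. 2 powr r * (norm (A (\<tau> i) (\<tau> (Suc i))) powr r + norm (B (\<tau> i) (\<tau> (Suc i))) powr r))"
      unfolding S_eq
    proof (rule sum_mono)
      fix i
      have "norm (A (\<tau> i) (\<tau> (Suc i)) - B (\<tau> i) (\<tau> (Suc i))) powr r
          \<le> (norm (A (\<tau> i) (\<tau> (Suc i))) + norm (B (\<tau> i) (\<tau> (Suc i)))) powr r"
        using \<open>0 \<le> r\<close> by (intro powr_mono2 norm_triangle_ineq4) auto
      also have "\<dots> \<le> 2 powr r * (norm (A (\<tau> i) (\<tau> (Suc i))) powr r + norm (B (\<tau> i) (\<tau> (Suc i))) powr r)"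
        using \<open>0 \<le> r\<close> by (intro powr_add_le) auto
      finally show "norm (A (\<tau> i) (\<tau> (Suc i)) - B (\<tau> i) (\<tau> (Suc i))) powr r \<le> \<dots>" .
    qed
    also have "\<dots> = 2 powr r * ((\<Sum>i<n. norm (A (\<tau> i) (\<tau> (Suc i))) powr r)
        + (\<Sum>i<n. norm (B (\<tau> i) (\<tau> (Suc i))) powr r))"
      by (simp only: sum_distrib_left sum.distrib distrib_left)
    also have "\<dots> \<le> 2 powr r * (K + L)"
      using \<tau> by (intro mult_left_mono add_mono K L) (auto simp: var_sums_def)
    finally show ?thesis .
  qed
  then show ?thesis unfolding finite_var_def bdd_above_def by blast
qed

text \<open>
  A finite variation norm dominates the pointwise norm, so a limit in \<open>d\<^sub>p\<close> is determined on the simplex.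
  Rough paths are assumed throughout because the supremum of an unbounded set carries no information.
\<close>

lemma rough_path_limit_unique:
  assumes "p > 0" and X: "\<And>m. rough_path p (X m)" and Y: "rough_path p Y" and Z: "rough_path p Z"
    and XY: "(\<lambda>m. rp_dist p (X m) Y) \<longlonglongrightarrow> 0" and XZ: "(\<lambda>m. rp_dist p (X m) Z) \<longlonglongrightarrow> 0"
    and st: "0 \<le> s" "s \<le> t" "t \<le> 1"
  shows "Y s t = Z s t"
proof (cases "s = t")
  case True
  have "multiplicative Y" "multiplicative Z" using Y Z by (auto simp: rough_path_iff)
  then show ?thesis using True st by (simp add: tensor2_eq_iff multiplicative_diag multiplicative_lev0)
next
  case False
  then have "s < t" using st by simp
  have lim: "(\<lambda>m. lev1 (X m s t)) \<longlonglongrightarrow> lev1 (W s t) \<and> (\<lambda>m. lev2 (X m s t)) \<longlonglongrightarrow> lev2 (W s t)"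
    if W: "rough_path p W" and XW: "(\<lambda>m. rp_dist p (X m) W) \<longlonglongrightarrow> 0" for W
  proof -
    have "norm (lev1 (X m s t) - lev1 (W s t)) \<le> var_norm p (\<lambda>s t. lev1 (X m s t) - lev1 (W s t))" for m
      using X[of m] W \<open>p > 0\<close> st \<open>s < t\<close>
      by (intro norm_le_var_norm[of p "\<lambda>s t. lev1 (X m s t) - lev1 (W s t)"] finite_var_diff)
        (auto simp: rough_path_iff)
    then have 1: "norm (lev1 (X m s t) - lev1 (W s t)) \<le> rp_dist p (X m) W" for m
      unfolding rp_dist_def by (rule order_trans) (simp add: var_norm_nonneg)
    have "norm (lev2 (X m s t) - lev2 (W s t)) \<le> var_norm (p / 2) (\<lambda>s t. lev2 (X m s t) - lev2 (W s t))" for m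
      using X[of m] W \<open>p > 0\<close> st \<open>s < t\<close>
      by (intro norm_le_var_norm[of "p / 2" "\<lambda>s t. lev2 (X m s t) - lev2 (W s t)"] finite_var_diff)
        (auto simp: rough_path_iff)
    then have 2: "norm (lev2 (X m s t) - lev2 (W s t)) \<le> rp_dist p (X m) W" for m
      unfolding rp_dist_def by (rule order_trans) (simp add: var_norm_nonneg)
    show ?thesis
      using 1 2 by (auto intro!: LIM_zero_cancel[OF Lim_null_comparison[OF _ XW]])
  qed
  have "lev1 (Y s t) = lev1 (Z s t)" "lev2 (Y s t) = lev2 (Z s t)"
    using lim[OF Y XY] lim[OF Z XZ] LIMSEQ_unique by blast+
  moreover have "lev0 (Y s t) = lev0 (Z s t)"
    using Y Z st by (simp add: rough_path_iff multiplicative_lev0)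
  ultimately show ?thesis by (simp add: tensor2_eq_iff)
qed

abbreviation on_cell :: "(real \<Rightarrow> real \<Rightarrow> 'a) \<Rightarrow> nat \<Rightarrow> nat \<Rightarrow> 'a" where
  "on_cell f n k \<equiv> f (real k / 2 ^ n) ((real k + 1) / 2 ^ n)"

section \<open>The lift of a polygonal path\<close>

text \<open>
  What the lift requires of a path: the Lipschitz bound gives finite variation of the first level, and a
  primitive identifies a coordinate of the second level on all subintervals at once, which reduces the Chen relation
  to the additivity of increments.
\<close>

definition regular_path :: "(real \<Rightarrow> real ^ 'd::finite) \<Rightarrow> bool" where
  "regular_path y \<longleftrightarrow>
     (\<exists>L. L-lipschitz_on {0..1} y) \<and>
     (\<forall>i j. \<exists>F C. rs_primitive C (\<lambda>t. y t $ i) (\<lambda>t. y t $ j) F 0 1)"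

lemma regular_path_dyadic_interp: "regular_path (dyadic_interp m x)"
  unfolding regular_path_def using dyadic_interp_lipschitz dyadic_interp_primitive by blast

lemma lev_smooth_lift [simp]:
  "lev0 (smooth_lift y s t) = 1" "lev1 (smooth_lift y s t) = y t - y s"
  by (simp_all add: smooth_lift_def)

lemma lev2_smooth_lift:
  assumes y: "L-lipschitz_on {0..1} y" and prim: "rs_primitive C (\<lambda>t. y t $ i) (\<lambda>t. y t $ j) F a b"
    and st: "a \<le> s" "s \<le> t" "t \<le> b" "0 \<le> s" "t \<le> 1"
  shows "lev2 (smooth_lift y s t) $ i $ j = F t - F s - y s $ i * (y t $ j - y s $ j)"
proof -
  have "rs_integral (\<lambda>r. y r $ i - y s $ i) (\<lambda>r. y r $ j) s t
      = (F t - y s $ i * y t $ j) - (F s - y s $ i * y s $ j)"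
  proof (rule rs_integral_primitive[OF rs_primitive_shift[OF rs_primitive_subinterval[OF prim]]])
    have "L-lipschitz_on {s..t} (\<lambda>r. y r $ k)" for k
      by (rule lipschitz_on_subset[OF lipschitz_component[OF y]]) (use st in auto)
    then show "L-lipschitz_on {s..t} (\<lambda>r. y r $ j)" "L-lipschitz_on {s..t} (\<lambda>r. y r $ i - y s $ i)"
      by (simp_all add: lipschitz_on_def dist_real_def)
  qed (use st in auto)
  then show ?thesis by (simp add: smooth_lift_def algebra_simps)
qed

lemma multiplicative_smooth_lift:
  assumes "regular_path y"
  shows "multiplicative (smooth_lift y)"
proof (rule multiplicativeI)
  fix s u t :: real assume *: "0 \<le> s" "s \<le> u" "u \<le> t" "t \<le> 1"
  have "lev2 (smooth_lift y s t) $ i $ j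
      = (lev2 (smooth_lift y s u) + lev2 (smooth_lift y u t) + outer (y u - y s) (y t - y u)) $ i $ j"
    for i j
  proof -
    obtain L F C where L: "L-lipschitz_on {0..1} y" and prim: "rs_primitive C (\<lambda>t. y t $ i) (\<lambda>t. y t $ j) F 0 1"
      using assms unfolding regular_path_def by blast
    show ?thesis
      using * by (simp add: lev2_smooth_lift[OF L prim] outer_def algebra_simps)
  qed
  then show "lev2 (smooth_lift y s t) = lev2 (smooth_lift y s u) + lev2 (smooth_lift y u t)
      + outer (lev1 (smooth_lift y s u)) (lev1 (smooth_lift y u t))"
    by (simp add: vec_eq_iff)
qed simp_all

lemma norm_matrix_le: "norm (A :: real ^ 'd ^ 'e::finite) \<le> (\<Sum>i\<in>UNIV. \<Sum>j\<in>UNIV. \<bar>A $ i $ j\<bar>)"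
proof -
  have "norm A \<le> (\<Sum>i\<in>UNIV. norm (A $ i))"
    unfolding norm_vec_def[of A] by (rule L2_set_le_sum) simp
  also have "\<dots> \<le> (\<Sum>i\<in>UNIV. \<Sum>j\<in>UNIV. \<bar>A $ i $ j\<bar>)"
    by (intro sum_mono norm_le_l1_cart)
  finally show ?thesis .
qed

text \<open>
  The estimate that defines a primitive is precisely a quadratic bound for the second level.
\<close>

lemma smooth_lift_quadratic_bound:
  assumes "regular_path y"
  obtains K where "0 \<le> K"
    "\<And>s t. 0 \<le> s \<Longrightarrow> s \<le> t \<Longrightarrow> t \<le> 1 \<Longrightarrow> norm (lev1 (smooth_lift y s t)) \<le> K * (t - s)"
    "\<And>s t. 0 \<le> s \<Longrightarrow> s \<le> t \<Longrightarrow> t \<le> 1 \<Longrightarrow> norm (lev2 (smooth_lift y s t)) \<le> K * (t - s)\<^sup>2"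
proof -
  obtain L where L: "L-lipschitz_on {0..1} y" using assms unfolding regular_path_def by blast
  have L0: "0 \<le> L" using L by (rule lipschitz_on_nonneg)
  obtain F C where prim: "\<And>i j. rs_primitive (C i j) (\<lambda>t. y t $ i) (\<lambda>t. y t $ j) (F i j) 0 1"
    using assms unfolding regular_path_def by metis
  have C0: "0 \<le> C i j" for i j using prim unfolding rs_primitive_def by blast
  define D where "D = (\<Sum>i\<in>UNIV. \<Sum>j\<in>UNIV. C i j)"
  have D0: "0 \<le> D" unfolding D_def by (intro sum_nonneg C0)
  show ?thesis
  proof (rule that[of "L + D"])
    show "0 \<le> L + D" using L0 D0 by simp
    fix s t :: real assume st: "0 \<le> s" "s \<le> t" "t \<le> 1"
    have "norm (y t - y s) \<le> L * (t - s)"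
      using lipschitz_onD[OF L, of t s] st by (simp add: dist_norm)
    also have "\<dots> \<le> (L + D) * (t - s)" using D0 st by (intro mult_right_mono) auto
    finally show "norm (lev1 (smooth_lift y s t)) \<le> (L + D) * (t - s)" by simp
    have "\<bar>lev2 (smooth_lift y s t) $ i $ j\<bar> \<le> C i j * (t - s)\<^sup>2" for i j
      using rs_primitiveD[OF prim, of s t i j] st by (simp add: lev2_smooth_lift[OF L prim])
    then have "norm (lev2 (smooth_lift y s t)) \<le> (\<Sum>i\<in>UNIV. \<Sum>j\<in>UNIV. C i j * (t - s)\<^sup>2)"
      by (intro order_trans[OF norm_matrix_le] sum_mono)
    also have "\<dots> = D * (t - s)\<^sup>2" by (simp add: D_def sum_distrib_right)
    also have "\<dots> \<le> (L + D) * (t - s)\<^sup>2" using L0 by (intro mult_right_mono) auto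
    finally show "norm (lev2 (smooth_lift y s t)) \<le> (L + D) * (t - s)\<^sup>2" .
  qed
qed

text \<open>
  A primitive is itself Lipschitz, so the lift is a polynomial in continuous functions of the end points.
\<close>

lemma continuous_smooth_lift:
  assumes "regular_path y"
  shows "continuous_on simplex01 (\<lambda>(s, t). smooth_lift y s t)"
proof -
  obtain L where L: "L-lipschitz_on {0..1} y" using assms unfolding regular_path_def by blast
  obtain F C where prim: "\<And>i j. rs_primitive (C i j) (\<lambda>t. y t $ i) (\<lambda>t. y t $ j) (F i j) 0 1"
    using assms unfolding regular_path_def by metis
  have C0: "0 \<le> C i j" for i j using prim unfolding rs_primitive_def by blast
  have y: "continuous_on {0..1} y" using L by (rule lipschitz_on_continuous_on)
  have bound: "norm (y r) \<le> norm (y 0) + L" if "r \<in> {0..1}" for r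
  proof -
    have "norm (y r - y 0) \<le> L * \<bar>r\<bar>" using lipschitz_onD[OF L, of r 0] that by (simp add: dist_norm)
    also have "\<dots> \<le> L * 1" using that lipschitz_on_nonneg[OF L] by (intro mult_left_mono) auto
    finally show ?thesis using norm_triangle_sub[of "y r" "y 0"] by simp
  qed
  have F_lip: "\<exists>K. K-lipschitz_on {0..1} (F i j)" for i j
  proof -
    define K where "K = C i j + (norm (y 0) + L) * L"
    have K0: "0 \<le> K" unfolding K_def using C0 lipschitz_on_nonneg[OF L] by simp
    have "dist (F i j u) (F i j v) \<le> K * dist u v" if "u \<in> {0..1}" "v \<in> {0..1}" "u \<le> v" for u v
    proof -
      have uv: "0 \<le> u" "u \<le> v" "v \<le> 1" using that by auto
      have "\<bar>F i j v - F i j u - y u $ i * (y v $ j - y u $ j)\<bar> \<le> C i j * (v - u)\<^sup>2"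
        using rs_primitiveD[OF prim, of u v i j] uv by simp
      also have "\<dots> \<le> C i j * (v - u)"
        using C0 uv unfolding power2_eq_square by (intro mult_left_mono mult_left_le) auto
      finally have 1: "\<bar>F i j v - F i j u - y u $ i * (y v $ j - y u $ j)\<bar> \<le> C i j * (v - u)" .
      have "\<bar>y v $ j - y u $ j\<bar> \<le> L * (v - u)"
        using lipschitz_onD[OF lipschitz_component[OF L], of v u j] uv by (simp add: dist_real_def)
      moreover have "\<bar>y u $ i\<bar> \<le> norm (y 0) + L"
        using bound[of u] component_le_norm_cart[of "y u" i] uv by simp
      ultimately have 2: "\<bar>y u $ i * (y v $ j - y u $ j)\<bar> \<le> (norm (y 0) + L) * (L * (v - u))"
        unfolding abs_mult by (intro mult_mono) auto
      have "\<bar>F i j v - F i j u\<bar> \<le> C i j * (v - u) + (norm (y 0) + L) * (L * (v - u))"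
        using 1 2 by linarith
      also have "\<dots> = K * (v - u)" by (simp add: K_def algebra_simps)
      finally show ?thesis using uv by (simp add: dist_real_def abs_minus_commute)
    qed
    then have "K-lipschitz_on {0..1} (F i j)" using K0 by (intro lipschitz_on_leI) auto
    then show ?thesis by blast
  qed
  have F: "continuous_on {0..1} (F i j)" for i j
    using F_lip[of i j] lipschitz_on_continuous_on by blast
  have fst: "continuous_on simplex01 (\<lambda>z. f (fst z))" and snd: "continuous_on simplex01 (\<lambda>z. f (snd z))"
    if "continuous_on {0..1} f" for f :: "real \<Rightarrow> 'b::topological_space"
    by (rule continuous_on_compose2[OF that]; force simp: simplex01_def intro!: continuous_intros)+
  have "continuous_on simplex01 (\<lambda>z. (1, y (snd z) - y (fst z),
      \<chi> i j. F i j (snd z) - F i j (fst z) - y (fst z) $ i * (y (snd z) $ j - y (fst z) $ j)))"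
    by (intro continuous_intros continuous_on_vec_lambda fst[OF F] snd[OF F] fst[OF y] snd[OF y]
        continuous_on_component)
  then show ?thesis
  proof (rule continuous_on_eq)
    fix z assume "z \<in> simplex01"
    then show "(1, y (snd z) - y (fst z),
        \<chi> i j. F i j (snd z) - F i j (fst z) - y (fst z) $ i * (y (snd z) $ j - y (fst z) $ j))
        = (case z of (s, t) \<Rightarrow> smooth_lift y s t)"
      by (auto simp: tensor2_eq_iff simplex01_def vec_eq_iff lev2_smooth_lift[OF L prim])
  qed
qed

lemma rough_path_smooth_lift:
  assumes y: "regular_path y" and "1 \<le> p"
  shows "rough_path p (smooth_lift y)"
proof -
  obtain K where K: "0 \<le> K"
    "\<And>s t. 0 \<le> s \<Longrightarrow> s \<le> t \<Longrightarrow> t \<le> 1 \<Longrightarrow> norm (lev1 (smooth_lift y s t)) \<le> K * (t - s)"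
    "\<And>s t. 0 \<le> s \<Longrightarrow> s \<le> t \<Longrightarrow> t \<le> 1 \<Longrightarrow> norm (lev2 (smooth_lift y s t)) \<le> K * (t - s)\<^sup>2"
    using smooth_lift_quadratic_bound[OF y] by blast
  have le: "h powr p \<le> h" if "0 \<le> h" "h \<le> 1" for h :: real
    using powr_mono'[of 1 p h] that \<open>1 \<le> p\<close> by (cases "h = 0") auto
  have ctrl: "control (\<lambda>s t. 1 * (t - s))" by (rule control_length) simp
  have "finite_var p (\<lambda>s t. lev1 (smooth_lift y s t))"
  proof (rule finite_var_control[OF ctrl, of "K powr p"])
    fix s t :: real assume st: "0 \<le> s" "s \<le> t" "t \<le> 1"
    have "norm (lev1 (smooth_lift y s t)) powr p \<le> (K * (t - s)) powr p"
      using K(2)[OF st] \<open>1 \<le> p\<close> by (intro powr_mono2) auto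
    also have "\<dots> \<le> K powr p * (1 * (t - s))"
      using K(1) st le[of "t - s"] by (simp add: powr_mult mult_left_mono)
    finally show "norm (lev1 (smooth_lift y s t)) powr p \<le> K powr p * (1 * (t - s))" .
  qed simp
  moreover have "finite_var (p / 2) (\<lambda>s t. lev2 (smooth_lift y s t))"
  proof (rule finite_var_control[OF ctrl, of "K powr (p / 2)"])
    fix s t :: real assume st: "0 \<le> s" "s \<le> t" "t \<le> 1"
    have "norm (lev2 (smooth_lift y s t)) powr (p / 2) \<le> (K * (t - s)\<^sup>2) powr (p / 2)"
      using K(3)[OF st] \<open>1 \<le> p\<close> by (intro powr_mono2) auto
    also have "\<dots> = K powr (p / 2) * (t - s) powr p"
      using K(1) st by (simp add: powr_mult powr_powr flip: powr_numeral)
    also have "\<dots> \<le> K powr (p / 2) * (1 * (t - s))"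
      using st le[of "t - s"] by (intro mult_left_mono) auto
    finally show "norm (lev2 (smooth_lift y s t)) powr (p / 2) \<le> K powr (p / 2) * (1 * (t - s))" .
  qed simp
  ultimately show ?thesis
    unfolding rough_path_iff
    using continuous_smooth_lift[OF y] multiplicative_smooth_lift[OF y] by blast
qed

lemma smooth_rough_path_smooth_lift:
  assumes y: "regular_path y"
  shows "smooth_rough_path (smooth_lift y)"
proof -
  obtain L where L: "L-lipschitz_on {0..1} y" using y unfolding regular_path_def by blast
  have "finite_var 1 (\<lambda>s t. y t - y s)"
  proof (rule finite_var_control[OF control_length, of 1 L])
    fix s t :: real assume "0 \<le> s" "s \<le> t" "t \<le> 1"
    then show "norm (y t - y s) powr 1 \<le> L * (1 * (t - s))"
      using lipschitz_onD[OF L, of t s] by (simp add: dist_norm)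
  qed (use lipschitz_on_nonneg[OF L] in auto)
  then show ?thesis
    unfolding smooth_rough_path_def using lipschitz_on_continuous_on[OF L] by blast
qed

text \<open>For affine coordinates the primitive is an explicit quadratic polynomial.\<close>

lemma lev2_smooth_lift_cell:
  assumes l: "l < 2 ^ m" and s: "real l / 2 ^ m \<le> s" and "s \<le> t" and t: "t \<le> (real l + 1) / 2 ^ m"
  shows "lev2 (smooth_lift (dyadic_interp m x) s t)
    = (1 / 2) *\<^sub>R outer (dyadic_interp m x t - dyadic_interp m x s)
        (dyadic_interp m x t - dyadic_interp m x s)"
proof -
  define a where "a = real l / 2 ^ m"
  define b where "b = (real l + 1) / 2 ^ m"
  define d where "d = x b - x a"
  have aff: "dyadic_interp m x r $ k = x a $ k + (2 ^ m * d $ k) * (r - a)" if "a \<le> r" "r \<le> b" for r k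
    using that unfolding a_def b_def
    by (subst dyadic_interp_cell[of l]) (auto simp: d_def a_def b_def field_simps)
  have "0 \<le> a" "b \<le> 1" using dyadic_endpoints[OF l] by (simp_all add: a_def b_def)
  moreover have "a \<le> s" "t \<le> b" using assms by (simp_all add: a_def b_def)
  ultimately have ab: "a \<le> s" "s \<le> t" "t \<le> b" "0 \<le> s" "t \<le> 1" using \<open>s \<le> t\<close> by linarith+
  obtain L where L: "L-lipschitz_on {0..1} (dyadic_interp m x)" using dyadic_interp_lipschitz by blast
  have "lev2 (smooth_lift (dyadic_interp m x) s t) $ i $ j
      = ((1 / 2) *\<^sub>R outer (dyadic_interp m x t - dyadic_interp m x s)
        (dyadic_interp m x t - dyadic_interp m x s)) $ i $ j" for i j
    by (subst lev2_smooth_lift[OF L rs_primitive_affine[OF aff aff] ab])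
      (use ab in \<open>simp_all add: aff outer_def power2_eq_square field_simps\<close>)
  then show ?thesis by (simp add: vec_eq_iff)
qed

lemma borel_measurable_outer:
  fixes f g :: "'w \<Rightarrow> real ^ 'd::finite"
  assumes "f \<in> borel_measurable M" "g \<in> borel_measurable M"
  shows "(\<lambda>\<omega>. outer (f \<omega>) (g \<omega>)) \<in> borel_measurable M"
  by (rule borel_measurable_continuous_Pair[OF assms])
    (intro bounded_bilinear.continuous_on[OF bounded_bilinear_outer] continuous_intros)

lemma borel_measurable_dyadic_interp:
  fixes x :: "'w \<Rightarrow> real \<Rightarrow> real ^ 'd::finite"
  assumes x: "\<And>t. 0 \<le> t \<Longrightarrow> t \<le> 1 \<Longrightarrow> (\<lambda>\<omega>. x \<omega> t) \<in> borel_measurable M"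
    and t: "0 \<le> t" "t \<le> 1"
  shows "(\<lambda>\<omega>. dyadic_interp m (x \<omega>) t) \<in> borel_measurable M"
proof -
  obtain l where l: "l < 2 ^ m" "real l / 2 ^ m \<le> t" "t \<le> (real l + 1) / 2 ^ m"
    using ex_dyadic_cell[OF t] by blast
  note dyadic_endpoints[OF l(1)]
  then have "(\<lambda>\<omega>. x \<omega> (real l / 2 ^ m)) \<in> borel_measurable M"
    "(\<lambda>\<omega>. x \<omega> ((real l + 1) / 2 ^ m)) \<in> borel_measurable M"
    by (simp_all add: x)
  then show ?thesis unfolding dyadic_interp_cell[OF l(2,3)] by measurable
qed

text \<open>
  Measurability in \<open>\<omega>\<close> is not visible from the Riemann--Stieltjes integral. The Chen relation and
  the formula on cells express the second level, cell after cell, as a polynomial in finitely many values of the path.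
\<close>

lemma borel_measurable_smooth_lift:
  fixes x :: "'w \<Rightarrow> real \<Rightarrow> real ^ 'd::finite"
  assumes x: "\<And>t. 0 \<le> t \<Longrightarrow> t \<le> 1 \<Longrightarrow> (\<lambda>\<omega>. x \<omega> t) \<in> borel_measurable M"
    and st: "0 \<le> s" "s \<le> t" "t \<le> 1"
  shows "(\<lambda>\<omega>. smooth_lift (dyadic_interp m (x \<omega>)) s t) \<in> borel_measurable M"
proof -
  let ?y = "\<lambda>\<omega>. dyadic_interp m (x \<omega>)"
  let ?X = "\<lambda>\<omega>. smooth_lift (?y \<omega>)"
  have y: "(\<lambda>\<omega>. ?y \<omega> r) \<in> borel_measurable M" if "0 \<le> r" "r \<le> 1" for r
    by (rule borel_measurable_dyadic_interp[OF _ that]) (rule x)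
  have mult: "multiplicative (?X \<omega>)" for \<omega>
    by (rule multiplicative_smooth_lift[OF regular_path_dyadic_interp])
  have extend: "(\<lambda>\<omega>. lev2 (?X \<omega> 0 r)) \<in> borel_measurable M"
    if q: "(\<lambda>\<omega>. lev2 (?X \<omega> 0 q)) \<in> borel_measurable M"
      and l: "l < 2 ^ m" "real l / 2 ^ m \<le> q" "r \<le> (real l + 1) / 2 ^ m" and qr: "0 \<le> q" "q \<le> r" "r \<le> 1"
    for q r l
  proof -
    have eq: "lev2 (?X \<omega> 0 r) = lev2 (?X \<omega> 0 q)
        + (1 / 2) *\<^sub>R outer (?y \<omega> r - ?y \<omega> q) (?y \<omega> r - ?y \<omega> q)
        + outer (?y \<omega> q - ?y \<omega> 0) (?y \<omega> r - ?y \<omega> q)" for \<omega>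
      using multiplicative_lev(2)[OF mult, of 0 q r] qr lev2_smooth_lift_cell[OF l(1,2) qr(2) l(3), of "x \<omega>"]
      by simp
    show ?thesis unfolding eq
      using qr by (intro borel_measurable_add borel_measurable_scaleR borel_measurable_outer
          borel_measurable_diff y q borel_measurable_const) auto
  qed
  have grid: "(\<lambda>\<omega>. lev2 (?X \<omega> 0 (real l / 2 ^ m))) \<in> borel_measurable M" if "l \<le> 2 ^ m" for l
    using that
  proof (induction l)
    case 0
    then show ?case using multiplicative_diag[OF mult, of 0] by simp
  next
    case (Suc l)
    have "real (Suc l) \<le> 2 ^ m" using Suc.prems by (simp del: of_nat_Suc)
    then have 1: "real (Suc l) / 2 ^ m \<le> 1" by simp
    have 2: "real l / 2 ^ m \<le> real (Suc l) / 2 ^ m" by (simp add: divide_right_mono)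
    have "(\<lambda>\<omega>. lev2 (?X \<omega> 0 (real l / 2 ^ m))) \<in> borel_measurable M" using Suc by simp
    then show ?case by (rule extend[OF _ _ order_refl _ _ 2 1]) (use Suc.prems in \<open>simp_all add: add.commute\<close>)
  qed
  have start: "(\<lambda>\<omega>. lev2 (?X \<omega> 0 r)) \<in> borel_measurable M" if r: "0 \<le> r" "r \<le> 1" for r
  proof -
    obtain l where l: "l < 2 ^ m" "real l / 2 ^ m \<le> r" "r \<le> (real l + 1) / 2 ^ m"
      using ex_dyadic_cell[OF r] by blast
    show ?thesis by (rule extend[OF grid l(1) order_refl l(3) _ l(2) r(2)]) (use l(1) in simp_all)
  qed
  have eq: "?X \<omega> s t = (1, ?y \<omega> t - ?y \<omega> s,
      lev2 (?X \<omega> 0 t) - lev2 (?X \<omega> 0 s) - outer (?y \<omega> s - ?y \<omega> 0) (?y \<omega> t - ?y \<omega> s))" for \<omega>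
    using multiplicative_lev(2)[OF mult, of 0 s t] st by (simp add: tensor2_eq_iff)
  show ?thesis unfolding eq
    using st by (intro borel_measurable_Pair borel_measurable_diff borel_measurable_outer start y
        borel_measurable_const) auto
qed

section \<open>Chaining along dyadic intervals\<close>

definition dyadic_edge :: "nat \<Rightarrow> real \<Rightarrow> real \<Rightarrow> bool" where
  "dyadic_edge n u v \<longleftrightarrow> u = v \<or> (\<exists>k<2 ^ n. u = real k / 2 ^ n \<and> v = (real k + 1) / 2 ^ n)"

text \<open>
  An interval with end points on the grid of level \<open>N + 1\<close> is an interval with end points on the
  grid of level \<open>N\<close> and at most one cell of level \<open>N + 1\<close> on either side. So every interval
  with dyadic end points is a chain with at most two cells of each level, which is what makes geometric decay in the level summable.
\<close>

lemma dyadic_chain_induct [consumes 2, case_names diag unit step]: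
  assumes "a \<le> b" "b \<le> 2 ^ N"
    and diag: "\<And>n s. 0 \<le> s \<Longrightarrow> s \<le> 1 \<Longrightarrow> P n s s"
    and unit: "P 0 0 1"
    and step: "\<And>n s s' t' t. dyadic_edge (Suc n) s s' \<Longrightarrow> dyadic_edge (Suc n) t' t \<Longrightarrow> P n s' t' \<Longrightarrow>
      0 \<le> s \<Longrightarrow> s \<le> s' \<Longrightarrow> s' \<le> t' \<Longrightarrow> t' \<le> t \<Longrightarrow> t \<le> 1 \<Longrightarrow> P (Suc n) s t"
  shows "P N (real a / 2 ^ N) (real b / 2 ^ N)"
  using assms(1,2)
proof (induction N arbitrary: a b)
  case 0
  then consider "a = b" | "a = 0" "b = 1" by fastforce
  then show ?case
  proof cases
    case 1
    then show ?thesis using 0 diag[of "real b"] by simp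
  next
    case 2
    then show ?thesis using unit by simp
  qed
next
  case (Suc N)
  define h :: real where "h = 2 ^ Suc N"
  have h: "h > 0" by (simp add: h_def)
  have half: "real k / 2 ^ N = real (2 * k) / h" for k by (simp add: h_def)
  have "real b \<le> h" using Suc.prems(2) unfolding h_def
    by (metis of_nat_le_iff of_nat_numeral of_nat_power)
  then have b1: "real b / h \<le> 1" using h by simp
  show ?case
  proof (cases "a = b")
    case True
    then show ?thesis using diag[of "real b / h"] b1 h by (simp add: h_def)
  next
    case False
    define a' where "a' = (a + 1) div 2"
    define b' where "b' = b div 2"
    have "a < b" using False Suc.prems by simp
    have a': "2 * a' = a \<or> 2 * a' = a + 1" and b': "2 * b' = b \<or> 2 * b' + 1 = b"
      by (auto simp: a'_def b'_def)
    have le: "a' \<le> b'" using \<open>a < b\<close> a' b' by linarith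
    have "b' \<le> 2 ^ N" using Suc.prems(2) by (simp add: b'_def)
    have IH: "P N (real a' / 2 ^ N) (real b' / 2 ^ N)" by (rule Suc.IH[OF le \<open>b' \<le> 2 ^ N\<close>])
    have "dyadic_edge (Suc N) (real a / h) (real (2 * a') / h)"
      using a'
    proof
      assume "2 * a' = a + 1"
      moreover have "a < 2 ^ Suc N" using \<open>a < b\<close> Suc.prems(2) by simp
      ultimately show ?thesis unfolding dyadic_edge_def h_def
        by (intro disjI2 exI[of _ a]) (simp only: of_nat_add of_nat_1 simp_thms)
    qed (simp add: dyadic_edge_def)
    moreover have "dyadic_edge (Suc N) (real (2 * b') / h) (real b / h)"
      using b'
    proof
      assume *: "2 * b' + 1 = b"
      then have "2 * b' < 2 ^ Suc N" using Suc.prems(2) by simp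
      moreover have "real b = real (2 * b') + 1" using * by simp
      ultimately show ?thesis unfolding dyadic_edge_def h_def
        by (intro disjI2 exI[of _ "2 * b'"]) (simp only: simp_thms)
    qed (simp add: dyadic_edge_def)
    moreover have "real a / h \<le> real (2 * a') / h" "real (2 * a') / h \<le> real (2 * b') / h"
      "real (2 * b') / h \<le> real b / h"
      using a' b' le h by (auto intro!: divide_right_mono)
    ultimately have "P (Suc N) (real a / h) (real b / h)"
      using IH b1 h unfolding half by (intro step) auto
    then show ?thesis by (simp add: h_def)
  qed
qed

lemma norm_triangle3: "norm (a + b + c) \<le> norm a + norm b + norm c"
  by (rule norm_triangle_le[OF add_right_mono[OF norm_triangle_ineq]])

lemma norm_triangle5: "norm (a + b + c + d + e) \<le> norm a + norm b + norm c + norm d + norm e"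
  by (rule norm_triangle_le[OF add_right_mono[OF norm_triangle_le[OF add_right_mono[OF norm_triangle3]]]])

text \<open>
  The gauge stands for the \<open>p\<close>-th root of a control, of which chaining uses the monotonicity;
  \<open>\<rho>\<close> is the rate of decay over the dyadic levels.
\<close>

locale interval_gauge =
  fixes g :: "real \<Rightarrow> real \<Rightarrow> real" and \<rho> :: real
  assumes gauge_nonneg: "0 \<le> s \<Longrightarrow> s \<le> t \<Longrightarrow> t \<le> 1 \<Longrightarrow> 0 \<le> g s t"
    and gauge_mono: "0 \<le> s \<Longrightarrow> s \<le> s' \<Longrightarrow> s' \<le> t' \<Longrightarrow> t' \<le> t \<Longrightarrow> t \<le> 1 \<Longrightarrow> g s' t' \<le> g s t"
    and ratio: "0 < \<rho>" "\<rho> < 1"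
begin

lemma geometric_partial_sum_le: "(\<Sum>n\<le>N. \<rho> ^ n) \<le> 1 / (1 - \<rho>)"
proof -
  have "(\<Sum>n\<le>N. \<rho> ^ n) \<le> (\<Sum>n. \<rho> ^ n)"
    using ratio by (intro sum_le_suminf summable_geometric) auto
  then show ?thesis using ratio by (simp add: suminf_geometric)
qed

lemma edge_bound:
  fixes f :: "real \<Rightarrow> real \<Rightarrow> 'a::real_normed_vector"
  assumes edge: "dyadic_edge n u v" and uv: "0 \<le> s" "s \<le> u" "u \<le> v" "v \<le> t" "t \<le> 1"
    and diag: "f u u = 0" and "0 \<le> c"
    and cell: "\<And>k. k < 2 ^ n \<Longrightarrow> norm (on_cell f n k)
      \<le> c * on_cell g n k ^ q"
  shows "norm (f u v) \<le> c * g s t ^ q"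
proof -
  have g: "0 \<le> g u v" "g u v \<le> g s t" using uv by (auto intro!: gauge_nonneg gauge_mono)
  have "norm (f u v) \<le> c * g u v ^ q"
    using edge unfolding dyadic_edge_def
  proof
    assume "u = v" then show ?thesis using diag g \<open>0 \<le> c\<close> by simp
  next
    assume "\<exists>k<2 ^ n. u = real k / 2 ^ n \<and> v = (real k + 1) / 2 ^ n"
    then show ?thesis using cell by blast
  qed
  also have "\<dots> \<le> c * g s t ^ q" using g \<open>0 \<le> c\<close> by (intro mult_left_mono power_mono) auto
  finally show ?thesis .
qed

text \<open>Shrinking the interval to dyadic end points inside it keeps the gauge on the right side.\<close>

lemma dyadic_dense_bound:
  fixes f :: "real \<Rightarrow> real \<Rightarrow> 'a::real_normed_vector"
  assumes cont: "continuous_on simplex01 (\<lambda>(s, t). f s t)"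
    and dyadic: "\<And>N a b. a \<le> b \<Longrightarrow> b \<le> 2 ^ N \<Longrightarrow>
      norm (f (real a / 2 ^ N) (real b / 2 ^ N)) \<le> c * g (real a / 2 ^ N) (real b / 2 ^ N) ^ q"
    and diag: "f s s = 0" and "0 \<le> c" and st: "0 \<le> s" "s \<le> t" "t \<le> 1"
  shows "norm (f s t) \<le> c * g s t ^ q"
proof (cases "s = t")
  case True
  then show ?thesis using diag \<open>0 \<le> c\<close> gauge_nonneg[OF st] by simp
next
  case False
  define a where "a N = nat \<lceil>2 ^ N * s\<rceil>" for N
  define b where "b N = nat \<lfloor>2 ^ N * t\<rfloor>" for N
  define s' where "s' N = real (a N) / 2 ^ N" for N
  define t' where "t' N = real (b N) / 2 ^ N" for N
  have a: "2 ^ N * s \<le> real (a N)" "real (a N) \<le> 2 ^ N * s + 1" for N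
  proof -
    have "0 \<le> 2 ^ N * s" using st by simp
    then have "real (a N) = \<lceil>2 ^ N * s\<rceil>" unfolding a_def by (simp add: ceiling_mono)
    then show "2 ^ N * s \<le> real (a N)" "real (a N) \<le> 2 ^ N * s + 1" by linarith+
  qed
  have b: "real (b N) \<le> 2 ^ N * t" "2 ^ N * t - 1 \<le> real (b N)" for N
  proof -
    have "0 \<le> 2 ^ N * t" using st by simp
    then have "real (b N) = \<lfloor>2 ^ N * t\<rfloor>" unfolding b_def by simp
    then show "real (b N) \<le> 2 ^ N * t" "2 ^ N * t - 1 \<le> real (b N)" by linarith+
  qed
  have s': "s \<le> s' N" "s' N \<le> s + (1 / 2) ^ N" for N
  proof -
    show "s \<le> s' N" using a(1)[of N] by (simp add: s'_def field_simps)
    have "s' N \<le> (2 ^ N * s + 1) / 2 ^ N" unfolding s'_def using a(2) by (intro divide_right_mono) auto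
    also have "\<dots> = s + (1 / 2) ^ N" by (simp add: add_divide_distrib power_one_over)
    finally show "s' N \<le> s + (1 / 2) ^ N" .
  qed
  have t': "t' N \<le> t" "t - (1 / 2) ^ N \<le> t' N" for N
  proof -
    show "t' N \<le> t" using b(1)[of N] by (simp add: t'_def field_simps)
    have "t - (1 / 2) ^ N = (2 ^ N * t - 1) / 2 ^ N" by (simp add: diff_divide_distrib power_one_over)
    also have "\<dots> \<le> t' N" unfolding t'_def using b(2) by (intro divide_right_mono) auto
    finally show "t - (1 / 2) ^ N \<le> t' N" .
  qed
  have half: "(\<lambda>N. (1 / 2) ^ N :: real) \<longlonglongrightarrow> 0" by (intro LIMSEQ_power_zero) simp
  have half_s: "(\<lambda>N. s + (1 / 2) ^ N) \<longlonglongrightarrow> s" and half_t: "(\<lambda>N. t - (1 / 2) ^ N) \<longlonglongrightarrow> t"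
    using tendsto_add[OF tendsto_const half, of s] tendsto_diff[OF tendsto_const half, of t] by simp_all
  have lim: "s' \<longlonglongrightarrow> s" "t' \<longlonglongrightarrow> t"
    by (rule tendsto_sandwich[OF _ _ tendsto_const half_s], simp_all add: s')
      (rule tendsto_sandwich[OF _ _ half_t tendsto_const], simp_all add: t')
  define r where "r = (s + t) / 2"
  have r: "s < r" "r < t" using False st by (auto simp: r_def)
  have ev: "\<forall>\<^sub>F N in sequentially. s' N \<le> t' N"
    using order_tendstoD(2)[OF lim(1) r(1)] order_tendstoD(1)[OF lim(2) r(2)]
    by eventually_elim linarith
  have inside: "0 \<le> s' N" "t' N \<le> 1" for N using s'[of N] t'[of N] st by linarith+
  have "((\<lambda>N. case (s' N, t' N) of (s, t) \<Rightarrow> f s t) \<longlongrightarrow> (case (s, t) of (s, t) \<Rightarrow> f s t)) sequentially"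
  proof (rule continuous_on_tendsto_compose[OF cont tendsto_Pair[OF lim]])
    show "(s, t) \<in> simplex01" using st by (simp add: simplex01_def)
    show "\<forall>\<^sub>F N in sequentially. (s' N, t' N) \<in> simplex01"
      using ev by eventually_elim (use inside in \<open>simp add: simplex01_def\<close>)
  qed
  then have "(\<lambda>N. norm (f (s' N) (t' N))) \<longlonglongrightarrow> norm (f s t)" by (intro tendsto_norm) simp
  moreover have "\<forall>\<^sub>F N in sequentially. norm (f (s' N) (t' N)) \<le> c * g s t ^ q"
    using ev
  proof eventually_elim
    case (elim N)
    have "real (a N) \<le> real (b N)" using elim by (simp add: s'_def t'_def divide_le_cancel)
    moreover have "real (b N) \<le> 2 ^ N" using inside(2)[of N] by (simp add: t'_def)
    ultimately have "norm (f (s' N) (t' N)) \<le> c * g (s' N) (t' N) ^ q"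
      unfolding s'_def t'_def by (intro dyadic) auto
    also have "\<dots> \<le> c * g s t ^ q"
      using elim inside s' t' st \<open>0 \<le> c\<close>
      by (intro mult_left_mono power_mono gauge_mono gauge_nonneg) auto
    finally show ?case .
  qed
  ultimately show ?thesis by (intro tendsto_upperbound[of _ _ sequentially]) auto
qed

text \<open>
  Each of the at most two cells of a level is measured by the gauge of the whole interval; the constant is
  twice the geometric series.
\<close>

lemma chain_level1:
  fixes f :: "real \<Rightarrow> real \<Rightarrow> 'a::real_normed_vector"
  assumes cont: "continuous_on simplex01 (\<lambda>(s, t). f s t)"
    and add: "\<And>s u t. 0 \<le> s \<Longrightarrow> s \<le> u \<Longrightarrow> u \<le> t \<Longrightarrow> t \<le> 1 \<Longrightarrow> f s t = f s u + f u t"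
    and "0 \<le> \<epsilon>"
    and cell: "\<And>n k. k < 2 ^ n \<Longrightarrow> norm (on_cell f n k)
      \<le> \<epsilon> * \<rho> ^ n * on_cell g n k"
    and st: "0 \<le> s" "s \<le> t" "t \<le> 1"
  shows "norm (f s t) \<le> \<epsilon> * (2 / (1 - \<rho>)) * g s t"
proof -
  have diag: "f s s = 0" if "0 \<le> s" "s \<le> 1" for s using add[of s s s] that by simp
  have edge: "norm (f u v) \<le> \<epsilon> * \<rho> ^ n * g s t ^ 1"
    if "dyadic_edge n u v" "0 \<le> s" "s \<le> u" "u \<le> v" "v \<le> t" "t \<le> 1" for n s u v t
    using that \<open>0 \<le> \<epsilon>\<close> ratio cell[of _ n] by (intro edge_bound[OF that diag]) auto
  have dyadic: "norm (f (real a / 2 ^ N) (real b / 2 ^ N))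
      \<le> \<epsilon> * (2 * (\<Sum>n\<le>N. \<rho> ^ n)) * g (real a / 2 ^ N) (real b / 2 ^ N)"
    if "a \<le> b" "b \<le> 2 ^ N" for N a b
    using that
  proof (induction rule: dyadic_chain_induct)
    case (diag n s)
    then show ?case using \<open>\<And>s. 0 \<le> s \<Longrightarrow> s \<le> 1 \<Longrightarrow> f s s = 0\<close> \<open>0 \<le> \<epsilon>\<close> gauge_nonneg[of s s] ratio
      by (simp add: sum_nonneg)
  next
    case unit
    then show ?case using cell[of 0 0] mult_nonneg_nonneg[OF \<open>0 \<le> \<epsilon>\<close> gauge_nonneg[of 0 1]] by simp
  next
    case (step n s s' t' t)
    have "f s t = f s s' + f s' t' + f t' t"
      using add[of s s' t] add[of s' t' t] step.hyps by simp
    then have "norm (f s t) \<le> norm (f s s') + norm (f s' t') + norm (f t' t)"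
      by (simp only: norm_triangle3)
    also have "\<dots> \<le> \<epsilon> * \<rho> ^ Suc n * g s t + \<epsilon> * (2 * (\<Sum>n\<le>n. \<rho> ^ n)) * g s t + \<epsilon> * \<rho> ^ Suc n * g s t"
    proof (intro add_mono)
      show "norm (f s s') \<le> \<epsilon> * \<rho> ^ Suc n * g s t" "norm (f t' t) \<le> \<epsilon> * \<rho> ^ Suc n * g s t"
        using edge[OF step.hyps(1), of s t] edge[OF step.hyps(2), of s t] step.hyps by simp_all
      have "0 \<le> \<epsilon> * (2 * (\<Sum>n\<le>n. \<rho> ^ n))" using \<open>0 \<le> \<epsilon>\<close> ratio by (simp add: sum_nonneg)
      then show "norm (f s' t') \<le> \<epsilon> * (2 * (\<Sum>n\<le>n. \<rho> ^ n)) * g s t"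
        by (intro order_trans[OF step.IH] mult_left_mono gauge_mono step.hyps)
    qed
    also have "\<dots> = \<epsilon> * (2 * (\<Sum>n\<le>Suc n. \<rho> ^ n)) * g s t" by (simp add: algebra_simps)
    finally show ?case .
  qed
  have "norm (f s t) \<le> \<epsilon> * (2 / (1 - \<rho>)) * g s t ^ 1"
  proof (rule dyadic_dense_bound[OF cont _ diag _ st])
    fix N a b :: nat assume ab: "a \<le> b" "b \<le> 2 ^ N"
    have ab': "0 \<le> real a / 2 ^ N" "real a / 2 ^ N \<le> real b / 2 ^ N" "real b / 2 ^ N \<le> 1"
      using ab by (auto simp: divide_right_mono)
    have "\<epsilon> * (2 * (\<Sum>n\<le>N. \<rho> ^ n)) \<le> \<epsilon> * (2 / (1 - \<rho>))"
      using geometric_partial_sum_le[of N] \<open>0 \<le> \<epsilon>\<close> by (intro mult_left_mono) auto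
    then show "norm (f (real a / 2 ^ N) (real b / 2 ^ N))
        \<le> \<epsilon> * (2 / (1 - \<rho>)) * g (real a / 2 ^ N) (real b / 2 ^ N) ^ 1"
      unfolding power_one_right
      by (intro order_trans[OF dyadic[OF ab]] mult_right_mono gauge_nonneg ab')
  qed (use st \<open>0 \<le> \<epsilon>\<close> ratio in auto)
  then show ?thesis by simp
qed

text \<open>
  In the second level each chaining step adds, by the Chen relation, two tensor products in which one
  factor is an increment over a cell; comparing two functionals, each product splits by bilinearity
  into terms containing exactly one difference.
\<close>

lemma chain_level2:
  fixes X Y :: "real \<Rightarrow> real \<Rightarrow> 'd::finite tensor2"
  assumes X: "multiplicative X" and Y: "multiplicative Y"
    and contX: "continuous_on simplex01 (\<lambda>(s, t). X s t)"
    and contY: "continuous_on simplex01 (\<lambda>(s, t). Y s t)"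
    and "0 \<le> \<epsilon>" "0 \<le> K"
    and cellX: "\<And>n k. k < 2 ^ n \<Longrightarrow> norm (lev1 (on_cell X n k))
      \<le> K * \<rho> ^ n * on_cell g n k"
    and cellY: "\<And>n k. k < 2 ^ n \<Longrightarrow> norm (lev1 (on_cell Y n k))
      \<le> K * \<rho> ^ n * on_cell g n k"
    and cell1: "\<And>n k. k < 2 ^ n \<Longrightarrow> norm (lev1 (on_cell X n k)
        - lev1 (on_cell Y n k))
      \<le> \<epsilon> * \<rho> ^ n * on_cell g n k"
    and cell2: "\<And>n k. k < 2 ^ n \<Longrightarrow> norm (lev2 (on_cell X n k)
        - lev2 (on_cell Y n k))
      \<le> \<epsilon> * \<rho> ^ n * on_cell g n k ^ 2"
    and st: "0 \<le> s" "s \<le> t" "t \<le> 1"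
  shows "norm (lev1 (X s t) - lev1 (Y s t)) \<le> \<epsilon> * (2 / (1 - \<rho>)) * g s t"
    and "norm (lev2 (X s t) - lev2 (Y s t)) \<le> \<epsilon> * ((2 + 8 * K / (1 - \<rho>)) / (1 - \<rho>)) * g s t ^ 2"
proof -
  define c where "c = 2 / (1 - \<rho>)"
  have c0: "0 \<le> c" using ratio by (simp add: c_def)
  have cont1: "continuous_on simplex01 (\<lambda>(s, t). lev1 (Z s t))"
    and cont2: "continuous_on simplex01 (\<lambda>(s, t). lev2 (Z s t))"
    if "continuous_on simplex01 (\<lambda>(s, t). Z s t)" for Z :: "real \<Rightarrow> real \<Rightarrow> 'd tensor2"
    using that unfolding lev1_def lev2_def split_def
    by (auto intro!: continuous_intros)
  have X1: "norm (lev1 (X s t)) \<le> K * c * g s t" and Y1: "norm (lev1 (Y s t)) \<le> K * c * g s t"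
    and D1: "norm (lev1 (X s t) - lev1 (Y s t)) \<le> \<epsilon> * c * g s t"
    if "0 \<le> s" "s \<le> t" "t \<le> 1" for s t
  proof -
    show "norm (lev1 (X s t)) \<le> K * c * g s t" unfolding c_def
      by (rule chain_level1[where f = "\<lambda>s t. lev1 (X s t)", OF cont1[OF contX] _ \<open>0 \<le> K\<close> cellX that])
        (rule multiplicative_lev(1)[OF X])
    show "norm (lev1 (Y s t)) \<le> K * c * g s t" unfolding c_def
      by (rule chain_level1[where f = "\<lambda>s t. lev1 (Y s t)", OF cont1[OF contY] _ \<open>0 \<le> K\<close> cellY that])
        (rule multiplicative_lev(1)[OF Y])
    have contD: "continuous_on simplex01 (\<lambda>(s, t). lev1 (X s t) - lev1 (Y s t))"
      using continuous_on_diff[OF cont1[OF contX] cont1[OF contY]] by (simp add: split_def)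
    show "norm (lev1 (X s t) - lev1 (Y s t)) \<le> \<epsilon> * c * g s t" unfolding c_def
    proof (rule chain_level1[where f = "\<lambda>s t. lev1 (X s t) - lev1 (Y s t)", OF contD _ \<open>0 \<le> \<epsilon>\<close> cell1 that])
      fix s u t :: real assume "0 \<le> s" "s \<le> u" "u \<le> t" "t \<le> 1"
      note * = this
      show "lev1 (X s t) - lev1 (Y s t) = lev1 (X s u) - lev1 (Y s u) + (lev1 (X u t) - lev1 (Y u t))"
        using multiplicative_lev(1)[OF X *] multiplicative_lev(1)[OF Y *] by simp
    qed
  qed
  then show "norm (lev1 (X s t) - lev1 (Y s t)) \<le> \<epsilon> * (2 / (1 - \<rho>)) * g s t"
    using st by (simp add: c_def)
  let ?D = "\<lambda>s t. lev2 (X s t) - lev2 (Y s t)"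
  have diag: "?D s s = 0" "lev1 (X s s) = 0" "lev1 (Y s s) = 0" "lev1 (X s s) - lev1 (Y s s) = 0"
    if "0 \<le> s" "s \<le> 1" for s
    using that multiplicative_diag[OF X] multiplicative_diag[OF Y] by simp_all
  have edge: "norm (lev1 (X u v)) \<le> K * \<rho> ^ n * g s t ^ 1" "norm (lev1 (Y u v)) \<le> K * \<rho> ^ n * g s t ^ 1"
    "norm (lev1 (X u v) - lev1 (Y u v)) \<le> \<epsilon> * \<rho> ^ n * g s t ^ 1" "norm (?D u v) \<le> \<epsilon> * \<rho> ^ n * g s t ^ 2"
    if "dyadic_edge n u v" "0 \<le> s" "s \<le> u" "u \<le> v" "v \<le> t" "t \<le> 1" for n s u v t
  proof -
    have u: "0 \<le> u" "u \<le> 1" using that by auto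
    have K0: "0 \<le> K * \<rho> ^ n" "0 \<le> \<epsilon> * \<rho> ^ n" using \<open>0 \<le> K\<close> \<open>0 \<le> \<epsilon>\<close> ratio by auto
    show "norm (lev1 (X u v)) \<le> K * \<rho> ^ n * g s t ^ 1"
      by (rule edge_bound[where f = "\<lambda>u v. lev1 (X u v)", OF that diag(2)[OF u] K0(1)]) (use cellX in simp)
    show "norm (lev1 (Y u v)) \<le> K * \<rho> ^ n * g s t ^ 1"
      by (rule edge_bound[where f = "\<lambda>u v. lev1 (Y u v)", OF that diag(3)[OF u] K0(1)]) (use cellY in simp)
    show "norm (lev1 (X u v) - lev1 (Y u v)) \<le> \<epsilon> * \<rho> ^ n * g s t ^ 1"
      by (rule edge_bound[where f = "\<lambda>u v. lev1 (X u v) - lev1 (Y u v)", OF that diag(4)[OF u] K0(2)])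
        (use cell1 in simp)
    show "norm (?D u v) \<le> \<epsilon> * \<rho> ^ n * g s t ^ 2"
      by (rule edge_bound[where f = ?D, OF that diag(1)[OF u] K0(2)]) (rule cell2)
  qed
  define e where "e = 2 + 4 * K * c"
  have e0: "0 \<le> e" using \<open>0 \<le> K\<close> c0 by (simp add: e_def)
  have bracket: "norm (outer x1 x2 - outer y1 y2) \<le> 2 * K * \<epsilon> * (l1 * l2) * G ^ 2"
    if "norm (x1 - y1) \<le> \<epsilon> * l1 * G" "norm y1 \<le> K * l1 * G"
      "norm (x2 - y2) \<le> \<epsilon> * l2 * G" "norm x2 \<le> K * l2 * G"
    for x1 x2 y1 y2 :: "real ^ 'd" and l1 l2 G
  proof -
    have "outer x1 x2 - outer y1 y2 = outer (x1 - y1) x2 + outer y1 (x2 - y2)"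
      by (simp add: outer_simps)
    then have "norm (outer x1 x2 - outer y1 y2) \<le> norm (x1 - y1) * norm x2 + norm y1 * norm (x2 - y2)"
      by (simp only: norm_triangle_ineq flip: norm_outer)
    also have "\<dots> \<le> (\<epsilon> * l1 * G) * (K * l2 * G) + (K * l1 * G) * (\<epsilon> * l2 * G)"
      by (rule add_mono[OF mult_mono[OF that(1,4)] mult_mono[OF that(2,3)]])
        (use that in \<open>auto intro: order_trans[OF norm_ge_zero]\<close>)
    also have "\<dots> = 2 * K * \<epsilon> * (l1 * l2) * G ^ 2" by (simp add: power2_eq_square)
    finally show ?thesis .
  qed
  have dyadic: "norm (?D (real a / 2 ^ N) (real b / 2 ^ N))
      \<le> \<epsilon> * (e * (\<Sum>n\<le>N. \<rho> ^ n)) * g (real a / 2 ^ N) (real b / 2 ^ N) ^ 2"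
    if "a \<le> b" "b \<le> 2 ^ N" for N a b
    using that
  proof (induction rule: dyadic_chain_induct)
    case (diag n s)
    have "?D s s = 0" using diag \<open>\<And>s. 0 \<le> s \<Longrightarrow> s \<le> 1 \<Longrightarrow> ?D s s = 0\<close> by blast
    then show ?case using \<open>0 \<le> \<epsilon>\<close> e0 ratio by (simp add: sum_nonneg)
  next
    case unit
    have "norm (?D 0 1) \<le> \<epsilon> * g 0 1 ^ 2" using cell2[of 0 0] by simp
    also have "\<dots> \<le> \<epsilon> * e * g 0 1 ^ 2"
      using \<open>0 \<le> \<epsilon>\<close> \<open>0 \<le> K\<close> c0 by (intro mult_right_mono) (auto simp: e_def mult_le_cancel_left1)
    finally show ?case by simp
  next
    case (step n s s' t' t)
    note o = step.hyps(3-7)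
    let ?G = "g s t" and ?l = "\<rho> ^ Suc n"
    note e1 = edge[OF step.hyps(1) o(1) order_refl o(2) order_trans[OF o(3,4)] o(5)]
    note e2 = edge[OF step.hyps(2) o(1) order_trans[OF o(2,3)] o(4) order_refl o(5)]
    have up: "z * g u v \<le> z * ?G" if "0 \<le> z" "s \<le> u" "u \<le> v" "v \<le> t" for z u v
      using that o by (intro mult_left_mono gauge_mono) auto
    have b1: "norm (outer (lev1 (X s s')) (lev1 (X s' t)) - outer (lev1 (Y s s')) (lev1 (Y s' t)))
        \<le> 2 * K * \<epsilon> * (?l * c) * ?G ^ 2"
    proof (rule bracket)
      have "0 \<le> s'" "s' \<le> t" "t \<le> 1" "s \<le> s'" using o by auto
      note r = this
      show "norm (lev1 (X s' t) - lev1 (Y s' t)) \<le> \<epsilon> * c * ?G"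
        using order_trans[OF D1[OF r(1-3)] up] r \<open>0 \<le> \<epsilon>\<close> c0 by simp
      show "norm (lev1 (X s' t)) \<le> K * c * ?G"
        using order_trans[OF X1[OF r(1-3)] up] r \<open>0 \<le> K\<close> c0 by simp
    qed (use e1 in simp_all)
    have b2: "norm (outer (lev1 (X s' t')) (lev1 (X t' t)) - outer (lev1 (Y s' t')) (lev1 (Y t' t)))
        \<le> 2 * K * \<epsilon> * (c * ?l) * ?G ^ 2"
    proof (rule bracket)
      have "0 \<le> s'" "s' \<le> t'" "t' \<le> 1" "s \<le> s'" "t' \<le> t" using o by auto
      note r = this
      show "norm (lev1 (X s' t') - lev1 (Y s' t')) \<le> \<epsilon> * c * ?G"
        using order_trans[OF D1[OF r(1-3)] up] r \<open>0 \<le> \<epsilon>\<close> c0 by simp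
      show "norm (lev1 (Y s' t')) \<le> K * c * ?G"
        using order_trans[OF Y1[OF r(1-3)] up] r \<open>0 \<le> K\<close> c0 by simp
    qed (use e2 in simp_all)
    have mid: "norm (?D s' t') \<le> \<epsilon> * (e * (\<Sum>n\<le>n. \<rho> ^ n)) * ?G ^ 2"
    proof -
      have "0 \<le> \<epsilon> * (e * (\<Sum>n\<le>n. \<rho> ^ n))" using \<open>0 \<le> \<epsilon>\<close> e0 ratio by (simp add: sum_nonneg)
      moreover have "g s' t' ^ 2 \<le> ?G ^ 2"
        using o by (intro power_mono gauge_mono gauge_nonneg) auto
      ultimately show ?thesis by (intro order_trans[OF step.IH] mult_left_mono)
    qed
    have "?D s t = ?D s s' + ?D s' t' + ?D t' t
        + (outer (lev1 (X s s')) (lev1 (X s' t)) - outer (lev1 (Y s s')) (lev1 (Y s' t)))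
        + (outer (lev1 (X s' t')) (lev1 (X t' t)) - outer (lev1 (Y s' t')) (lev1 (Y t' t)))"
      using o by (simp add: multiplicative_lev(2)[OF X, of s s' t] multiplicative_lev(2)[OF X, of s' t' t]
          multiplicative_lev(2)[OF Y, of s s' t] multiplicative_lev(2)[OF Y, of s' t' t])
    then have "norm (?D s t) \<le> norm (?D s s') + norm (?D s' t') + norm (?D t' t)
        + norm (outer (lev1 (X s s')) (lev1 (X s' t)) - outer (lev1 (Y s s')) (lev1 (Y s' t)))
        + norm (outer (lev1 (X s' t')) (lev1 (X t' t)) - outer (lev1 (Y s' t')) (lev1 (Y t' t)))"
      by (simp only: norm_triangle5)
    also have "\<dots> \<le> \<epsilon> * ?l * ?G ^ 2 + \<epsilon> * (e * (\<Sum>n\<le>n. \<rho> ^ n)) * ?G ^ 2 + \<epsilon> * ?l * ?G ^ 2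
        + 2 * K * \<epsilon> * (?l * c) * ?G ^ 2 + 2 * K * \<epsilon> * (c * ?l) * ?G ^ 2"
      by (intro add_mono b1 b2 mid e1(4) e2(4))
    also have "\<dots> = \<epsilon> * (e * (\<Sum>n\<le>Suc n. \<rho> ^ n)) * ?G ^ 2"
      by (simp add: e_def algebra_simps)
    finally show ?case .
  qed
  have contD: "continuous_on simplex01 (\<lambda>(s, t). ?D s t)"
    using continuous_on_diff[OF cont2[OF contX] cont2[OF contY]] by (simp add: split_def)
  have "norm (?D s t) \<le> \<epsilon> * (e / (1 - \<rho>)) * g s t ^ 2"
  proof (rule dyadic_dense_bound[where f = ?D, OF contD _ _ _ st])
    fix N a b :: nat assume ab: "a \<le> b" "b \<le> 2 ^ N"
    have "e * (\<Sum>n\<le>N. \<rho> ^ n) \<le> e * (1 / (1 - \<rho>))"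
      by (intro mult_left_mono geometric_partial_sum_le e0)
    then have "\<epsilon> * (e * (\<Sum>n\<le>N. \<rho> ^ n)) \<le> \<epsilon> * (e / (1 - \<rho>))"
      using \<open>0 \<le> \<epsilon>\<close> by (intro mult_left_mono) auto
    then show "norm (?D (real a / 2 ^ N) (real b / 2 ^ N))
        \<le> \<epsilon> * (e / (1 - \<rho>)) * g (real a / 2 ^ N) (real b / 2 ^ N) ^ 2"
      by (intro order_trans[OF dyadic[OF ab]] mult_right_mono zero_le_power2)
  qed (use st diag \<open>0 \<le> \<epsilon>\<close> e0 ratio in auto)
  then show "norm (lev2 (X s t) - lev2 (Y s t)) \<le> \<epsilon> * ((2 + 8 * K / (1 - \<rho>)) / (1 - \<rho>)) * g s t ^ 2"
    by (simp add: e_def c_def)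
qed

end

section \<open>Convergence from dyadic estimates\<close>

lemma geometric_increments_limit:
  fixes a :: "nat \<Rightarrow> 'b::banach"
  assumes inc: "\<And>m. norm (a (Suc m) - a m) \<le> c * \<rho> ^ m" and "0 \<le> c" "0 < \<rho>" "\<rho> < 1"
  shows "a \<longlonglongrightarrow> lim a" "norm (a m - lim a) \<le> c / (1 - \<rho>) * \<rho> ^ m"
proof -
  have "summable (\<lambda>m. c * \<rho> ^ m)" using assms by (intro summable_mult summable_geometric) auto
  then have "summable (\<lambda>m. a (Suc m) - a m)"
    by (rule summable_comparison_test'[where N = 0]) (rule inc)
  then have "convergent (\<lambda>n. \<Sum>m<n. a (Suc m) - a m)" by (simp add: summable_iff_convergent)
  then have "convergent (\<lambda>n. a n - a 0)" by (simp add: sum_lessThan_telescope)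
  then have "convergent a" by (simp only: convergent_diff_const_right_iff)
  then show lim: "a \<longlonglongrightarrow> lim a" by (simp add: convergent_LIMSEQ_iff)
  have step: "norm (a m - a (m + k)) \<le> c * \<rho> ^ m * (\<Sum>j<k. \<rho> ^ j)" for k
  proof (induction k)
    case (Suc k)
    have "norm (a m - a (m + Suc k)) \<le> norm (a m - a (m + k)) + norm (a (Suc (m + k)) - a (m + k))"
      using norm_triangle_ineq4[of "a m - a (m + k)" "a (Suc (m + k)) - a (m + k)"] by simp
    also have "\<dots> \<le> c * \<rho> ^ m * (\<Sum>j<k. \<rho> ^ j) + c * \<rho> ^ (m + k)"
      by (intro add_mono Suc.IH inc)
    also have "\<dots> = c * \<rho> ^ m * (\<Sum>j<Suc k. \<rho> ^ j)" by (simp add: power_add algebra_simps)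
    finally show ?case .
  qed simp
  have bound: "norm (a m - a (m + k)) \<le> c / (1 - \<rho>) * \<rho> ^ m" for k
  proof -
    have "(\<Sum>j<k. \<rho> ^ j) \<le> (\<Sum>j. \<rho> ^ j)"
      using assms by (intro sum_le_suminf summable_geometric) auto
    also have "\<dots> = 1 / (1 - \<rho>)" using assms by (simp add: suminf_geometric)
    finally have "c * \<rho> ^ m * (\<Sum>j<k. \<rho> ^ j) \<le> c * \<rho> ^ m * (1 / (1 - \<rho>))"
      using assms by (intro mult_left_mono) auto
    then show ?thesis using step[of k] by (simp add: algebra_simps)
  qed
  have "(\<lambda>k. a (m + k)) \<longlonglongrightarrow> lim a" using LIMSEQ_ignore_initial_segment[OF lim, of m] by (simp add: add.commute)
  then have "(\<lambda>k. norm (a m - a (m + k))) \<longlonglongrightarrow> norm (a m - lim a)"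
    by (intro tendsto_norm tendsto_diff tendsto_const)
  then show "norm (a m - lim a) \<le> c / (1 - \<rho>) * \<rho> ^ m"
    by (rule LIMSEQ_le_const2) (use bound in auto)
qed

lemma continuous_on_geometric_limit:
  fixes f :: "nat \<Rightarrow> 'a::topological_space \<Rightarrow> 'b::real_normed_vector"
  assumes c: "\<And>m. continuous_on S (f m)"
    and le: "\<And>m z. z \<in> S \<Longrightarrow> norm (f m z - F z) \<le> c * \<rho> ^ m"
    and \<rho>: "0 < \<rho>" "\<rho> < 1"
  shows "continuous_on S F"
proof (rule uniform_limit_theorem[where F = sequentially])
  have "(\<lambda>m. c * \<rho> ^ m) \<longlonglongrightarrow> c * 0" using \<rho> by (intro tendsto_mult tendsto_const LIMSEQ_power_zero) auto
  then have 0: "(\<lambda>m. c * \<rho> ^ m) \<longlonglongrightarrow> 0" by simp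
  show "uniform_limit S f F sequentially"
  proof (rule uniform_limitI)
    fix e :: real assume "0 < e"
    have "\<forall>\<^sub>F m in sequentially. c * \<rho> ^ m < e" by (rule order_tendstoD(2)[OF 0 \<open>0 < e\<close>])
    then show "\<forall>\<^sub>F m in sequentially. \<forall>z\<in>S. dist (f m z) (F z) < e"
      by eventually_elim (use le in \<open>auto simp: dist_norm intro: le_less_trans\<close>)
  qed
qed (use c in auto)

text \<open>
  The exponents \<open>1 / p\<close> and \<open>2 / p\<close> match the two levels, so that one control serves both;
  the factor \<open>\<rho> ^ n\<close> is what chaining consumes, and \<open>\<rho> ^ m\<close> gives convergence.
\<close>

lemma dyadic_estimates_limit:
  fixes X :: "nat \<Rightarrow> real \<Rightarrow> real \<Rightarrow> 'd::finite tensor2"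
  assumes V: "control V" and "0 < p" and \<rho>: "0 < \<rho>" "\<rho> < 1"
    and rough: "\<And>m. rough_path p (X m)"
    and start: "\<And>n k. k < 2 ^ n \<Longrightarrow> norm (lev1 (on_cell (X 0) n k))
      \<le> \<rho> ^ n * on_cell V n k powr (1 / p)"
    and diff1: "\<And>m n k. k < 2 ^ n \<Longrightarrow>
      norm (lev1 (on_cell (X (Suc m)) n k)
        - lev1 (on_cell (X m) n k))
      \<le> \<rho> ^ (n + m) * on_cell V n k powr (1 / p)"
    and diff2: "\<And>m n k. k < 2 ^ n \<Longrightarrow>
      norm (lev2 (on_cell (X (Suc m)) n k)
        - lev2 (on_cell (X m) n k))
      \<le> \<rho> ^ (n + m) * on_cell V n k powr (2 / p)"
  shows "rough_path p (\<lambda>s t. lim (\<lambda>m. X m s t))"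
    and "(\<lambda>m. rp_dist p (X m) (\<lambda>s t. lim (\<lambda>m. X m s t))) \<longlonglongrightarrow> 0"
proof -
  have mult: "multiplicative (X m)" and cont: "continuous_on simplex01 (\<lambda>(s, t). X m s t)" for m
    using rough[of m] by (simp_all add: rough_path_iff)
  define g where "g s t = V s t powr (1 / p)" for s t
  have g2: "g s t ^ 2 = V s t powr (2 / p)" for s t
    by (simp add: g_def power2_eq_square flip: powr_add)
  interpret interval_gauge g \<rho>
  proof
    fix s s' t' t :: real
    assume "0 \<le> s" "s \<le> s'" "s' \<le> t'" "t' \<le> t" "t \<le> 1"
    then show "g s' t' \<le> g s t"
      unfolding g_def using \<open>0 < p\<close> by (intro powr_mono2 control_mono[OF V] control_nonneg[OF V]) auto
  qed (use \<rho> in \<open>simp_all add: g_def\<close>)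
  \<comment> \<open>\<open>K\<close> sums the first levels of \<open>X 0\<close> and of all the differences.\<close>
  define K where "K = 1 + 1 / (1 - \<rho>)"
  have K: "1 \<le> K" using \<rho> by (simp add: K_def)
  define C where "C = (2 + 8 * K / (1 - \<rho>)) / (1 - \<rho>)"
  have C: "0 \<le> C" "2 / (1 - \<rho>) \<le> C"
    using \<rho> K by (auto simp: C_def divide_right_mono)
  have cellg: "0 \<le> on_cell g n k" for k n by (simp add: g_def)
  have cell: "norm (lev1 (on_cell (X m) n k))
      \<le> K * \<rho> ^ n * on_cell g n k" if "k < 2 ^ n" for m n k
  proof -
    let ?a = "\<lambda>m. lev1 (on_cell (X m) n k)"
    let ?h = "\<rho> ^ n * on_cell g n k"
    have h: "0 \<le> ?h" using cellg \<rho> by simp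
    have "norm (?a m) \<le> (1 + (\<Sum>j<m. \<rho> ^ j)) * ?h"
    proof (induction m)
      case 0
      then show ?case using start[OF that] by (simp add: g_def)
    next
      case (Suc m)
      have "norm (?a (Suc m)) \<le> norm (?a m) + norm (?a (Suc m) - ?a m)"
        by (metis add.commute diff_add_cancel norm_triangle_ineq)
      also have "\<dots> \<le> (1 + (\<Sum>j<m. \<rho> ^ j)) * ?h + \<rho> ^ m * ?h"
        using Suc diff1[OF that, of m] by (simp add: g_def power_add mult.commute mult.left_commute)
      also have "\<dots> = (1 + (\<Sum>j<Suc m. \<rho> ^ j)) * ?h" by (simp add: algebra_simps)
      finally show ?case .
    qed
    also have "\<dots> \<le> K * ?h"
    proof -
      have "(\<Sum>j<m. \<rho> ^ j) \<le> (\<Sum>j\<le>m. \<rho> ^ j)" using \<rho> by (intro sum_mono2) auto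
      then have "1 + (\<Sum>j<m. \<rho> ^ j) \<le> K" using geometric_partial_sum_le[of m] by (simp add: K_def)
      then show ?thesis using h by (intro mult_right_mono)
    qed
    finally show ?thesis by (simp add: mult.assoc)
  qed
  define c1 where "c1 = C / (1 - \<rho>)"
  have c1: "0 \<le> c1" using C \<rho> by (simp add: c1_def)
  have bounds: "norm (lev1 (X (Suc m) s t) - lev1 (X m s t)) \<le> (C * g s t) * \<rho> ^ m"
    "norm (lev2 (X (Suc m) s t) - lev2 (X m s t)) \<le> (C * g s t ^ 2) * \<rho> ^ m"
    if st: "0 \<le> s" "s \<le> t" "t \<le> 1" for m s t
  proof -
    have K0: "0 \<le> \<rho> ^ m" "0 \<le> K" using K \<rho> by auto
    note chain = chain_level2[where X = "X (Suc m)" and Y = "X m",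
        OF mult mult cont cont K0 _ _ _ _ st]
    have d1: "norm (lev1 (on_cell (X (Suc m)) n k)
        - lev1 (on_cell (X m) n k))
      \<le> \<rho> ^ m * \<rho> ^ n * on_cell g n k" if "k < 2 ^ n" for n k
      using diff1[OF that, of m] by (simp add: g_def power_add mult.commute)
    have d2: "norm (lev2 (on_cell (X (Suc m)) n k)
        - lev2 (on_cell (X m) n k))
      \<le> \<rho> ^ m * \<rho> ^ n * on_cell g n k ^ 2" if "k < 2 ^ n" for n k
      unfolding g2 using diff2[OF that, of m] by (simp add: power_add mult.commute)
    have "norm (lev1 (X (Suc m) s t) - lev1 (X m s t)) \<le> \<rho> ^ m * (2 / (1 - \<rho>)) * g s t"
      by (rule chain(1); (rule cell d1 d2, assumption))
    also have "\<dots> \<le> \<rho> ^ m * C * g s t"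
      using C \<rho> gauge_nonneg[OF st] by (intro mult_right_mono mult_left_mono) auto
    finally show "norm (lev1 (X (Suc m) s t) - lev1 (X m s t)) \<le> (C * g s t) * \<rho> ^ m"
      by (simp add: mult.commute mult.left_commute)
    have "norm (lev2 (X (Suc m) s t) - lev2 (X m s t)) \<le> \<rho> ^ m * C * g s t ^ 2"
      unfolding C_def by (rule chain(2); (rule cell d1 d2, assumption))
    then show "norm (lev2 (X (Suc m) s t) - lev2 (X m s t)) \<le> (C * g s t ^ 2) * \<rho> ^ m"
      by (simp add: mult.commute mult.left_commute)
  qed
  define Z where "Z s t = lim (\<lambda>m. X m s t)" for s t
  have lim: "(\<lambda>m. lev1 (X m s t)) \<longlonglongrightarrow> lev1 (Z s t)" "(\<lambda>m. lev2 (X m s t)) \<longlonglongrightarrow> lev2 (Z s t)"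
    "lev0 (Z s t) = 1"
    "norm (lev1 (X m s t) - lev1 (Z s t)) \<le> c1 * g s t * \<rho> ^ m"
    "norm (lev2 (X m s t) - lev2 (Z s t)) \<le> c1 * g s t ^ 2 * \<rho> ^ m"
    if st: "0 \<le> s" "s \<le> t" "t \<le> 1" for m s t
  proof -
    have nn: "0 \<le> C * g s t" "0 \<le> C * g s t ^ 2" using C gauge_nonneg[OF st] by auto
    note l1 = geometric_increments_limit[where a = "\<lambda>m. lev1 (X m s t)", OF bounds(1)[OF st] nn(1) \<rho>]
    note l2 = geometric_increments_limit[where a = "\<lambda>m. lev2 (X m s t)", OF bounds(2)[OF st] nn(2) \<rho>]
    have "(\<lambda>m. (1::real, lev1 (X m s t), lev2 (X m s t)))
        \<longlonglongrightarrow> (1, lim (\<lambda>m. lev1 (X m s t)), lim (\<lambda>m. lev2 (X m s t)))"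
      by (intro tendsto_intros l1(1) l2(1))
    moreover have "(1, lev1 (X m s t), lev2 (X m s t)) = X m s t" for m
      using multiplicative_lev0[OF mult st] by (simp add: tensor2_eq_iff)
    ultimately have Z: "Z s t = (1, lim (\<lambda>m. lev1 (X m s t)), lim (\<lambda>m. lev2 (X m s t)))"
      unfolding Z_def by (simp only: limI)
    show "(\<lambda>m. lev1 (X m s t)) \<longlonglongrightarrow> lev1 (Z s t)" "(\<lambda>m. lev2 (X m s t)) \<longlonglongrightarrow> lev2 (Z s t)"
      "lev0 (Z s t) = 1"
      using l1(1) l2(1) by (simp_all add: Z)
    show "norm (lev1 (X m s t) - lev1 (Z s t)) \<le> c1 * g s t * \<rho> ^ m"
      "norm (lev2 (X m s t) - lev2 (Z s t)) \<le> c1 * g s t ^ 2 * \<rho> ^ m"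
      using l1(2)[of m] l2(2)[of m] by (simp_all add: Z c1_def)
  qed
  have multZ: "multiplicative Z"
  proof (rule multiplicativeI)
    fix s t :: real assume "0 \<le> s" "s \<le> t" "t \<le> 1"
    then show "lev0 (Z s t) = 1" by (rule lim(3))
  next
    fix s u t :: real assume *: "0 \<le> s" "s \<le> u" "u \<le> t" "t \<le> 1"
    have su: "0 \<le> s" "s \<le> u" "u \<le> 1" and ut: "0 \<le> u" "u \<le> t" "t \<le> 1" and st: "0 \<le> s" "s \<le> t" "t \<le> 1"
      using * by auto
    have "(\<lambda>m. lev1 (X m s t)) \<longlonglongrightarrow> lev1 (Z s u) + lev1 (Z u t)"
      unfolding multiplicative_lev(1)[OF mult *] by (intro tendsto_add lim su ut)
    then show "lev1 (Z s t) = lev1 (Z s u) + lev1 (Z u t)"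
      using LIMSEQ_unique lim(1)[OF st] by blast
    have "(\<lambda>m. lev2 (X m s t)) \<longlonglongrightarrow> lev2 (Z s u) + lev2 (Z u t) + outer (lev1 (Z s u)) (lev1 (Z u t))"
      unfolding multiplicative_lev(2)[OF mult *]
      by (intro tendsto_add bounded_bilinear.tendsto[OF bounded_bilinear_outer] lim su ut)
    then show "lev2 (Z s t) = lev2 (Z s u) + lev2 (Z u t) + outer (lev1 (Z s u)) (lev1 (Z u t))"
      using LIMSEQ_unique lim(2)[OF st] by blast
  qed
  have contZ: "continuous_on simplex01 (\<lambda>z. Z (fst z) (snd z))"
  proof (rule continuous_on_geometric_limit[where c = "c1 * g 0 1 + c1 * g 0 1 ^ 2", OF _ _ \<rho>])
    show "continuous_on simplex01 (\<lambda>z. X m (fst z) (snd z))" for m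
      using cont[of m] by (simp add: split_def)
    fix m z assume "z \<in> simplex01"
    then obtain s t where z: "fst z = s" "snd z = t" and st: "0 \<le> s" "s \<le> t" "t \<le> 1"
      by (auto simp: simplex01_def)
    have "X m s t - Z s t = (0, lev1 (X m s t) - lev1 (Z s t), lev2 (X m s t) - lev2 (Z s t))"
      using multiplicative_lev0[OF mult st] lim(3)[OF st] by (simp add: lev0_def lev1_def lev2_def prod_eq_iff)
    then have "norm (X m s t - Z s t) \<le> norm (lev1 (X m s t) - lev1 (Z s t)) + norm (lev2 (X m s t) - lev2 (Z s t))"
      using norm_Pair_le by (simp add: norm_Pair)
    also have "\<dots> \<le> c1 * g 0 1 * \<rho> ^ m + c1 * g 0 1 ^ 2 * \<rho> ^ m"
    proof (rule add_mono)
      have le: "g s t \<le> g 0 1" "g s t ^ 2 \<le> g 0 1 ^ 2"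
        using st by (auto intro!: gauge_mono power_mono gauge_nonneg)
      show "norm (lev1 (X m s t) - lev1 (Z s t)) \<le> c1 * g 0 1 * \<rho> ^ m"
        by (rule order_trans[OF lim(4)[OF st]], intro mult_right_mono mult_left_mono) (use le c1 \<rho> in auto)
      show "norm (lev2 (X m s t) - lev2 (Z s t)) \<le> c1 * g 0 1 ^ 2 * \<rho> ^ m"
        by (rule order_trans[OF lim(5)[OF st]], intro mult_right_mono mult_left_mono) (use le c1 \<rho> in auto)
    qed
    finally show "norm (X m (fst z) (snd z) - Z (fst z) (snd z)) \<le> (c1 * g 0 1 + c1 * g 0 1 ^ 2) * \<rho> ^ m"
      unfolding z by (simp add: distrib_right)
  qed
  have var1: "finite_var p (\<lambda>s t. lev1 (X m s t) - lev1 (Z s t))"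
    "var_norm p (\<lambda>s t. lev1 (X m s t) - lev1 (Z s t)) \<le> c1 * \<rho> ^ m * V 0 1 powr (1 / p)"
    and var2: "finite_var (p / 2) (\<lambda>s t. lev2 (X m s t) - lev2 (Z s t))"
    "var_norm (p / 2) (\<lambda>s t. lev2 (X m s t) - lev2 (Z s t)) \<le> c1 * \<rho> ^ m * V 0 1 powr (1 / (p / 2))" for m
  proof -
    have n1: "norm (lev1 (X m s t) - lev1 (Z s t)) \<le> c1 * \<rho> ^ m * V s t powr (1 / p)"
      and n2: "norm (lev2 (X m s t) - lev2 (Z s t)) \<le> c1 * \<rho> ^ m * V s t powr (1 / (p / 2))"
      if "0 \<le> s" "s \<le> t" "t \<le> 1" for s t
      using lim(4,5)[OF that, of m] by (simp_all add: g_def[symmetric] g2[symmetric] ac_simps)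
    have c: "0 \<le> c1 * \<rho> ^ m" "0 < p / 2" using c1 \<rho> \<open>0 < p\<close> by auto
    show "finite_var p (\<lambda>s t. lev1 (X m s t) - lev1 (Z s t))"
      "var_norm p (\<lambda>s t. lev1 (X m s t) - lev1 (Z s t)) \<le> c1 * \<rho> ^ m * V 0 1 powr (1 / p)"
      by (rule var_norm_le_control[OF V c(1) \<open>0 < p\<close> n1]; assumption)+
    show "finite_var (p / 2) (\<lambda>s t. lev2 (X m s t) - lev2 (Z s t))"
      "var_norm (p / 2) (\<lambda>s t. lev2 (X m s t) - lev2 (Z s t)) \<le> c1 * \<rho> ^ m * V 0 1 powr (1 / (p / 2))"
      by (rule var_norm_le_control[OF V c n2]; assumption)+
  qed
  have "finite_var p (\<lambda>s t. lev1 (Z s t))"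
    using finite_var_diff[OF _ var1(1)[of 0], of "\<lambda>s t. lev1 (X 0 s t)"] rough[of 0] \<open>0 < p\<close>
    by (simp add: rough_path_iff)
  moreover have "finite_var (p / 2) (\<lambda>s t. lev2 (Z s t))"
    using finite_var_diff[OF _ var2(1)[of 0], of "\<lambda>s t. lev2 (X 0 s t)"] rough[of 0] \<open>0 < p\<close>
    by (simp add: rough_path_iff)
  ultimately have "rough_path p Z" using multZ contZ by (simp add: rough_path_iff split_def)
  then show "rough_path p (\<lambda>s t. lim (\<lambda>m. X m s t))" unfolding Z_def .
  have dist: "rp_dist p (X m) Z \<le> (c1 * V 0 1 powr (1 / p) + c1 * V 0 1 powr (2 / p)) * \<rho> ^ m" for m
    unfolding rp_dist_def using add_mono[OF var1(2)[of m] var2(2)[of m]] by (simp add: algebra_simps)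
  have "(\<lambda>m. (c1 * V 0 1 powr (1 / p) + c1 * V 0 1 powr (2 / p)) * \<rho> ^ m)
      \<longlonglongrightarrow> (c1 * V 0 1 powr (1 / p) + c1 * V 0 1 powr (2 / p)) * 0"
    using \<rho> by (intro tendsto_mult tendsto_const LIMSEQ_power_zero) auto
  then have up: "(\<lambda>m. (c1 * V 0 1 powr (1 / p) + c1 * V 0 1 powr (2 / p)) * \<rho> ^ m) \<longlonglongrightarrow> 0"
    by simp
  have nn: "0 \<le> rp_dist p (X m) Z" for m by (simp add: rp_dist_def var_norm_nonneg)
  have "(\<lambda>m. rp_dist p (X m) Z) \<longlonglongrightarrow> 0"
    by (rule tendsto_sandwich[OF _ _ tendsto_const up]) (rule always_eventually, rule allI, rule nn dist)+
  then show "(\<lambda>m. rp_dist p (X m) (\<lambda>s t. lim (\<lambda>m. X m s t))) \<longlonglongrightarrow> 0" unfolding Z_def .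
qed

section \<open>Increments and areas of dyadic polygonal paths\<close>

definition dyadic_inc :: "(real \<Rightarrow> 'a::real_normed_vector) \<Rightarrow> nat \<Rightarrow> nat \<Rightarrow> 'a" where
  "dyadic_inc x n k = x ((real k + 1) / 2 ^ n) - x (real k / 2 ^ n)"

lemma dyadic_ancestor:
  assumes "m \<le> n" "k < 2 ^ n"
  defines "l \<equiv> k div 2 ^ (n - m)"
  shows "l < 2 ^ m" "real l / 2 ^ m \<le> real k / 2 ^ n" "(real k + 1) / 2 ^ n \<le> (real l + 1) / 2 ^ m"
proof -
  define q :: nat where "q = 2 ^ (n - m)"
  have q: "q > 0" by (simp add: q_def)
  have n: "2 ^ n = 2 ^ m * q" using assms(1) by (simp add: q_def flip: power_add)
  then have rn: "(2 ^ n :: real) = 2 ^ m * real q"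
    by (metis of_nat_mult of_nat_numeral of_nat_power)
  show "l < 2 ^ m" using assms(2) n q unfolding l_def q_def[symmetric]
    by (simp add: less_mult_imp_div_less)
  have "l * q \<le> k" unfolding l_def q_def[symmetric] by (rule div_times_less_eq_dividend)
  then have 1: "real l * real q \<le> real k" by (metis of_nat_le_iff of_nat_mult)
  have "k < (l + 1) * q" unfolding l_def q_def[symmetric] using q by (metis Suc_eq_plus1 dividend_less_div_times mult.commute mult_Suc_right add.commute)
  then have "k + 1 \<le> (l + 1) * q" by simp
  then have 2: "real k + 1 \<le> (real l + 1) * real q"
    by (metis of_nat_1 of_nat_add of_nat_le_iff of_nat_mult)
  show "real l / 2 ^ m \<le> real k / 2 ^ n" using 1 q unfolding rn by (simp add: field_simps)
  have "(real k + 1) / 2 ^ n \<le> ((real l + 1) * real q) / (2 ^ m * real q)"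
    unfolding rn using 2 by (intro divide_right_mono) auto
  then show "(real k + 1) / 2 ^ n \<le> (real l + 1) / 2 ^ m" using q by simp
qed

lemma lev1_lift_fine_cell:
  assumes "m \<le> n" "k < 2 ^ n"
  shows "lev1 (on_cell (smooth_lift (dyadic_interp m x)) n k)
    = (1 / 2) ^ (n - m) *\<^sub>R dyadic_inc x m (k div 2 ^ (n - m))"
proof -
  note * = dyadic_ancestor[OF assms]
  let ?l = "k div 2 ^ (n - m)"
  let ?s = "real k / 2 ^ n" and ?t = "(real k + 1) / 2 ^ n"
  have "?s \<le> ?t" by (simp add: divide_right_mono)
  then have "dyadic_interp m x ?t - dyadic_interp m x ?s
      = (2 ^ m * ?t - real ?l) *\<^sub>R dyadic_inc x m ?l - (2 ^ m * ?s - real ?l) *\<^sub>R dyadic_inc x m ?l"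
    using * by (simp only: dyadic_interp_cell[of ?l m ?t x] dyadic_interp_cell[of ?l m ?s x]
        order_trans[OF *(2)] order_trans[OF _ *(3)] dyadic_inc_def add_diff_cancel_left)
  also have "\<dots> = (2 ^ m * ?t - 2 ^ m * ?s) *\<^sub>R dyadic_inc x m ?l"
    by (simp flip: scaleR_left_diff_distrib)
  also have "2 ^ m * ?t - 2 ^ m * ?s = (1 / 2) ^ (n - m)"
    using assms(1) by (simp add: field_simps power_one_over flip: power_add)
  finally show ?thesis by simp
qed

lemma lev2_lift_fine_cell:
  fixes x :: "real \<Rightarrow> real ^ 'd::finite"
  assumes "m \<le> n" "k < 2 ^ n"
  defines "v \<equiv> lev1 (on_cell (smooth_lift (dyadic_interp m x)) n k)"
  shows "lev2 (on_cell (smooth_lift (dyadic_interp m x)) n k)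
    = (1 / 2) *\<^sub>R outer v v"
  unfolding v_def lev_smooth_lift
  by (rule lev2_smooth_lift_cell[OF dyadic_ancestor(1,2)[OF assms(1,2)] _ dyadic_ancestor(3)[OF assms(1,2)]])
    (simp add: divide_right_mono)

text \<open>
  Consecutive approximations agree at the first level on the coarser grid, so the cross terms of the
  Chen relation cancel in the difference of the second levels. What remains are the Levy areas of the
  triangles cut off by the refinement.
\<close>

lemma lev2_refinement:
  fixes x :: "real \<Rightarrow> real ^ 'd::finite"
  assumes "a \<le> b" "b \<le> 2 ^ m"
  defines "\<alpha> \<equiv> \<lambda>l. dyadic_inc x (Suc m) (2 * l)" and "\<beta> \<equiv> \<lambda>l. dyadic_inc x (Suc m) (2 * l + 1)"
  shows "lev2 (smooth_lift (dyadic_interp (Suc m) x) (real a / 2 ^ m) (real b / 2 ^ m))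
      - lev2 (smooth_lift (dyadic_interp m x) (real a / 2 ^ m) (real b / 2 ^ m))
    = (1 / 2) *\<^sub>R (\<Sum>l\<in>{a..<b}. outer (\<alpha> l) (\<beta> l) - outer (\<beta> l) (\<alpha> l))"
  using assms(1,2)
proof (induction b rule: dec_induct)
  case base
  have "real a / 2 ^ m \<le> 1"
    using base by simp
  then show ?case
    by (simp add: multiplicative_diag[OF multiplicative_smooth_lift[OF regular_path_dyadic_interp]])
next
  case (step b)
  let ?X = "smooth_lift (dyadic_interp m x)" and ?Y = "smooth_lift (dyadic_interp (Suc m) x)"
  have mX: "multiplicative ?X" and mY: "multiplicative ?Y"
    by (rule multiplicative_smooth_lift[OF regular_path_dyadic_interp])+
  define s where "s = real a / 2 ^ m"
  define u where "u = real b / 2 ^ m"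
  define t where "t = real (Suc b) / 2 ^ m"
  define v where "v = (real (2 * b) + 1) / 2 ^ Suc m"
  have u_fine: "u = real (2 * b) / 2 ^ Suc m" by (simp add: u_def)
  have t_fine: "t = (real (2 * b + 1) + 1) / 2 ^ Suc m" by (simp add: t_def field_simps)
  have v_fine: "v = real (2 * b + 1) / 2 ^ Suc m" by (simp add: v_def)
  have t': "t = (real b + 1) / 2 ^ m" by (simp add: t_def add.commute)
  have "real (Suc b) \<le> 2 ^ m" using step.prems by (simp del: of_nat_Suc)
  then have le: "0 \<le> s" "s \<le> u" "u \<le> v" "v \<le> t" "u \<le> t" "t \<le> 1" "0 \<le> u"
    using step.hyps unfolding s_def u_def t_def v_def by (simp_all add: field_simps)
  have b: "b < 2 ^ m" using step.prems by simp
  have b2: "2 * b < 2 ^ Suc m" "2 * b + 1 < 2 ^ Suc m" using b by simp_all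
  have fst_Y: "lev1 (?Y u v) = \<alpha> b" "lev1 (?Y v t) = \<beta> b"
    using lev1_lift_fine_cell[OF order_refl b2(1), of x] lev1_lift_fine_cell[OF order_refl b2(2), of x]
    unfolding \<alpha>_def \<beta>_def by (simp_all only: u_fine v_def t_fine v_fine[unfolded v_def]) simp_all
  have snd_Y: "lev2 (?Y u v) = (1 / 2) *\<^sub>R outer (\<alpha> b) (\<alpha> b)" "lev2 (?Y v t) = (1 / 2) *\<^sub>R outer (\<beta> b) (\<beta> b)"
    using lev2_lift_fine_cell[OF order_refl b2(1), of x] lev2_lift_fine_cell[OF order_refl b2(2), of x]
    unfolding fst_Y[symmetric] by (simp_all only: u_fine v_def t_fine v_fine[unfolded v_def])
  have grid: "dyadic_interp m x (real k / 2 ^ m) = dyadic_interp (Suc m) x (real k / 2 ^ m)" for k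
    by (simp add: dyadic_interp_grid)
  have same: "lev1 (?X s u) = lev1 (?Y s u)" "lev1 (?X u t) = lev1 (?Y u t)"
    using grid[of a] grid[of b] grid[of "Suc b"] by (simp_all only: lev_smooth_lift s_def u_def t_def)
  have inc: "lev1 (?Y u t) = \<alpha> b + \<beta> b"
    unfolding fst_Y[symmetric] by (rule multiplicative_lev(1)[OF mY]) (use le in auto)
  have snd_X: "lev2 (?X u t) = (1 / 2) *\<^sub>R outer (\<alpha> b + \<beta> b) (\<alpha> b + \<beta> b)"
    using lev2_lift_fine_cell[OF order_refl b, of x] unfolding u_def[symmetric] t'[symmetric]
    by (simp only: same(2) inc)
  have snd_Y': "lev2 (?Y u t) = (1 / 2) *\<^sub>R outer (\<alpha> b) (\<alpha> b) + (1 / 2) *\<^sub>R outer (\<beta> b) (\<beta> b) + outer (\<alpha> b) (\<beta> b)"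
    using multiplicative_lev(2)[OF mY, of u v t] le fst_Y snd_Y by simp
  have area: "lev2 (?Y u t) - lev2 (?X u t) = (1 / 2) *\<^sub>R (outer (\<alpha> b) (\<beta> b) - outer (\<beta> b) (\<alpha> b))"
    unfolding snd_X snd_Y' by (simp add: outer_simps vec_eq_iff field_simps)
  have IH: "lev2 (?Y s u) - lev2 (?X s u) = (1 / 2) *\<^sub>R (\<Sum>l\<in>{a..<b}. outer (\<alpha> l) (\<beta> l) - outer (\<beta> l) (\<alpha> l))"
    using step unfolding s_def u_def by simp
  have "lev2 (?Y s t) - lev2 (?X s t) = (lev2 (?Y s u) - lev2 (?X s u)) + (lev2 (?Y u t) - lev2 (?X u t))"
    using multiplicative_lev(2)[OF mX, of s u t] multiplicative_lev(2)[OF mY, of s u t] le same by simp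
  also have "\<dots> = (1 / 2) *\<^sub>R (\<Sum>l\<in>{a..<Suc b}. outer (\<alpha> l) (\<beta> l) - outer (\<beta> l) (\<alpha> l))"
    unfolding IH area using step.hyps by (simp add: scaleR_add_right)
  finally show ?case unfolding s_def t_def .
qed

lemma norm_matrix_sq: "(norm (A :: real ^ 'd ^ 'e::finite))\<^sup>2 = (\<Sum>i\<in>UNIV. \<Sum>j\<in>UNIV. (A $ i $ j)\<^sup>2)"
  by (simp add: norm_vec_def L2_set_def sum_nonneg)

lemma norm_vec_pow4_le: "(norm (v :: real ^ 'd::finite)) ^ 4 \<le> real CARD('d) * (\<Sum>i\<in>UNIV. (v $ i) ^ 4)"
proof -
  have "(norm v)\<^sup>2 = (\<Sum>i\<in>UNIV. 1 * (v $ i)\<^sup>2)"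
    by (simp add: norm_vec_def L2_set_def sum_nonneg)
  then have "((norm v)\<^sup>2)\<^sup>2 \<le> (\<Sum>i\<in>(UNIV::'d set). 1\<^sup>2) * (\<Sum>i\<in>UNIV. ((v $ i)\<^sup>2)\<^sup>2)"
    by (simp only: Cauchy_Schwarz_ineq_sum)
  then show ?thesis by (simp flip: power_mult)
qed

section \<open>Moments of the differences of consecutive approximations\<close>

lemma prod4_le:
  fixes a b c d :: real
  shows "\<bar>a * b * (c * d)\<bar> \<le> a ^ 4 + b ^ 4 + c ^ 4 + d ^ 4"
proof -
  have am: "\<bar>x * y\<bar> \<le> (x\<^sup>2 + y\<^sup>2) / 2" for x y :: real
    using zero_le_power2[of "\<bar>x\<bar> - \<bar>y\<bar>"] by (simp add: power2_diff abs_mult)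
  have "\<bar>a * b * (c * d)\<bar> \<le> ((a * b)\<^sup>2 + (c * d)\<^sup>2) / 2" by (rule am)
  moreover have "(a * b)\<^sup>2 \<le> (a ^ 4 + b ^ 4) / 2"
    using am[of "a\<^sup>2" "b\<^sup>2"] by (simp add: power_mult_distrib flip: power_mult)
  moreover have "(c * d)\<^sup>2 \<le> (c ^ 4 + d ^ 4) / 2"
    using am[of "c\<^sup>2" "d\<^sup>2"] by (simp add: power_mult_distrib flip: power_mult)
  moreover have "0 \<le> a ^ 4" "0 \<le> b ^ 4" "0 \<le> c ^ 4" "0 \<le> d ^ 4" by simp_all
  ultimately show ?thesis by argo
qed

lemma integrable_nonneg_dominated:
  fixes f U :: "'w \<Rightarrow> real"
  assumes "integrable M U" "f \<in> borel_measurable M" "\<And>\<omega>. 0 \<le> f \<omega>" "\<And>\<omega>. f \<omega> \<le> U \<omega>"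
  shows "integrable M f"
proof (rule Bochner_Integration.integrable_bound[OF assms(1,2)], rule AE_I2)
  fix \<omega>
  show "norm (f \<omega>) \<le> norm (U \<omega>)"
    using assms(3)[of \<omega>] assms(4)[of \<omega>] by simp
qed

lemma half_difference_sq_le: "((a - b) / 2)\<^sup>2 \<le> (a\<^sup>2 + b\<^sup>2) / (2 :: real)"
  using sum_squares_bound[of a "- b"] by (simp add: power2_diff power_divide)

lemma quarter_le: "a \<le> 2 * c \<Longrightarrow> 0 \<le> c \<Longrightarrow> a / 4 \<le> (c :: real)"
  by simp

lemma average_le: "a \<le> c \<Longrightarrow> b \<le> c \<Longrightarrow> (a + b) / 2 \<le> (c :: real)"
  by simp

text \<open>
  The probabilistic input. Here \<open>\<eta> ^ n\<close> is the order of the standard deviation of an increment over a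
  dyadic interval of level \<open>n\<close>. Summability of the covariances expresses that
  increments over distinct cells are nearly uncorrelated, and cross moments factorise
  because distinct coordinates are independent.
\<close>

locale increment_process = prob_space M for M :: "'w measure" +
  fixes x :: "'w \<Rightarrow> real \<Rightarrow> real ^ 'd::finite" and \<eta> C :: real
  assumes measurable_coord: "0 \<le> t \<Longrightarrow> t \<le> 1 \<Longrightarrow> (\<lambda>\<omega>. x \<omega> t $ i) \<in> borel_measurable M"
    and \<eta>: "0 < \<eta>" "\<eta> \<le> 1" and C: "1 \<le> C"
    and integrable_fourth: "k < 2 ^ n \<Longrightarrow> integrable M (\<lambda>\<omega>. (dyadic_inc (x \<omega>) n k $ i) ^ 4)"
    and fourth_moment: "k < 2 ^ n \<Longrightarrow> expectation (\<lambda>\<omega>. (dyadic_inc (x \<omega>) n k $ i) ^ 4) \<le> C * \<eta> ^ (4 * n)"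
    and covariance_sum: "k < 2 ^ n \<Longrightarrow>
      (\<Sum>l<2 ^ n. \<bar>expectation (\<lambda>\<omega>. dyadic_inc (x \<omega>) n k $ i * dyadic_inc (x \<omega>) n l $ i)\<bar>) \<le> C * \<eta> ^ (2 * n)"
    and cross_moment: "i \<noteq> j \<Longrightarrow> k < 2 ^ n \<Longrightarrow> k' < 2 ^ n \<Longrightarrow> l < 2 ^ n \<Longrightarrow> l' < 2 ^ n \<Longrightarrow>
      expectation (\<lambda>\<omega>. (dyadic_inc (x \<omega>) n k $ i * dyadic_inc (x \<omega>) n k' $ i)
        * (dyadic_inc (x \<omega>) n l $ j * dyadic_inc (x \<omega>) n l' $ j))
      = expectation (\<lambda>\<omega>. dyadic_inc (x \<omega>) n k $ i * dyadic_inc (x \<omega>) n k' $ i)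
        * expectation (\<lambda>\<omega>. dyadic_inc (x \<omega>) n l $ j * dyadic_inc (x \<omega>) n l' $ j)"
begin

lemma measurable_path:
  assumes "0 \<le> t" "t \<le> 1"
  shows "(\<lambda>\<omega>. x \<omega> t) \<in> borel_measurable M"
proof (rule borel_measurable_euclidean_space[THEN iffD2], rule ballI)
  fix e :: "real ^ 'd" assume "e \<in> Basis"
  then obtain i where "e = axis i 1" by (auto simp: Basis_vec_def)
  then show "(\<lambda>\<omega>. x \<omega> t \<bullet> e) \<in> borel_measurable M"
    using measurable_coord[OF assms, of i] by (simp add: inner_axis)
qed

abbreviation inc :: "nat \<Rightarrow> nat \<Rightarrow> 'd \<Rightarrow> 'w \<Rightarrow> real" where
  "inc n k i \<omega> \<equiv> dyadic_inc (x \<omega>) n k $ i"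

lemma measurable_inc:
  assumes "k < 2 ^ n"
  shows "inc n k i \<in> borel_measurable M"
proof -
  note * = dyadic_endpoints[OF assms]
  show ?thesis unfolding dyadic_inc_def vector_minus_component
    by (intro borel_measurable_diff measurable_coord *)
qed

lemma integrable_prod4:
  assumes "k < 2 ^ n" "k' < 2 ^ n" "l < 2 ^ n" "l' < 2 ^ n"
  shows "integrable M (\<lambda>\<omega>. (inc n k i \<omega> * inc n k' i' \<omega>) * (inc n l j \<omega> * inc n l' j' \<omega>))"
proof (rule Bochner_Integration.integrable_bound)
  show "integrable M (\<lambda>\<omega>. inc n k i \<omega> ^ 4 + inc n k' i' \<omega> ^ 4 + inc n l j \<omega> ^ 4 + inc n l' j' \<omega> ^ 4)"
    using assms by (intro Bochner_Integration.integrable_add integrable_fourth)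
  show "(\<lambda>\<omega>. (inc n k i \<omega> * inc n k' i' \<omega>) * (inc n l j \<omega> * inc n l' j' \<omega>)) \<in> borel_measurable M"
    using assms by (intro borel_measurable_times measurable_inc)
  have "norm ((inc n k i \<omega> * inc n k' i' \<omega>) * (inc n l j \<omega> * inc n l' j' \<omega>))
      \<le> norm (inc n k i \<omega> ^ 4 + inc n k' i' \<omega> ^ 4 + inc n l j \<omega> ^ 4 + inc n l' j' \<omega> ^ 4)" for \<omega>
    using prod4_le[of "inc n k i \<omega>" "inc n k' i' \<omega>" "inc n l j \<omega>" "inc n l' j' \<omega>"] by simp
  then show "AE \<omega> in M. norm ((inc n k i \<omega> * inc n k' i' \<omega>) * (inc n l j \<omega> * inc n l' j' \<omega>))
      \<le> norm (inc n k i \<omega> ^ 4 + inc n k' i' \<omega> ^ 4 + inc n l j \<omega> ^ 4 + inc n l' j' \<omega> ^ 4)" by blast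
qed

lemma covariance_le:
  assumes "k < 2 ^ n" "l < 2 ^ n"
  shows "\<bar>expectation (\<lambda>\<omega>. inc n k i \<omega> * inc n l i \<omega>)\<bar> \<le> C * \<eta> ^ (2 * n)"
  using covariance_sum[OF assms(1), of i] assms(2)
    member_le_sum[of l "{..<2 ^ n}" "\<lambda>l. \<bar>expectation (\<lambda>\<omega>. inc n k i \<omega> * inc n l i \<omega>)\<bar>"]
  by simp

text \<open>
  Independence makes the second moment a double sum of products of covariances. One factor is
  bounded uniformly, the sum of the other over the second index is
  bounded as well, so the double sum grows only linearly in the number of cells.
\<close>

lemma second_moment_cross_sum:
  assumes "i \<noteq> j" and L: "finite L" and f: "f ` L \<subseteq> {..<2 ^ n}" and g: "inj_on g L" "g ` L \<subseteq> {..<2 ^ n}"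
  shows "integrable M (\<lambda>\<omega>. (\<Sum>l\<in>L. inc n (f l) i \<omega> * inc n (g l) j \<omega>)\<^sup>2)"
    and "expectation (\<lambda>\<omega>. (\<Sum>l\<in>L. inc n (f l) i \<omega> * inc n (g l) j \<omega>)\<^sup>2)
      \<le> real (card L) * (C\<^sup>2 * \<eta> ^ (4 * n))"
proof -
  have fl: "f l < 2 ^ n" and gl: "g l < 2 ^ n" if "l \<in> L" for l using f g that by auto
  let ?p = "\<lambda>l l' \<omega>. (inc n (f l) i \<omega> * inc n (f l') i \<omega>) * (inc n (g l) j \<omega> * inc n (g l') j \<omega>)"
  have sq: "(\<Sum>l\<in>L. inc n (f l) i \<omega> * inc n (g l) j \<omega>)\<^sup>2 = (\<Sum>l\<in>L. \<Sum>l'\<in>L. ?p l l' \<omega>)" for \<omega>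
    unfolding power2_eq_square sum_product by (intro sum.cong refl) (simp only: mult.commute mult.left_commute)
  have int: "integrable M (?p l l')" if "l \<in> L" "l' \<in> L" for l l'
    using that by (intro integrable_prod4 fl gl)
  show "integrable M (\<lambda>\<omega>. (\<Sum>l\<in>L. inc n (f l) i \<omega> * inc n (g l) j \<omega>)\<^sup>2)"
    unfolding sq by (intro Bochner_Integration.integrable_sum int)
  let ?u = "\<lambda>l l'. expectation (\<lambda>\<omega>. inc n (f l) i \<omega> * inc n (f l') i \<omega>)"
  let ?v = "\<lambda>k k'. expectation (\<lambda>\<omega>. inc n k j \<omega> * inc n k' j \<omega>)"
  have "expectation (\<lambda>\<omega>. (\<Sum>l\<in>L. inc n (f l) i \<omega> * inc n (g l) j \<omega>)\<^sup>2)
      = (\<Sum>l\<in>L. expectation (\<lambda>\<omega>. \<Sum>l'\<in>L. ?p l l' \<omega>))"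
    unfolding sq by (rule Bochner_Integration.integral_sum) (intro Bochner_Integration.integrable_sum int)
  also have "\<dots> = (\<Sum>l\<in>L. \<Sum>l'\<in>L. expectation (?p l l'))"
    by (intro sum.cong refl Bochner_Integration.integral_sum int)
  also have "\<dots> = (\<Sum>l\<in>L. \<Sum>l'\<in>L. ?u l l' * ?v (g l) (g l'))"
    by (intro sum.cong refl cross_moment[OF \<open>i \<noteq> j\<close>] fl gl)
  also have "\<dots> \<le> (\<Sum>l\<in>L. \<Sum>l'\<in>L. (C * \<eta> ^ (2 * n)) * \<bar>?v (g l) (g l')\<bar>)"
  proof (intro sum_mono)
    fix l l' assume "l \<in> L" "l' \<in> L"
    then have "\<bar>?u l l'\<bar> * \<bar>?v (g l) (g l')\<bar> \<le> (C * \<eta> ^ (2 * n)) * \<bar>?v (g l) (g l')\<bar>"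
      by (intro mult_right_mono covariance_le fl) auto
    then show "?u l l' * ?v (g l) (g l') \<le> (C * \<eta> ^ (2 * n)) * \<bar>?v (g l) (g l')\<bar>"
      using abs_ge_self[of "?u l l' * ?v (g l) (g l')"] unfolding abs_mult by (rule order_trans[rotated])
  qed
  also have "\<dots> = (\<Sum>l\<in>L. (C * \<eta> ^ (2 * n)) * (\<Sum>l'\<in>L. \<bar>?v (g l) (g l')\<bar>))"
    by (simp add: sum_distrib_left)
  also have "\<dots> \<le> (\<Sum>l\<in>L. (C * \<eta> ^ (2 * n)) * (C * \<eta> ^ (2 * n)))"
  proof (intro sum_mono mult_left_mono)
    fix l assume l: "l \<in> L"
    have "(\<Sum>l'\<in>L. \<bar>?v (g l) (g l')\<bar>) = (\<Sum>k\<in>g ` L. \<bar>?v (g l) k\<bar>)"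
      using g(1) by (simp add: sum.reindex)
    also have "\<dots> \<le> (\<Sum>k<2 ^ n. \<bar>?v (g l) k\<bar>)"
      using g(2) by (intro sum_mono2) auto
    also have "\<dots> \<le> C * \<eta> ^ (2 * n)" by (rule covariance_sum[OF gl[OF l]])
    finally show "(\<Sum>l'\<in>L. \<bar>?v (g l) (g l')\<bar>) \<le> C * \<eta> ^ (2 * n)" .
  qed (use C \<eta> in auto)
  also have "\<dots> = real (card L) * (C\<^sup>2 * \<eta> ^ (4 * n))"
    by (simp add: power2_eq_square flip: power_add)
  finally show "expectation (\<lambda>\<omega>. (\<Sum>l\<in>L. inc n (f l) i \<omega> * inc n (g l) j \<omega>)\<^sup>2)
      \<le> real (card L) * (C\<^sup>2 * \<eta> ^ (4 * n))" .
qed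

definition lift :: "nat \<Rightarrow> 'w \<Rightarrow> real \<Rightarrow> real \<Rightarrow> 'd tensor2" where
  "lift m \<omega> = smooth_lift (dyadic_interp m (x \<omega>))"

definition diff1 :: "nat \<Rightarrow> nat \<Rightarrow> nat \<Rightarrow> 'w \<Rightarrow> real ^ 'd" where
  "diff1 m n k \<omega> = lev1 (on_cell (lift (Suc m) \<omega>) n k)
    - lev1 (on_cell (lift m \<omega>) n k)"

definition diff2 :: "nat \<Rightarrow> nat \<Rightarrow> nat \<Rightarrow> 'w \<Rightarrow> real ^ 'd ^ 'd" where
  "diff2 m n k \<omega> = lev2 (on_cell (lift (Suc m) \<omega>) n k)
    - lev2 (on_cell (lift m \<omega>) n k)"

text \<open>
  Both levels are measured by one quantity of order four in the increments: its powers
  \<open>1 / 4\<close> and \<open>1 / 2\<close> dominate the first and the second level.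
\<close>

definition fluct :: "nat \<Rightarrow> nat \<Rightarrow> nat \<Rightarrow> 'w \<Rightarrow> real" where
  "fluct m n k \<omega> = norm (diff1 m n k \<omega>) ^ 4 + norm (diff2 m n k \<omega>) ^ 2"

lemma fluct_nonneg: "0 \<le> fluct m n k \<omega>"
  by (simp add: fluct_def)

lemma measurable_lift:
  assumes "0 \<le> s" "s \<le> t" "t \<le> 1"
  shows "(\<lambda>\<omega>. lift m \<omega> s t) \<in> borel_measurable M"
  unfolding lift_def by (rule borel_measurable_smooth_lift[OF _ assms]) (rule measurable_path)

lemma measurable_fluct:
  assumes "k < 2 ^ n"
  shows "fluct m n k \<in> borel_measurable M"
proof -
  note [measurable] = measurable_lift[OF dyadic_endpoints(1-3)[OF assms]]
  have lev: "(lev1 :: 'd tensor2 \<Rightarrow> _) \<in> borel_measurable borel" "(lev2 :: 'd tensor2 \<Rightarrow> _) \<in> borel_measurable borel"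
    unfolding lev1_def lev2_def by (intro borel_measurable_continuous_onI continuous_intros)+
  note [measurable] = lev
  show ?thesis unfolding fluct_def[abs_def] diff1_def diff2_def by measurable
qed

text \<open>
  The end points of the cell lie on both grids, so only the areas contribute.
\<close>

lemma fluct_coarse:
  assumes "n \<le> m" "k < 2 ^ n"
  shows "integrable M (fluct m n k)"
    and "expectation (fluct m n k) \<le> real CARD('d) ^ 2 * C\<^sup>2 * (2 ^ (m - n) * \<eta> ^ (4 * m))"
proof -
  define L where "L = {k * 2 ^ (m - n)..<(k + 1) * 2 ^ (m - n)}"
  have L: "finite L" "card L = 2 ^ (m - n)" by (auto simp: L_def algebra_simps)
  have kn: "(k + 1) * 2 ^ (m - n) \<le> 2 ^ m"
  proof -
    have "(k + 1) * 2 ^ (m - n) \<le> 2 ^ n * 2 ^ (m - n)" using assms(2) by (intro mult_right_mono) auto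
    then show ?thesis using assms(1) by (simp flip: power_add)
  qed
  have scale: "real (j * 2 ^ (m - n)) / 2 ^ m = real j / 2 ^ n" for j
    using assms(1) by (simp add: field_simps flip: power_add)
  have d1: "diff1 m n k \<omega> = 0" for \<omega>
  proof -
    have "dyadic_interp q (x \<omega>) (real j / 2 ^ n) = x \<omega> (real j / 2 ^ n)" if "q \<ge> m" for q j
      using that assms(1) by (intro dyadic_interp_grid) auto
    from this[of _ k] this[of _ "Suc k"] show ?thesis
      by (simp add: diff1_def lift_def add.commute)
  qed
  let ?a = "\<lambda>l. 2 * l" and ?b = "\<lambda>l. 2 * l + 1" and ?N = "Suc m"
  have k1: "real (k + 1) = real k + 1" and kk: "k * 2 ^ (m - n) \<le> (k + 1) * 2 ^ (m - n)" by simp_all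
  have d2: "diff2 m n k \<omega> = (1 / 2) *\<^sub>R (\<Sum>l\<in>L.
      outer (dyadic_inc (x \<omega>) ?N (?a l)) (dyadic_inc (x \<omega>) ?N (?b l))
      - outer (dyadic_inc (x \<omega>) ?N (?b l)) (dyadic_inc (x \<omega>) ?N (?a l)))" for \<omega>
    using lev2_refinement[OF kk kn, of "x \<omega>"] unfolding scale k1
    by (simp only: diff2_def lift_def L_def)
  let ?S = "\<lambda>f g i j \<omega>. \<Sum>l\<in>L. inc ?N (f l) i \<omega> * inc ?N (g l) j \<omega>"
  have entry: "diff2 m n k \<omega> $ i $ j = (?S ?a ?b i j \<omega> - ?S ?b ?a i j \<omega>) / 2" for i j \<omega>
    unfolding d2 by (simp add: outer_def sum_subtractf)
  have in_range: "?a ` L \<subseteq> {..<2 ^ ?N}" "?b ` L \<subseteq> {..<2 ^ ?N}" "inj_on ?a L" "inj_on ?b L"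
    using kn by (auto simp: L_def inj_on_def)
  have entry_moment: "integrable M (\<lambda>\<omega>. (diff2 m n k \<omega> $ i $ j)\<^sup>2)
      \<and> expectation (\<lambda>\<omega>. (diff2 m n k \<omega> $ i $ j)\<^sup>2) \<le> C\<^sup>2 * (2 ^ (m - n) * \<eta> ^ (4 * m))" for i j
  proof (cases "i = j")
    case True
    \<comment> \<open>The area matrices are antisymmetric.\<close>
    have "diff2 m n k \<omega> $ i $ j = 0" for \<omega>
      unfolding entry True by (simp add: mult.commute)
    then show ?thesis using \<eta> by simp
  next
    case False
    note 1 = second_moment_cross_sum[OF False L(1) in_range(1,4,2)]
    note 2 = second_moment_cross_sum[OF False L(1) in_range(2,3,1)]
    let ?U = "\<lambda>\<omega>. ((?S ?a ?b i j \<omega>)\<^sup>2 + (?S ?b ?a i j \<omega>)\<^sup>2) / 2"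
    have U: "integrable M ?U"
      by (intro integrable_divide_zero Bochner_Integration.integrable_add 1(1) 2(1))
    have le: "(diff2 m n k \<omega> $ i $ j)\<^sup>2 \<le> ?U \<omega>" for \<omega>
      unfolding entry by (rule half_difference_sq_le)
    have meas: "(\<lambda>\<omega>. (diff2 m n k \<omega> $ i $ j)\<^sup>2) \<in> borel_measurable M"
      unfolding entry using in_range
      by (intro borel_measurable_power borel_measurable_divide borel_measurable_diff borel_measurable_sum
          borel_measurable_times measurable_inc borel_measurable_const) auto
    have int: "integrable M (\<lambda>\<omega>. (diff2 m n k \<omega> $ i $ j)\<^sup>2)"
      by (rule integrable_nonneg_dominated[OF U meas zero_le_power2 le])
    have "expectation (\<lambda>\<omega>. (diff2 m n k \<omega> $ i $ j)\<^sup>2) \<le> expectation ?U"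
      by (rule integral_mono[OF int U le])
    also have "\<dots> = (expectation (\<lambda>\<omega>. (?S ?a ?b i j \<omega>)\<^sup>2) + expectation (\<lambda>\<omega>. (?S ?b ?a i j \<omega>)\<^sup>2)) / 2"
      by (simp only: integral_divide_zero Bochner_Integration.integral_add[OF 1(1) 2(1)])
    also have "\<dots> \<le> real (card L) * (C\<^sup>2 * \<eta> ^ (4 * ?N))" by (rule average_le[OF 1(2) 2(2)])
    also have "\<dots> \<le> real (card L) * (C\<^sup>2 * \<eta> ^ (4 * m))"
      using \<eta> by (intro mult_left_mono power_decreasing) auto
    also have "\<dots> = C\<^sup>2 * (2 ^ (m - n) * \<eta> ^ (4 * m))" by (simp add: L(2))
    finally show ?thesis using int by blast
  qed
  have fl: "fluct m n k = (\<lambda>\<omega>. \<Sum>i\<in>UNIV. \<Sum>j\<in>UNIV. (diff2 m n k \<omega> $ i $ j)\<^sup>2)"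
    by (simp add: fluct_def[abs_def] d1 norm_matrix_sq)
  show "integrable M (fluct m n k)"
    unfolding fl by (intro Bochner_Integration.integrable_sum conjunct1[OF entry_moment])
  have "expectation (fluct m n k) = (\<Sum>i\<in>UNIV. \<Sum>j\<in>UNIV. expectation (\<lambda>\<omega>. (diff2 m n k \<omega> $ i $ j)\<^sup>2))"
    unfolding fl
    by (subst Bochner_Integration.integral_sum;
        (intro sum.cong refl Bochner_Integration.integral_sum Bochner_Integration.integrable_sum
          conjunct1[OF entry_moment]))
  also have "\<dots> \<le> (\<Sum>i\<in>(UNIV::'d set). \<Sum>j\<in>(UNIV::'d set). C\<^sup>2 * (2 ^ (m - n) * \<eta> ^ (4 * m)))"
    by (intro sum_mono conjunct2[OF entry_moment])
  also have "\<dots> = real CARD('d) ^ 2 * C\<^sup>2 * (2 ^ (m - n) * \<eta> ^ (4 * m))"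
    by (simp add: power2_eq_square)
  finally show "expectation (fluct m n k) \<le> real CARD('d) ^ 2 * C\<^sup>2 * (2 ^ (m - n) * \<eta> ^ (4 * m))" .
qed

lemma norm_inc_fourth:
  assumes "k < 2 ^ n"
  shows "integrable M (\<lambda>\<omega>. norm (dyadic_inc (x \<omega>) n k) ^ 4)"
    and "expectation (\<lambda>\<omega>. norm (dyadic_inc (x \<omega>) n k) ^ 4) \<le> real CARD('d) ^ 2 * C * \<eta> ^ (4 * n)"
proof -
  let ?U = "\<lambda>\<omega>. real CARD('d) * (\<Sum>i\<in>UNIV. inc n k i \<omega> ^ 4)"
  have U: "integrable M ?U"
    by (rule integrable_mult_right, rule Bochner_Integration.integrable_sum, rule integrable_fourth[OF assms])
  note * = dyadic_endpoints[OF assms]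
  have meas: "(\<lambda>\<omega>. norm (dyadic_inc (x \<omega>) n k) ^ 4) \<in> borel_measurable M"
    unfolding dyadic_inc_def
    by (rule borel_measurable_power,
        rule measurable_compose[OF borel_measurable_diff[OF measurable_path measurable_path] borel_measurable_norm])
      (rule *)+
  show int: "integrable M (\<lambda>\<omega>. norm (dyadic_inc (x \<omega>) n k) ^ 4)"
    by (rule integrable_nonneg_dominated[OF U meas _ norm_vec_pow4_le]) simp
  have "expectation (\<lambda>\<omega>. norm (dyadic_inc (x \<omega>) n k) ^ 4) \<le> expectation ?U"
    by (intro integral_mono int U norm_vec_pow4_le)
  also have "\<dots> = real CARD('d) * (\<Sum>i\<in>UNIV. expectation (\<lambda>\<omega>. inc n k i \<omega> ^ 4))"
    by (simp only: integral_mult_right_zero Bochner_Integration.integral_sum[OF integrable_fourth[OF assms]])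
  also have "\<dots> \<le> real CARD('d) * (\<Sum>i\<in>(UNIV::'d set). C * \<eta> ^ (4 * n))"
    by (intro mult_left_mono sum_mono fourth_moment assms) auto
  also have "\<dots> = real CARD('d) ^ 2 * C * \<eta> ^ (4 * n)" by (simp add: power2_eq_square)
  finally show "expectation (\<lambda>\<omega>. norm (dyadic_inc (x \<omega>) n k) ^ 4) \<le> real CARD('d) ^ 2 * C * \<eta> ^ (4 * n)" .
qed

text \<open>
  On cells of level above \<open>m\<close> both approximations are affine, so everything is controlled by the
  increments over the ancestor cells, contracted by the ratio of the lengths.
\<close>

lemma fluct_fine:
  assumes "m < n" "k < 2 ^ n"
  shows "integrable M (fluct m n k)"
    and "expectation (fluct m n k) \<le> 153 * real CARD('d) ^ 2 * C\<^sup>2 * ((1 / 2) ^ (4 * (n - m)) * \<eta> ^ (4 * m))"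
proof -
  define r where "r = (1 / 2 :: real) ^ (4 * (n - m))"
  have r: "((1 / 2) ^ (n - m)) ^ 4 = r" "((1 / 2) ^ (n - Suc m)) ^ 4 = 16 * r"
  proof -
    show r: "((1 / 2) ^ (n - m)) ^ 4 = r" unfolding r_def by (simp only: mult.commute flip: power_mult)
    have "n - m = Suc (n - Suc m)" using assms(1) by simp
    then have "r = ((1 / 2) * (1 / 2) ^ (n - Suc m)) ^ 4" unfolding r[symmetric] by simp
    also have "\<dots> = (1 / 16) * ((1 / 2) ^ (n - Suc m)) ^ 4"
      unfolding power_mult_distrib by (rule arg_cong2[where f = "(*)"]) (simp_all add: power_divide)
    finally show "((1 / 2) ^ (n - Suc m)) ^ 4 = 16 * r" by simp
  qed
  define l where "l = k div 2 ^ (n - m)"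
  define l' where "l' = k div 2 ^ (n - Suc m)"
  have l: "l < 2 ^ m" "l' < 2 ^ Suc m"
    unfolding l_def l'_def using assms by (intro dyadic_ancestor; simp)+
  let ?s = "real k / 2 ^ n" and ?t = "(real k + 1) / 2 ^ n"
  let ?U = "\<lambda>\<omega>. 9 * (r * norm (dyadic_inc (x \<omega>) m l) ^ 4 + 16 * r * norm (dyadic_inc (x \<omega>) (Suc m) l') ^ 4)"
  have le: "fluct m n k \<omega> \<le> ?U \<omega>" for \<omega>
  proof -
    define u where "u = lev1 (lift m \<omega> ?s ?t)"
    define v where "v = lev1 (lift (Suc m) \<omega> ?s ?t)"
    have "u = (1 / 2) ^ (n - m) *\<^sub>R dyadic_inc (x \<omega>) m l"
      unfolding u_def lift_def l_def using assms by (intro lev1_lift_fine_cell) auto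
    then have u4: "norm u ^ 4 = r * norm (dyadic_inc (x \<omega>) m l) ^ 4"
      by (simp only: norm_scaleR power_mult_distrib) (simp add: r)
    have "v = (1 / 2) ^ (n - Suc m) *\<^sub>R dyadic_inc (x \<omega>) (Suc m) l'"
      unfolding v_def lift_def l'_def using assms by (intro lev1_lift_fine_cell) auto
    then have v4: "norm v ^ 4 = 16 * r * norm (dyadic_inc (x \<omega>) (Suc m) l') ^ 4"
      by (simp only: norm_scaleR power_mult_distrib) (simp add: r)
    have "lev2 (lift m \<omega> ?s ?t) = (1 / 2) *\<^sub>R outer u u"
      unfolding u_def lift_def using assms by (intro lev2_lift_fine_cell) auto
    moreover have "lev2 (lift (Suc m) \<omega> ?s ?t) = (1 / 2) *\<^sub>R outer v v"
      unfolding v_def lift_def using assms by (intro lev2_lift_fine_cell) auto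
    ultimately have "diff2 m n k \<omega> = (1 / 2) *\<^sub>R outer v v - (1 / 2) *\<^sub>R outer u u"
      by (simp add: diff2_def)
    then have "norm (diff2 m n k \<omega>) \<le> norm ((1 / 2) *\<^sub>R outer v v) + norm ((1 / 2) *\<^sub>R outer u u)"
      by (simp only: norm_triangle_ineq4)
    then have n2: "norm (diff2 m n k \<omega>) \<le> (norm v ^ 2 + norm u ^ 2) / 2"
      by (simp add: norm_outer power2_eq_square)
    have n1: "norm (diff1 m n k \<omega>) \<le> norm v + norm u"
      unfolding diff1_def u_def v_def by (rule norm_triangle_ineq4)
    have sq: "(a + b)\<^sup>2 \<le> 2 * (a\<^sup>2 + b\<^sup>2)" for a b :: real
      using sum_squares_bound[of a b] by (simp add: power2_sum)
    have sq_sq: "(a\<^sup>2)\<^sup>2 = a ^ 4" for a :: real by (simp flip: power_mult)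
    have "norm (diff1 m n k \<omega>) ^ 4 \<le> (norm v + norm u) ^ 4" using n1 by (intro power_mono) auto
    also have "\<dots> = ((norm v + norm u)\<^sup>2)\<^sup>2" by (simp only: sq_sq)
    also have "\<dots> \<le> (2 * ((norm v)\<^sup>2 + (norm u)\<^sup>2))\<^sup>2" by (intro power_mono sq) auto
    also have "\<dots> = 4 * ((norm v)\<^sup>2 + (norm u)\<^sup>2)\<^sup>2" unfolding power_mult_distrib by simp
    also have "\<dots> \<le> 4 * (2 * (norm v ^ 4 + norm u ^ 4))"
      using sq[of "(norm v)\<^sup>2" "(norm u)\<^sup>2"] unfolding sq_sq by simp
    finally have f1: "norm (diff1 m n k \<omega>) ^ 4 \<le> 8 * (norm v ^ 4 + norm u ^ 4)" by simp
    have "norm (diff2 m n k \<omega>) ^ 2 \<le> ((norm v ^ 2 + norm u ^ 2) / 2) ^ 2"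
      using n2 by (intro power_mono) auto
    also have "\<dots> = (norm v ^ 2 + norm u ^ 2) ^ 2 / 4" by (simp add: power_divide)
    also have "\<dots> \<le> norm v ^ 4 + norm u ^ 4"
      by (rule quarter_le[OF sq[of "(norm v)\<^sup>2" "(norm u)\<^sup>2", unfolded sq_sq]]) simp
    finally show ?thesis using f1 unfolding fluct_def u4[symmetric] v4[symmetric] by simp
  qed
  note 1 = norm_inc_fourth[OF l(1)] and 2 = norm_inc_fourth[OF l(2)]
  have U: "integrable M ?U"
    by (intro integrable_mult_right Bochner_Integration.integrable_add 1(1) 2(1))
  show int: "integrable M (fluct m n k)"
    by (rule integrable_nonneg_dominated[OF U measurable_fluct[OF assms(2)] fluct_nonneg le])
  have r0: "0 \<le> r" by (simp add: r_def)
  have "expectation (fluct m n k) \<le> expectation ?U" by (intro integral_mono int U le)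
  also have "\<dots> = 9 * (r * expectation (\<lambda>\<omega>. norm (dyadic_inc (x \<omega>) m l) ^ 4)
      + 16 * r * expectation (\<lambda>\<omega>. norm (dyadic_inc (x \<omega>) (Suc m) l') ^ 4))"
    by (simp only: integral_mult_right_zero
        Bochner_Integration.integral_add[OF integrable_mult_right[OF 1(1)] integrable_mult_right[OF 2(1)]])
  also have "\<dots> \<le> 9 * (r * (real CARD('d) ^ 2 * C * \<eta> ^ (4 * m)) + 16 * r * (real CARD('d) ^ 2 * C * \<eta> ^ (4 * m)))"
  proof -
    have "real CARD('d) ^ 2 * C * \<eta> ^ (4 * Suc m) \<le> real CARD('d) ^ 2 * C * \<eta> ^ (4 * m)"
      using \<eta> C by (intro mult_left_mono power_decreasing) auto
    note * = order_trans[OF 2(2) this]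
    have n1: "r * expectation (\<lambda>\<omega>. norm (dyadic_inc (x \<omega>) m l) ^ 4) \<le> r * (real CARD('d) ^ 2 * C * \<eta> ^ (4 * m))"
      by (rule mult_left_mono[OF 1(2) r0])
    have n2: "16 * r * expectation (\<lambda>\<omega>. norm (dyadic_inc (x \<omega>) (Suc m) l') ^ 4)
        \<le> 16 * r * (real CARD('d) ^ 2 * C * \<eta> ^ (4 * m))"
      by (rule mult_left_mono[OF *]) (use r0 in simp)
    show ?thesis by (rule mult_left_mono[OF add_mono[OF n1 n2]]) simp
  qed
  \<comment> \<open>\<open>153 = 9 * (1 + 16)\<close>\<close>
  also have "\<dots> = 153 * real CARD('d) ^ 2 * C * (r * \<eta> ^ (4 * m))" by simp
  also have "\<dots> \<le> 153 * real CARD('d) ^ 2 * C\<^sup>2 * (r * \<eta> ^ (4 * m))"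
    using C r0 \<eta> by (intro mult_right_mono mult_left_mono) (auto simp: power2_eq_square)
  finally show "expectation (fluct m n k) \<le> 153 * real CARD('d) ^ 2 * C\<^sup>2 * ((1 / 2) ^ (4 * (n - m)) * \<eta> ^ (4 * m))"
    unfolding r_def .
qed

end

section \<open>The random control\<close>

text \<open>
  The families of intervals contained in two adjacent intervals are disjoint, hence summing weights
  over contained intervals is superadditive.
\<close>

lemma control_infsum:
  fixes w l r :: "'i \<Rightarrow> real"
  assumes w: "\<And>i. i \<in> I \<Longrightarrow> 0 \<le> w i" and sum: "w summable_on I" and lr: "\<And>i. i \<in> I \<Longrightarrow> l i < r i"
  defines "V \<equiv> \<lambda>s t. infsum w {i \<in> I. s \<le> l i \<and> r i \<le> t}"
  shows "control V" and "\<And>i. i \<in> I \<Longrightarrow> w i \<le> V (l i) (r i)"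
proof -
  let ?J = "\<lambda>s t. {i \<in> I. s \<le> l i \<and> r i \<le> t}"
  have sub: "w summable_on J" if "J \<subseteq> I" for J
    using summable_on_subset_banach[OF sum that] .
  show "control V"
    unfolding control_def V_def
  proof (intro conjI allI impI)
    fix s t :: real
    show "0 \<le> infsum w (?J s t)" by (rule infsum_nonneg) (use w in auto)
  next
    fix s u t :: real assume "s \<le> u" "u \<le> t"
    have "infsum w (?J s u) + infsum w (?J u t) = infsum w (?J s u \<union> ?J u t)"
    proof (rule infsum_Un_disjoint[symmetric])
      show "?J s u \<inter> ?J u t = {}" using lr by fastforce
    qed (auto intro!: sub)
    also have "\<dots> \<le> infsum w (?J s t)"
      using \<open>s \<le> u\<close> \<open>u \<le> t\<close> w by (intro infsum_mono_neutral sub) auto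
    finally show "infsum w (?J s u) + infsum w (?J u t) \<le> infsum w (?J s t)" .
  qed
  fix i assume i: "i \<in> I"
  have "sum w {i} \<le> infsum w (?J (l i) (r i))"
    using i w by (intro finite_sum_le_infsum sub) auto
  then show "w i \<le> V (l i) (r i)" by (simp add: V_def)
qed

text \<open>
  An elementary substitute for Jensen's inequality, sufficient as only the order of magnitude of
  the moment matters.
\<close>

lemma powr_le_affine:
  fixes y \<sigma> a :: real
  assumes "0 \<le> y" "0 < \<sigma>" "0 \<le> a" "a \<le> 1"
  shows "y powr a \<le> \<sigma> powr a * (1 + y / \<sigma>)"
proof -
  have "(y / \<sigma>) powr a \<le> 1 + y / \<sigma>"
  proof (cases "y / \<sigma> \<le> 1")
    case True
    then have "(y / \<sigma>) powr a \<le> 1 powr a" using assms by (intro powr_mono2) auto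
    then show ?thesis using assms by (simp add: add_increasing2)
  next
    case False
    then have "(y / \<sigma>) powr a \<le> (y / \<sigma>) powr 1" using assms by (intro powr_mono) auto
    then show ?thesis using False assms by simp
  qed
  then have "\<sigma> powr a * (y / \<sigma>) powr a \<le> \<sigma> powr a * (1 + y / \<sigma>)" by (intro mult_left_mono) auto
  then show ?thesis using assms by (simp add: powr_divide)
qed

text \<open>By monotone convergence the double series has a finite expectation.\<close>

lemma (in prob_space) AE_double_sum_bounded:
  fixes R :: "nat \<Rightarrow> nat \<Rightarrow> 'a \<Rightarrow> real"
  assumes int: "\<And>m n. integrable M (R m n)" and nn: "\<And>m n \<omega>. 0 \<le> R m n \<omega>"
    and le: "\<And>m n. expectation (R m n) \<le> c * \<gamma> ^ (n + m)" and c: "0 \<le> c" and \<gamma>: "0 < \<gamma>" "\<gamma> < 1"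
  shows "AE \<omega> in M. \<exists>B. \<forall>N. (\<Sum>m<N. \<Sum>n<N. R m n \<omega>) \<le> B"
proof -
  have meas [measurable]: "R m n \<in> borel_measurable M" for m n using int by auto
  let ?G = "\<lambda>\<omega>. \<Sum>m. \<Sum>n. ennreal (R m n \<omega>)"
  have geo: "(\<Sum>n. ennreal (C * \<gamma> ^ n)) = ennreal (C / (1 - \<gamma>))" if "0 \<le> C" for C
  proof (rule suminf_ennreal_eq)
    show "0 \<le> C * \<gamma> ^ n" for n using that \<gamma> by simp
    show "(\<lambda>n. C * \<gamma> ^ n) sums (C / (1 - \<gamma>))"
      using sums_mult[OF geometric_sums[of \<gamma>], of C] \<gamma> by simp
  qed
  have "(\<integral>\<^sup>+\<omega>. ?G \<omega> \<partial>M) = (\<Sum>m. \<Sum>n. \<integral>\<^sup>+\<omega>. ennreal (R m n \<omega>) \<partial>M)"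
    by (subst nn_integral_suminf) (auto simp: nn_integral_suminf)
  also have "\<dots> = (\<Sum>m. \<Sum>n. ennreal (expectation (R m n)))"
    by (intro suminf_cong nn_integral_eq_integral int AE_I2 nn)
  also have "\<dots> \<le> (\<Sum>m. \<Sum>n. ennreal (c * \<gamma> ^ m * \<gamma> ^ n))"
    by (intro suminf_le ennreal_leI summableI) (use le in \<open>auto simp: power_add mult.commute mult.left_commute\<close>)
  also have "\<dots> = (\<Sum>m. ennreal (c / (1 - \<gamma>) * \<gamma> ^ m))"
  proof (rule suminf_cong)
    fix m
    have "0 \<le> c * \<gamma> ^ m" using c \<gamma> by simp
    from geo[OF this] show "(\<Sum>n. ennreal (c * \<gamma> ^ m * \<gamma> ^ n)) = ennreal (c / (1 - \<gamma>) * \<gamma> ^ m)"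
      by simp
  qed
  also have "\<dots> = ennreal (c / (1 - \<gamma>) / (1 - \<gamma>))"
    using c \<gamma> by (intro geo) auto
  finally have "(\<integral>\<^sup>+\<omega>. ?G \<omega> \<partial>M) \<noteq> \<infinity>" by (auto simp: top_unique)
  then have "AE \<omega> in M. ?G \<omega> \<noteq> \<infinity>" by (intro nn_integral_PInf_AE) auto
  then show ?thesis
  proof (rule AE_mp, intro AE_I2 impI)
    fix \<omega> assume fin: "?G \<omega> \<noteq> \<infinity>"
    have "(\<Sum>m<N. \<Sum>n<N. R m n \<omega>) \<le> enn2real (?G \<omega>)" for N
    proof -
      have "ennreal (\<Sum>m<N. \<Sum>n<N. R m n \<omega>) = (\<Sum>m<N. \<Sum>n<N. ennreal (R m n \<omega>))"
        using nn by (simp add: sum_nonneg flip: sum_ennreal)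
      also have "\<dots> \<le> (\<Sum>m<N. \<Sum>n. ennreal (R m n \<omega>))"
        by (intro sum_mono sum_le_suminf summableI) auto
      also have "\<dots> \<le> ?G \<omega>" by (intro sum_le_suminf summableI) auto
      finally have "ennreal (\<Sum>m<N. \<Sum>n<N. R m n \<omega>) \<le> ?G \<omega>" .
      then have "enn2real (ennreal (\<Sum>m<N. \<Sum>n<N. R m n \<omega>)) \<le> enn2real (?G \<omega>)"
        by (rule enn2real_mono) (use fin in \<open>simp add: top.not_eq_extremum\<close>)
      then show ?thesis using nn by (simp add: sum_nonneg)
    qed
    then show "\<exists>B. \<forall>N. (\<Sum>m<N. \<Sum>n<N. R m n \<omega>) \<le> B" by blast
  qed
qed


context increment_process
begin

context
  fixes p \<delta> :: real
  assumes \<delta>: "0 < \<delta>" and p: "1 + \<delta> \<le> p" "p \<le> 4" and \<eta>_le: "\<eta> \<le> 2 powr (- ((1 + 2 * \<delta>) / p))"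
begin

lemma p_pos: "0 < p"
  using \<delta> p by simp

lemma eta_power_le: "\<eta> ^ (4 * m) \<le> 2 powr (- (4 / p) * ((1 + 2 * \<delta>) * real m))"
proof -
  have "\<eta> ^ (4 * m) \<le> (2 powr (- ((1 + 2 * \<delta>) / p))) ^ (4 * m)"
    using \<eta> \<eta>_le by (intro power_mono) auto
  also have "\<dots> = 2 powr (- ((1 + 2 * \<delta>) / p) * real (4 * m))"
    by (simp add: powr_powr flip: powr_realpow)
  also have "- ((1 + 2 * \<delta>) / p) * real (4 * m) = - (4 / p) * ((1 + 2 * \<delta>) * real m)" by simp
  finally show ?thesis .
qed

text \<open>
  Both regimes give the same exponent: the sum over the \<open>2 ^ n\<close> cells of a level leaves the
  factor \<open>2 powr (- \<delta> * (n + m))\<close>, as \<open>p \<le> 4\<close> makes long cells and \<open>1 + \<delta> \<le> p\<close>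
  makes short cells contribute no more than those with \<open>n = m\<close>.
\<close>

lemma fluct_moment:
  assumes "k < 2 ^ n"
  shows "integrable M (fluct m n k)"
    and "expectation (fluct m n k)
      \<le> 153 * real CARD('d) ^ 2 * C\<^sup>2 * 2 powr (- (4 / p) * (real n + \<delta> * (real n + real m)))"
proof -
  let ?\<sigma> = "2 powr (- (4 / p) * (real n + \<delta> * (real n + real m)))"
  have dC: "0 \<le> real CARD('d) ^ 2 * C\<^sup>2" by simp
  have "integrable M (fluct m n k) \<and> expectation (fluct m n k) \<le> 153 * real CARD('d) ^ 2 * C\<^sup>2 * ?\<sigma>"
  proof (cases "n \<le> m")
    case True
    have "2 ^ (m - n) * \<eta> ^ (4 * m) \<le> 2 powr (real m - real n) * 2 powr (- (4 / p) * ((1 + 2 * \<delta>) * real m))"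
      using True eta_power_le[of m] by (simp add: powr_realpow[symmetric] of_nat_diff)
    also have "\<dots> = 2 powr (real m - real n - (4 / p) * ((1 + 2 * \<delta>) * real m))"
      by (simp flip: powr_add)
    also have "\<dots> \<le> ?\<sigma>"
    proof (rule powr_mono)
      have "p * (real m - real n) \<le> 4 * (real m - real n)" using True p by (intro mult_right_mono) auto
      moreover have "\<delta> * real n \<le> \<delta> * real m" using True \<delta> by (intro mult_left_mono) auto
      ultimately have "p * (real m - real n) \<le> 4 * ((1 + 2 * \<delta>) * real m - (real n + \<delta> * (real n + real m)))"
        by (simp add: algebra_simps)
      then have "real m - real n \<le> (4 / p) * ((1 + 2 * \<delta>) * real m - (real n + \<delta> * (real n + real m)))"
        using p_pos by (simp add: field_simps)
      then show "real m - real n - (4 / p) * ((1 + 2 * \<delta>) * real m)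
          \<le> - (4 / p) * (real n + \<delta> * (real n + real m))"
        unfolding right_diff_distrib by linarith
    qed simp
    finally have *: "2 ^ (m - n) * \<eta> ^ (4 * m) \<le> ?\<sigma>" .
    have "expectation (fluct m n k) \<le> real CARD('d) ^ 2 * C\<^sup>2 * (2 ^ (m - n) * \<eta> ^ (4 * m))"
      by (rule fluct_coarse(2)[OF True assms])
    also have "\<dots> \<le> real CARD('d) ^ 2 * C\<^sup>2 * ?\<sigma>" by (rule mult_left_mono[OF * dC])
    also have "\<dots> \<le> 153 * (real CARD('d) ^ 2 * C\<^sup>2 * ?\<sigma>)" by simp
    finally show ?thesis using fluct_coarse(1)[OF True assms] by (simp add: mult.assoc)
  next
    case False
    then have mn: "m < n" by simp
    have half: "(1 / 2 :: real) ^ (4 * (n - m)) = 2 powr (- 4 * (real n - real m))"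
    proof -
      have "(1 / 2 :: real) ^ (4 * (n - m)) = inverse (2 ^ (4 * (n - m)))" by (simp add: power_one_over inverse_eq_divide)
      also have "\<dots> = 2 powr (- real (4 * (n - m)))" by (simp add: powr_minus flip: powr_realpow)
      finally show ?thesis using mn by (simp add: of_nat_diff)
    qed
    have "(1 / 2) ^ (4 * (n - m)) * \<eta> ^ (4 * m)
        \<le> 2 powr (- 4 * (real n - real m)) * 2 powr (- (4 / p) * ((1 + 2 * \<delta>) * real m))"
      unfolding half by (intro mult_left_mono eta_power_le) auto
    also have "\<dots> = 2 powr (- 4 * (real n - real m) - (4 / p) * ((1 + 2 * \<delta>) * real m))"
      by (simp flip: powr_add)
    also have "\<dots> \<le> ?\<sigma>"
    proof (rule powr_mono)
      have "(1 + \<delta>) * (real n - real m) \<le> p * (real n - real m)" using mn p by (intro mult_right_mono) auto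
      then have "4 * ((real n + \<delta> * (real n + real m)) - (1 + 2 * \<delta>) * real m) \<le> p * (4 * (real n - real m))"
        by (simp add: algebra_simps)
      then have "(4 / p) * ((real n + \<delta> * (real n + real m)) - (1 + 2 * \<delta>) * real m) \<le> 4 * (real n - real m)"
        using p_pos by (simp add: field_simps)
      then show "- 4 * (real n - real m) - (4 / p) * ((1 + 2 * \<delta>) * real m)
          \<le> - (4 / p) * (real n + \<delta> * (real n + real m))"
        unfolding right_diff_distrib by linarith
    qed simp
    finally have *: "(1 / 2) ^ (4 * (n - m)) * \<eta> ^ (4 * m) \<le> ?\<sigma>" .
    have "expectation (fluct m n k)
        \<le> 153 * real CARD('d) ^ 2 * C\<^sup>2 * ((1 / 2) ^ (4 * (n - m)) * \<eta> ^ (4 * m))"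
      by (rule fluct_fine(2)[OF mn assms])
    also have "\<dots> \<le> 153 * real CARD('d) ^ 2 * C\<^sup>2 * ?\<sigma>"
      by (rule mult_left_mono[OF *]) simp
    finally show ?thesis using fluct_fine(1)[OF mn assms] by blast
  qed
  then show "integrable M (fluct m n k)"
    "expectation (fluct m n k) \<le> 153 * real CARD('d) ^ 2 * C\<^sup>2 * ?\<sigma>" by blast+
qed

definition \<gamma> :: real where "\<gamma> = 2 powr (- \<delta> / 2)"

lemma \<gamma>: "0 < \<gamma>" "\<gamma> < 1"
  using \<delta> by (simp_all add: \<gamma>_def powr_less_one)

text \<open>
  The control sums the powers \<open>fluct powr (p / 4)\<close> with the weights \<open>1 / \<gamma> ^ (n + m)\<close>. The expectations
  decay like \<open>\<gamma> ^ (2 * (n + m))\<close> on each level: half of this pays for the weight, the other half for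
  summability.
\<close>

lemma AE_control:
  "AE \<omega> in M. \<exists>V. control V \<and> (\<forall>m n k. k < 2 ^ n \<longrightarrow>
     fluct m n k \<omega> powr (p / 4) \<le> \<gamma> ^ (n + m) * on_cell V n k)"
proof -
  define A where "A = 153 * real CARD('d) ^ 2 * C\<^sup>2"
  have A: "0 \<le> A" by (simp add: A_def)
  define w where "w m n k \<omega> = fluct m n k \<omega> powr (p / 4) / \<gamma> ^ (n + m)" for m n k \<omega>
  define R where "R m n \<omega> = (\<Sum>k<2 ^ n. w m n k \<omega>)" for m n \<omega>
  have w0: "0 \<le> w m n k \<omega>" for m n k \<omega> using \<gamma> by (simp add: w_def)
  have w: "integrable M (w m n k)" "expectation (w m n k) \<le> (1 + A) * ((1 / 2) ^ n * \<gamma> ^ (n + m))"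
    if k: "k < 2 ^ n" for m n k
  proof -
    define \<sigma> where "\<sigma> = 2 powr (- (4 / p) * (real n + \<delta> * (real n + real m)))"
    have \<sigma>: "0 < \<sigma>" by (simp add: \<sigma>_def)
    have \<sigma>p: "\<sigma> powr (p / 4) = (1 / 2) ^ n * (\<gamma> ^ (n + m) * \<gamma> ^ (n + m))"
    proof -
      have "- (4 / p) * (real n + \<delta> * (real n + real m)) * (p / 4)
          = - real n + (- \<delta> / 2) * real (n + m) + (- \<delta> / 2) * real (n + m)"
        using p_pos by (simp add: field_simps)
      then have "\<sigma> powr (p / 4) = 2 powr (- real n + (- \<delta> / 2) * real (n + m) + (- \<delta> / 2) * real (n + m))"
        unfolding \<sigma>_def powr_powr by (rule arg_cong)
      also have "\<dots> = 2 powr (- real n) * (2 powr ((- \<delta> / 2) * real (n + m)) * 2 powr ((- \<delta> / 2) * real (n + m)))"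
        by (simp only: powr_add mult.assoc)
      also have "2 powr ((- \<delta> / 2) * real (n + m)) = \<gamma> ^ (n + m)"
        unfolding \<gamma>_def by (simp only: powr_powr[symmetric] powr_realpow powr_gt_zero)
      also have "2 powr (- real n) = (1 / 2) ^ n"
        by (simp add: powr_minus powr_realpow power_one_over inverse_eq_divide)
      finally show ?thesis .
    qed
    note F = fluct_moment[OF k, of m, folded \<sigma>_def A_def]
    have le: "w m n k \<omega> \<le> \<sigma> powr (p / 4) / \<gamma> ^ (n + m) * (1 + fluct m n k \<omega> / \<sigma>)" for \<omega>
      unfolding w_def using powr_le_affine[OF fluct_nonneg \<sigma>, of "p / 4" m n k \<omega>] p p_pos \<gamma>
      by (simp add: divide_right_mono)
    have U: "integrable M (\<lambda>\<omega>. \<sigma> powr (p / 4) / \<gamma> ^ (n + m) * (1 + fluct m n k \<omega> / \<sigma>))"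
      by (intro integrable_mult_right Bochner_Integration.integrable_add integrable_divide_zero F(1))
        (simp add: F(1))
    have meas: "w m n k \<in> borel_measurable M"
      unfolding w_def[abs_def] using measurable_fluct[OF k, of m] by measurable
    show int: "integrable M (w m n k)" by (rule integrable_nonneg_dominated[OF U meas w0 le])
    have "expectation (w m n k) \<le> expectation (\<lambda>\<omega>. \<sigma> powr (p / 4) / \<gamma> ^ (n + m) * (1 + fluct m n k \<omega> / \<sigma>))"
      by (rule integral_mono[OF int U le])
    also have "\<dots> = \<sigma> powr (p / 4) / \<gamma> ^ (n + m) * (1 + expectation (fluct m n k) / \<sigma>)"
      using F(1) by (simp add: prob_space)
    also have "\<dots> \<le> \<sigma> powr (p / 4) / \<gamma> ^ (n + m) * (1 + A)"
      using F(2) \<sigma> \<gamma> by (intro mult_left_mono add_left_mono) (auto simp: pos_divide_le_eq)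
    also have "\<sigma> powr (p / 4) / \<gamma> ^ (n + m) = (1 / 2) ^ n * \<gamma> ^ (n + m)"
      unfolding \<sigma>p using \<gamma> by simp
    finally show "expectation (w m n k) \<le> (1 + A) * ((1 / 2) ^ n * \<gamma> ^ (n + m))"
      by (simp add: mult.commute)
  qed
  have "AE \<omega> in M. \<exists>B. \<forall>N. (\<Sum>m<N. \<Sum>n<N. R m n \<omega>) \<le> B"
  proof (rule AE_double_sum_bounded[where c = "1 + A", OF _ _ _ _ \<gamma>])
    fix m n \<omega>
    show "integrable M (R m n)" unfolding R_def[abs_def] by (intro Bochner_Integration.integrable_sum w(1)) simp
    show "0 \<le> R m n \<omega>" unfolding R_def by (intro sum_nonneg w0)
    have "expectation (R m n) = (\<Sum>k<2 ^ n. expectation (w m n k))"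
      unfolding R_def by (intro Bochner_Integration.integral_sum w(1)) simp
    also have "\<dots> \<le> (\<Sum>k<(2::nat) ^ n. (1 + A) * ((1 / 2) ^ n * \<gamma> ^ (n + m)))"
      by (intro sum_mono w(2)) simp
    also have "\<dots> = (1 + A) * \<gamma> ^ (n + m)" by (simp add: power_one_over)
    finally show "expectation (R m n) \<le> (1 + A) * \<gamma> ^ (n + m)" .
  qed (use A in simp)
  then show ?thesis
  proof (rule AE_mp, intro AE_I2 impI)
    fix \<omega> assume "\<exists>B. \<forall>N. (\<Sum>m<N. \<Sum>n<N. R m n \<omega>) \<le> B"
    then obtain B where B: "\<And>N. (\<Sum>m<N. \<Sum>n<N. R m n \<omega>) \<le> B" by blast
    define I where "I = (SIGMA m:(UNIV :: nat set). SIGMA n:(UNIV :: nat set). {..<(2::nat) ^ n})"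
    define W where "W = (\<lambda>(m, n, k). w m n k \<omega>)"
    have W0: "0 \<le> W i" for i by (simp add: W_def w0 split_def)
    have "sum W F \<le> B" if F: "finite F" "F \<subseteq> I" for F
    proof -
      obtain N where N: "\<And>m n k. (m, n, k) \<in> F \<Longrightarrow> m < N \<and> n < N"
      proof -
        have "finite (fst ` F \<union> (fst \<circ> snd) ` F)" using F(1) by simp
        then obtain N where N: "\<forall>a \<in> fst ` F \<union> (fst \<circ> snd) ` F. a < N"
          using finite_nat_set_iff_bounded by blast
        have "m < N \<and> n < N" if "(m, n, k) \<in> F" for m n k
          using bspec[OF N, of m] bspec[OF N, of n] that by force
        then show ?thesis using that by blast
      qed
      have "sum W F \<le> sum W (SIGMA m:{..<N}. SIGMA n:{..<N}. {..<2 ^ n})"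
      proof (rule sum_mono2)
        show "F \<subseteq> (SIGMA m:{..<N}. SIGMA n:{..<N}. {..<2 ^ n})"
        proof
          fix i assume i: "i \<in> F"
          obtain m n k where mnk: "i = (m, n, k)" by (metis prod_cases3)
          have "k < 2 ^ n" using F(2) i unfolding mnk I_def by blast
          then show "i \<in> (SIGMA m:{..<N}. SIGMA n:{..<N}. {..<2 ^ n})"
            using N[of m n k] i unfolding mnk by simp
        qed
      qed (use W0 in auto)
      also have "\<dots> = (\<Sum>m<N. \<Sum>n<N. R m n \<omega>)"
        unfolding W_def R_def by (simp add: sum.Sigma)
      finally show ?thesis using B[of N] by linarith
    qed
    then have "bdd_above (sum W ` {F. F \<subseteq> I \<and> finite F})" by (intro bdd_aboveI[where M = B]) auto
    then have summ: "W summable_on I" by (intro nonneg_bdd_above_summable_on W0)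
    let ?l = "\<lambda>(m :: nat, n :: nat, k :: nat). real k / 2 ^ n"
    let ?r = "\<lambda>(m :: nat, n :: nat, k :: nat). (real k + 1) / 2 ^ n"
    have lr: "?l i < ?r i" for i by (auto simp: split_def divide_strict_right_mono)
    note ctrl = control_infsum[where I = I and l = ?l and r = ?r, OF W0 summ lr]
    define V where "V s t = infsum W {i \<in> I. s \<le> ?l i \<and> ?r i \<le> t}" for s t
    have "control V" unfolding V_def[abs_def] by (rule ctrl(1))
    moreover have "fluct m n k \<omega> powr (p / 4) \<le> \<gamma> ^ (n + m) * on_cell V n k"
      if "k < 2 ^ n" for m n k
    proof -
      have "(m, n, k) \<in> I" using that by (simp add: I_def)
      from ctrl(2)[OF this] have "w m n k \<omega> \<le> on_cell V n k"
        unfolding V_def W_def by simp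
      then show ?thesis unfolding w_def using \<gamma> by (simp add: pos_divide_le_eq mult.commute)
    qed
    ultimately show "\<exists>V. control V \<and> (\<forall>m n k. k < 2 ^ n \<longrightarrow>
       fluct m n k \<omega> powr (p / 4) \<le> \<gamma> ^ (n + m) * on_cell V n k)" by blast
  qed
qed

lemma rough_path_lift: "rough_path p (lift m \<omega>)"
  unfolding lift_def using \<delta> p by (intro rough_path_smooth_lift regular_path_dyadic_interp) simp

text \<open>
  The first approximation, linear on \<open>[0,1]\<close>, is not a difference; it is absorbed by adding a
  multiple of the length to the control.
\<close>

lemma AE_lift_converges:
  "AE \<omega> in M. rough_path p (\<lambda>s t. lim (\<lambda>m. lift m \<omega> s t)) \<and>
     (\<lambda>m. rp_dist p (lift m \<omega>) (\<lambda>s t. lim (\<lambda>m. lift m \<omega> s t))) \<longlonglongrightarrow> 0"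
  using AE_control
proof (rule AE_mp, intro AE_I2 impI)
  fix \<omega>
  assume "\<exists>V. control V \<and> (\<forall>m n k. k < 2 ^ n \<longrightarrow>
    fluct m n k \<omega> powr (p / 4) \<le> \<gamma> ^ (n + m) * on_cell V n k)"
  then obtain V where V: "control V" and fl: "\<And>m n k. k < 2 ^ n \<Longrightarrow>
    fluct m n k \<omega> powr (p / 4) \<le> \<gamma> ^ (n + m) * on_cell V n k" by blast
  define K where "K = norm (x \<omega> 1 - x \<omega> 0) powr p"
  have K: "0 \<le> K" by (simp add: K_def)
  define U where "U s t = V s t + K * (t - s)" for s t
  have U: "control U" unfolding U_def[abs_def] by (rule control_add[OF V control_length[OF K]])
  define \<rho>1 where "\<rho>1 = \<gamma> powr (1 / p)"
  \<comment> \<open>On a cell of level \<open>n\<close> the straight line contributes \<open>(1 / 2) ^ n\<close>, of which the length in the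
    control accounts for \<open>(1 / 2) powr (n / p)\<close>; \<open>\<rho>2\<close> is what remains per level.\<close>
  define \<rho>2 where "\<rho>2 = (2 :: real) powr (1 / p - 1)"
  define \<rho> where "\<rho> = max \<rho>1 \<rho>2"
  have "1 < p" using \<delta> p by simp
  then have r12: "0 < \<rho>1" "\<rho>1 < 1" "0 < \<rho>2" "\<rho>2 < 1"
    using \<gamma> by (auto simp: \<rho>1_def \<rho>2_def powr_less_one powr01_less_one)
  then have \<rho>: "0 < \<rho>" "\<rho> < 1" "\<rho>1 \<le> \<rho>" "\<rho>2 \<le> \<rho>" by (auto simp: \<rho>_def)
  have drop: "q powr (2 / p) = (q powr (1 / p))\<^sup>2" for q :: real
    by (simp add: power2_eq_square flip: powr_add)
  have nn: "0 \<le> on_cell U n k" "0 \<le> on_cell V n k"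
    "on_cell V n k \<le> on_cell U n k"
    "K * (1 / 2 ^ n) \<le> on_cell U n k" if "k < 2 ^ n" for n k
  proof -
    note e = dyadic_endpoints(1-3)[OF that]
    show v: "0 \<le> on_cell V n k" by (rule control_nonneg[OF V e])
    have len: "(real k + 1) / 2 ^ n - real k / 2 ^ n = 1 / 2 ^ n" by (simp flip: diff_divide_distrib)
    have "0 \<le> K * (1 / 2 ^ n)" using K by simp
    then show "on_cell V n k \<le> on_cell U n k"
      "K * (1 / 2 ^ n) \<le> on_cell U n k"
      "0 \<le> on_cell U n k"
      unfolding U_def len using v by linarith+
  qed
  have root: "(fluct m n k \<omega>) powr (1 / 4) \<le> \<rho> ^ (n + m) * on_cell U n k powr (1 / p)"
    if "k < 2 ^ n" for m n k
  proof -
    let ?V = "on_cell V n k" and ?U = "on_cell U n k"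
    have "(fluct m n k \<omega>) powr (1 / 4) = (fluct m n k \<omega> powr (p / 4)) powr (1 / p)"
      using p_pos by (simp add: powr_powr)
    also have "\<dots> \<le> (\<gamma> ^ (n + m) * ?V) powr (1 / p)"
      using p_pos by (intro powr_mono2 fl that) auto
    also have "\<dots> = (\<gamma> ^ (n + m)) powr (1 / p) * ?V powr (1 / p)"
      by (rule powr_mult)
    also have "(\<gamma> ^ (n + m)) powr (1 / p) = \<rho>1 ^ (n + m)"
      unfolding \<rho>1_def using \<gamma> by (simp add: powr_powr mult.commute flip: powr_realpow)
    also have "\<rho>1 ^ (n + m) * ?V powr (1 / p) \<le> \<rho> ^ (n + m) * ?U powr (1 / p)"
      using r12 \<rho> nn[OF that] p_pos by (intro mult_mono power_mono powr_mono2) auto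
    finally show ?thesis .
  qed
  have root4: "(z ^ 4) powr (1 / 4) = z" and root2: "(z ^ 2) powr (1 / 2) = z" if "0 \<le> z" for z :: real
  proof -
    have *: "z ^ 4 = z powr 4" "z ^ 2 = z powr 2" using that by simp_all
    show "(z ^ 4) powr (1 / 4) = z" "(z ^ 2) powr (1 / 2) = z"
      unfolding * powr_powr using that by simp_all
  qed
  have d1: "norm (diff1 m n k \<omega>) \<le> fluct m n k \<omega> powr (1 / 4)" for m n k
  proof -
    have "(norm (diff1 m n k \<omega>) ^ 4) powr (1 / 4) \<le> fluct m n k \<omega> powr (1 / 4)"
      by (intro powr_mono2) (auto simp: fluct_def)
    then show ?thesis by (simp only: root4 norm_ge_zero)
  qed
  have d2: "norm (diff2 m n k \<omega>) \<le> (fluct m n k \<omega> powr (1 / 4))\<^sup>2" for m n k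
  proof -
    have "(norm (diff2 m n k \<omega>) ^ 2) powr (1 / 2) \<le> fluct m n k \<omega> powr (1 / 2)"
      by (intro powr_mono2) (auto simp: fluct_def)
    also have "\<dots> = (fluct m n k \<omega> powr (1 / 4))\<^sup>2"
      by (simp add: power2_eq_square flip: powr_add)
    finally show ?thesis by (simp only: root2 norm_ge_zero)
  qed
  have start: "norm (lev1 (on_cell (lift 0 \<omega>) n k))
      \<le> \<rho> ^ n * on_cell U n k powr (1 / p)" if k: "k < 2 ^ n" for n k
  proof -
    have "lev1 (on_cell (lift 0 \<omega>) n k) = (1 / 2) ^ n *\<^sub>R (x \<omega> 1 - x \<omega> 0)"
      unfolding lift_def using lev1_lift_fine_cell[OF le0 k, of "x \<omega>"] k by (simp add: dyadic_inc_def)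
    then have "norm (lev1 (on_cell (lift 0 \<omega>) n k)) = (1 / 2) ^ n * K powr (1 / p)"
      using p_pos by (simp add: K_def powr_powr)
    also have "(1 / 2 :: real) ^ n = \<rho>2 ^ n * (1 / 2 ^ n) powr (1 / p)"
    proof -
      have "(1 / 2 :: real) ^ n = 2 powr (- real n)"
        by (simp add: powr_minus power_one_over inverse_eq_divide flip: powr_realpow)
      also have "- real n = (1 / p - 1) * real n + - (real n / p)" by (simp add: field_simps)
      also have "(2 :: real) powr \<dots> = 2 powr ((1 / p - 1) * real n) * 2 powr (- (real n / p))" by (rule powr_add)
      also have "(2 :: real) powr ((1 / p - 1) * real n) = \<rho>2 ^ n"
        unfolding \<rho>2_def by (simp only: powr_powr[symmetric] powr_realpow powr_gt_zero)
      also have "(2 :: real) powr (- (real n / p)) = (1 / 2 ^ n) powr (1 / p)"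
        by (simp add: powr_minus powr_powr powr_divide inverse_eq_divide flip: powr_realpow)
      finally show ?thesis .
    qed
    also have "\<rho>2 ^ n * (1 / 2 ^ n) powr (1 / p) * K powr (1 / p) = \<rho>2 ^ n * (K * (1 / 2 ^ n)) powr (1 / p)"
      by (simp only: powr_mult ac_simps)
    also have "\<dots> \<le> \<rho> ^ n * on_cell U n k powr (1 / p)"
      using r12 \<rho> K nn(4)[OF k] p_pos by (intro mult_mono power_mono powr_mono2) auto
    finally show ?thesis .
  qed
  have square: "(\<rho> ^ N * q powr (1 / p))\<^sup>2 \<le> \<rho> ^ N * q powr (2 / p)" for N and q :: real
  proof -
    have "(\<rho> ^ N)\<^sup>2 \<le> \<rho> ^ N * 1"
      unfolding power2_eq_square using \<rho> by (intro mult_left_mono power_le_one) auto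
    then show ?thesis unfolding drop power_mult_distrib by (intro mult_right_mono) auto
  qed
  have level1: "norm (diff1 m n k \<omega>) \<le> \<rho> ^ (n + m) * on_cell U n k powr (1 / p)"
    and level2: "norm (diff2 m n k \<omega>) \<le> \<rho> ^ (n + m) * on_cell U n k powr (2 / p)"
    if k: "k < 2 ^ n" for m n k
  proof -
    show "norm (diff1 m n k \<omega>) \<le> \<rho> ^ (n + m) * on_cell U n k powr (1 / p)"
      by (rule order_trans[OF d1 root[OF k]])
    have "norm (diff2 m n k \<omega>) \<le> (\<rho> ^ (n + m) * on_cell U n k powr (1 / p))\<^sup>2"
      by (rule order_trans[OF d2 power_mono[OF root[OF k]]]) simp
    also have "\<dots> \<le> \<rho> ^ (n + m) * on_cell U n k powr (2 / p)" by (rule square)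
    finally show "norm (diff2 m n k \<omega>) \<le> \<dots>" .
  qed
  note limit = dyadic_estimates_limit[where X = "\<lambda>m. lift m \<omega>", OF U p_pos \<rho>(1,2) rough_path_lift start
      level1[unfolded diff1_def] level2[unfolded diff2_def]]
  show "rough_path p (\<lambda>s t. lim (\<lambda>m. lift m \<omega> s t)) \<and>
     (\<lambda>m. rp_dist p (lift m \<omega>) (\<lambda>s t. lim (\<lambda>m. lift m \<omega> s t))) \<longlonglongrightarrow> 0"
    by (rule conjI[OF limit]; assumption)
qed

end

end

section \<open>Dyadic increments of fractional and standard Brownian motion\<close>

lemma powr_concave_second_difference:
  fixes a x :: real
  assumes "0 < a" "a < 1" "1 \<le> x"
  shows "(x + 1) powr a + (x - 1) powr a \<le> 2 * x powr a"
proof -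
  \<comment> \<open>The tangent of the concave power at \<open>x\<close> lies above it.\<close>
  have tangent: "y powr a \<le> x powr a * (a * (y / x) + (1 - a))" if "0 \<le> y" for y
  proof (cases "y = 0")
    case True
    then show ?thesis using assms by simp
  next
    case False
    then have "0 < y / x" using that assms by simp
    then have "(y / x) powr a * 1 powr (1 - a) \<le> a * (y / x) + (1 - a) * 1"
      using assms by (intro Youngs_inequality_0) auto
    then have "(y / x) powr a \<le> a * (y / x) + (1 - a)" by simp
    then have "x powr a * (y / x) powr a \<le> x powr a * (a * (y / x) + (1 - a))"
      by (rule mult_left_mono) simp
    moreover have "x powr a * (y / x) powr a = y powr a"
      using assms by (simp flip: powr_mult)
    ultimately show ?thesis by simp
  qed
  have "(x + 1) powr a + (x - 1) powr a
      \<le> x powr a * (a * ((x + 1) / x) + (1 - a)) + x powr a * (a * ((x - 1) / x) + (1 - a))"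
    using assms by (intro add_mono tangent) auto
  also have "\<dots> = x powr a * (a * ((x + 1) / x + (x - 1) / x) + 2 * (1 - a))" by (simp add: algebra_simps)
  also have "(x + 1) / x + (x - 1) / x = 2" using assms by (simp add: field_simps)
  finally show ?thesis by (simp add: algebra_simps)
qed

text \<open>Covariance of the increments over two unit intervals at distance \<open>z\<close>, for Hurst parameter \<open>a / 2\<close>.\<close>

definition fgn_cov :: "real \<Rightarrow> real \<Rightarrow> real" where
  "fgn_cov a z = (\<bar>z + 1\<bar> powr a + \<bar>z - 1\<bar> powr a - 2 * \<bar>z\<bar> powr a) / 2"

lemma fgn_cov_minus: "fgn_cov a (- z) = fgn_cov a z"
proof -
  have "\<bar>- z + 1\<bar> = \<bar>z - 1\<bar>" "\<bar>- z - 1\<bar> = \<bar>z + 1\<bar>" by linarith+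
  then show ?thesis by (simp add: fgn_cov_def)
qed

text \<open>For \<open>a < 1\<close> increments over distinct intervals are negatively correlated, so the absolute values telescope.\<close>

lemma fgn_cov_abs_sum:
  assumes a: "0 < a" "a < 1"
  shows "(\<Sum>j<Suc K. \<bar>fgn_cov a (real j)\<bar>) = 3 / 2 - (real (Suc K) powr a - real K powr a) / 2"
proof (induction K)
  case 0
  show ?case by (simp add: fgn_cov_def)
next
  case (Suc K)
  have "(real (Suc K) + 1) powr a + (real (Suc K) - 1) powr a \<le> 2 * real (Suc K) powr a"
    using a by (intro powr_concave_second_difference) auto
  then have neg: "real (Suc (Suc K)) powr a + real K powr a - 2 * real (Suc K) powr a \<le> 0"
    by (simp add: add.commute)
  have "fgn_cov a (real (Suc K)) = (real (Suc (Suc K)) powr a + real K powr a - 2 * real (Suc K) powr a) / 2"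
    unfolding fgn_cov_def by (simp add: add.commute)
  then have "\<bar>fgn_cov a (real (Suc K))\<bar>
      = (2 * real (Suc K) powr a - real (Suc (Suc K)) powr a - real K powr a) / 2"
    by (simp only: abs_of_nonpos[OF divide_nonpos_pos[OF neg zero_less_numeral]]) (simp add: field_simps)
  then show ?case unfolding sum.lessThan_Suc[of _ "Suc K"] Suc.IH by (simp add: field_simps)
qed

text \<open>
  In a row of the covariance matrix every distance occurs at most twice.
\<close>

lemma fgn_cov_row_sum:
  assumes a: "0 < a" "a < 1"
  shows "(\<Sum>l<N. \<bar>fgn_cov a (real k - real l)\<bar>) \<le> 3"
proof -
  have half: "(\<Sum>j\<in>J. \<bar>fgn_cov a (real j)\<bar>) \<le> 3 / 2" if "finite J" for J
  proof -
    obtain K where "J \<subseteq> {..<Suc K}"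
      using \<open>finite J\<close> finite_nat_set_iff_bounded by (metis lessThan_iff less_Suc_eq subsetI)
    then have "(\<Sum>j\<in>J. \<bar>fgn_cov a (real j)\<bar>) \<le> (\<Sum>j<Suc K. \<bar>fgn_cov a (real j)\<bar>)"
      by (intro sum_mono2) auto
    also have "\<dots> \<le> 3 / 2"
      unfolding fgn_cov_abs_sum[OF a] using powr_mono2[of a "real K" "real (Suc K)"] a by simp
    finally show ?thesis .
  qed
  have "(\<Sum>l<N. \<bar>fgn_cov a (real k - real l)\<bar>)
      = (\<Sum>l\<in>{l. l < N \<and> l \<le> k}. \<bar>fgn_cov a (real k - real l)\<bar>)
        + (\<Sum>l\<in>{l. l < N \<and> k < l}. \<bar>fgn_cov a (real k - real l)\<bar>)"
    by (subst sum.union_disjoint[symmetric]) (auto intro!: sum.cong)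
  also have "(\<Sum>l\<in>{l. l < N \<and> l \<le> k}. \<bar>fgn_cov a (real k - real l)\<bar>)
      = (\<Sum>j\<in>(\<lambda>l. k - l) ` {l. l < N \<and> l \<le> k}. \<bar>fgn_cov a (real j)\<bar>)"
    by (subst sum.reindex) (auto simp: inj_on_def of_nat_diff intro!: sum.cong)
  also have "(\<Sum>l\<in>{l. l < N \<and> k < l}. \<bar>fgn_cov a (real k - real l)\<bar>)
      = (\<Sum>j\<in>(\<lambda>l. l - k) ` {l. l < N \<and> k < l}. \<bar>fgn_cov a (real j)\<bar>)"
  proof -
    have "fgn_cov a (real k - real l) = fgn_cov a (real l - real k)" for l
      using fgn_cov_minus[of a "real l - real k"] by simp
    then show ?thesis
      by (subst sum.reindex) (auto simp: inj_on_def of_nat_diff intro!: sum.cong)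
  qed
  finally show ?thesis
    using half[of "(\<lambda>l. k - l) ` {l. l < N \<and> l \<le> k}"] half[of "(\<lambda>l. l - k) ` {l. l < N \<and> k < l}"] by simp
qed

lemma centred_normal_moments:
  fixes Z :: "'w \<Rightarrow> real"
  assumes D: "distributed M lborel Z (\<lambda>x. ennreal (normal_density 0 \<sigma> x))" and "0 < \<sigma>"
  shows "integrable M (\<lambda>\<omega>. Z \<omega> ^ 2)" "integral\<^sup>L M (\<lambda>\<omega>. Z \<omega> ^ 2) = \<sigma>\<^sup>2"
    and "integrable M (\<lambda>\<omega>. Z \<omega> ^ 4)" "integral\<^sup>L M (\<lambda>\<omega>. Z \<omega> ^ 4) = 3 * \<sigma> ^ 4"
proof -
  have int: "integrable M (\<lambda>\<omega>. Z \<omega> ^ k)" for k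
    using distributed_integrable[OF D, of "\<lambda>x. x ^ k"] integrable_normal_moment[OF \<open>0 < \<sigma>\<close>, of 0 k] by simp
  show "integrable M (\<lambda>\<omega>. Z \<omega> ^ 2)" "integrable M (\<lambda>\<omega>. Z \<omega> ^ 4)" by (rule int)+
  have val: "integral\<^sup>L M (\<lambda>\<omega>. Z \<omega> ^ (2 * k)) = fact (2 * k) / ((2 / \<sigma>\<^sup>2) ^ k * fact k)" for k
    using distributed_integral[OF D, of "\<lambda>x. x ^ (2 * k)"]
      integral_normal_moment_even[OF \<open>0 < \<sigma>\<close>, of 0 k] by simp
  show "integral\<^sup>L M (\<lambda>\<omega>. Z \<omega> ^ 2) = \<sigma>\<^sup>2"
    using val[of 1] \<open>0 < \<sigma>\<close> by (simp add: fact_numeral)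
  show "integral\<^sup>L M (\<lambda>\<omega>. Z \<omega> ^ 4) = 3 * \<sigma> ^ 4"
    using val[of 2] \<open>0 < \<sigma>\<close> by (simp add: fact_numeral power_divide field_simps flip: power_mult)
qed

lemma centred_gaussian_moments:
  assumes "centred_gaussian_rv M Z"
  shows "integrable M (\<lambda>\<omega>. Z \<omega> ^ 2)" "integrable M (\<lambda>\<omega>. Z \<omega> ^ 4)"
    and "integral\<^sup>L M (\<lambda>\<omega>. Z \<omega> ^ 4) = 3 * (integral\<^sup>L M (\<lambda>\<omega>. Z \<omega> ^ 2))\<^sup>2"
proof -
  have meas [measurable]: "Z \<in> borel_measurable M" using assms by (simp add: centred_gaussian_rv_def)
  have "integrable M (\<lambda>\<omega>. Z \<omega> ^ 2) \<and> integrable M (\<lambda>\<omega>. Z \<omega> ^ 4)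
      \<and> integral\<^sup>L M (\<lambda>\<omega>. Z \<omega> ^ 4) = 3 * (integral\<^sup>L M (\<lambda>\<omega>. Z \<omega> ^ 2))\<^sup>2"
    using assms unfolding centred_gaussian_rv_def
  proof (elim conjE disjE)
    assume zero: "AE \<omega> in M. Z \<omega> = 0"
    have "integrable M (\<lambda>\<omega>. Z \<omega> ^ k) \<and> integral\<^sup>L M (\<lambda>\<omega>. Z \<omega> ^ k) = 0" if "0 < k" for k
    proof -
      have "AE \<omega> in M. Z \<omega> ^ k = 0" using zero by (rule AE_mp) (use that in auto)
      then show ?thesis
        using integrable_cong_AE[of "\<lambda>\<omega>. Z \<omega> ^ k" M "\<lambda>_. 0"] integral_cong_AE[of "\<lambda>\<omega>. Z \<omega> ^ k" M "\<lambda>_. 0"]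
        by simp
    qed
    from this[of 2] this[of 4] show ?thesis by simp
  next
    assume "\<exists>\<sigma>>0. distributed M lborel Z (\<lambda>x. ennreal (normal_density 0 \<sigma> x))"
    then obtain \<sigma> where "0 < \<sigma>" "distributed M lborel Z (\<lambda>x. ennreal (normal_density 0 \<sigma> x))" by blast
    from centred_normal_moments[OF this(2,1)] show ?thesis by (simp flip: power_mult)
  qed
  then show "integrable M (\<lambda>\<omega>. Z \<omega> ^ 2)" "integrable M (\<lambda>\<omega>. Z \<omega> ^ 4)"
    "integral\<^sup>L M (\<lambda>\<omega>. Z \<omega> ^ 4) = 3 * (integral\<^sup>L M (\<lambda>\<omega>. Z \<omega> ^ 2))\<^sup>2" by blast+
qed

lemma centred_gaussian_process_value:
  assumes "centred_gaussian_process M X" "t \<in> {0..1}"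
  shows "centred_gaussian_rv M (X t)"
  using assms(1)[unfolded centred_gaussian_process_def, rule_format, of "{t}" "\<lambda>_. 1"] assms(2) by simp

lemma centred_gaussian_process_increment:
  assumes X: "centred_gaussian_process M X" and st: "s \<in> {0..1}" "t \<in> {0..1}" "s \<noteq> t"
  shows "centred_gaussian_rv M (\<lambda>\<omega>. X t \<omega> - X s \<omega>)"
proof -
  have "(\<Sum>r\<in>{s, t}. (if r = t then 1 else - 1) * X r \<omega>) = X t \<omega> - X s \<omega>" for \<omega>
    using st(3) by simp
  then show ?thesis
    using X[unfolded centred_gaussian_process_def, rule_format, of "{s, t}" "\<lambda>r. if r = t then 1 else - 1"] st(1,2)
    by simp
qed

lemma integrable_product_of_squares:
  fixes U V :: "'w \<Rightarrow> real"
  assumes "U \<in> borel_measurable M" "V \<in> borel_measurable M"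
    and "integrable M (\<lambda>\<omega>. U \<omega> ^ 2)" "integrable M (\<lambda>\<omega>. V \<omega> ^ 2)"
  shows "integrable M (\<lambda>\<omega>. U \<omega> * V \<omega>)"
proof (rule Bochner_Integration.integrable_bound[OF Bochner_Integration.integrable_add[OF assms(3,4)]])
  show "(\<lambda>\<omega>. U \<omega> * V \<omega>) \<in> borel_measurable M" by (rule borel_measurable_times[OF assms(1,2)])
  have "norm (u * v) \<le> norm (u ^ 2 + v ^ 2)" for u v :: real
  proof -
    have "2 * (\<bar>u\<bar> * \<bar>v\<bar>) \<le> u ^ 2 + v ^ 2" using sum_squares_bound[of "\<bar>u\<bar>" "\<bar>v\<bar>"] by simp
    moreover have "0 \<le> \<bar>u\<bar> * \<bar>v\<bar>" by simp
    ultimately have "\<bar>u\<bar> * \<bar>v\<bar> \<le> u ^ 2 + v ^ 2" by linarith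
    then show ?thesis by (simp add: abs_mult)
  qed
  then show "AE \<omega> in M. norm (U \<omega> * V \<omega>) \<le> norm (U \<omega> ^ 2 + V \<omega> ^ 2)" by blast
qed

context prob_space
begin

lemma fBm_increment_covariance:
  assumes b: "fBm_1d M H b" and s: "s \<in> {0..1}" and t: "t \<in> {0..1}" and s': "s' \<in> {0..1}" and t': "t' \<in> {0..1}"
  shows "integrable M (\<lambda>\<omega>. (b t \<omega> - b s \<omega>) * (b t' \<omega> - b s' \<omega>))"
    and "expectation (\<lambda>\<omega>. (b t \<omega> - b s \<omega>) * (b t' \<omega> - b s' \<omega>))
      = (\<bar>t - s'\<bar> powr (2 * H) + \<bar>s - t'\<bar> powr (2 * H) - \<bar>t - t'\<bar> powr (2 * H) - \<bar>s - s'\<bar> powr (2 * H)) / 2"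
proof -
  have gauss: "centred_gaussian_rv M (b r)" if "r \<in> {0..1}" for r
    using b that centred_gaussian_process_value unfolding fBm_1d_def by blast
  have int: "integrable M (\<lambda>\<omega>. b q \<omega> * b r \<omega>)" if "q \<in> {0..1}" "r \<in> {0..1}" for q r
    using gauss[OF that(1)] gauss[OF that(2)]
    by (intro integrable_product_of_squares centred_gaussian_moments(1)) (simp_all add: centred_gaussian_rv_def)
  have val: "expectation (\<lambda>\<omega>. b q \<omega> * b r \<omega>) = (r powr (2 * H) + q powr (2 * H) - \<bar>r - q\<bar> powr (2 * H)) / 2"
    if "q \<in> {0..1}" "r \<in> {0..1}" for q r
    using b that unfolding fBm_1d_def by blast
  have expand: "(b t \<omega> - b s \<omega>) * (b t' \<omega> - b s' \<omega>)
      = b t \<omega> * b t' \<omega> - b t \<omega> * b s' \<omega> - (b s \<omega> * b t' \<omega> - b s \<omega> * b s' \<omega>)" for \<omega>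
    by (simp add: algebra_simps)
  show "integrable M (\<lambda>\<omega>. (b t \<omega> - b s \<omega>) * (b t' \<omega> - b s' \<omega>))"
    unfolding expand by (intro Bochner_Integration.integrable_diff int s t s' t')
  have "expectation (\<lambda>\<omega>. (b t \<omega> - b s \<omega>) * (b t' \<omega> - b s' \<omega>))
      = expectation (\<lambda>\<omega>. b t \<omega> * b t' \<omega>) - expectation (\<lambda>\<omega>. b t \<omega> * b s' \<omega>)
        - (expectation (\<lambda>\<omega>. b s \<omega> * b t' \<omega>) - expectation (\<lambda>\<omega>. b s \<omega> * b s' \<omega>))"
    unfolding expand
    by (simp only: Bochner_Integration.integral_diff Bochner_Integration.integrable_diff int s t s' t')
  then show "expectation (\<lambda>\<omega>. (b t \<omega> - b s \<omega>) * (b t' \<omega> - b s' \<omega>))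
      = (\<bar>t - s'\<bar> powr (2 * H) + \<bar>s - t'\<bar> powr (2 * H) - \<bar>t - t'\<bar> powr (2 * H) - \<bar>s - s'\<bar> powr (2 * H)) / 2"
    unfolding val[OF t t'] val[OF t s'] val[OF s t'] val[OF s s']
      abs_minus_commute[of t' t] abs_minus_commute[of s' t] abs_minus_commute[of t' s] abs_minus_commute[of s' s]
    by (simp add: field_simps)
qed

lemma dyadic_in_unit:
  assumes "k < 2 ^ n"
  shows "real k / 2 ^ n \<in> {0..1}" "(real k + 1) / 2 ^ n \<in> {0..1}"
  using dyadic_endpoints[OF assms] by simp_all

text \<open>Self-similarity reduces the covariances of dyadic increments to those over unit intervals.\<close>

lemma fBm_dyadic_increments:
  assumes b: "fBm_1d M H b" and H: "0 < H" "H < 1 / 2" and k: "k < 2 ^ n"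
  defines "Z \<equiv> \<lambda>k \<omega>. b ((real k + 1) / 2 ^ n) \<omega> - b (real k / 2 ^ n) \<omega>"
  shows "l < 2 ^ n \<Longrightarrow> integrable M (\<lambda>\<omega>. Z k \<omega> * Z l \<omega>)"
    and "integrable M (\<lambda>\<omega>. Z k \<omega> ^ 4)"
    and "expectation (\<lambda>\<omega>. Z k \<omega> ^ 4) \<le> 3 * (2 powr - H) ^ (4 * n)"
    and "(\<Sum>l<2 ^ n. \<bar>expectation (\<lambda>\<omega>. Z k \<omega> * Z l \<omega>)\<bar>) \<le> 3 * (2 powr - H) ^ (2 * n)"
proof -
  define h :: real where "h = 1 / 2 ^ n"
  define \<eta> :: real where "\<eta> = 2 powr - H"
  have h: "0 < h" by (simp add: h_def)
  have h_powr: "h powr (2 * H) = \<eta> ^ (2 * n)"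
  proof -
    have "h = 2 powr (- real n)" by (simp add: h_def powr_minus inverse_eq_divide flip: powr_realpow)
    then have "h powr (2 * H) = 2 powr (- H * real (2 * n))" by (simp add: powr_powr ac_simps)
    also have "\<dots> = \<eta> ^ (2 * n)"
      unfolding \<eta>_def by (simp only: powr_powr[symmetric] powr_realpow powr_gt_zero)
    finally show ?thesis .
  qed
  have cov: "integrable M (\<lambda>\<omega>. Z k \<omega> * Z l \<omega>)"
    "expectation (\<lambda>\<omega>. Z k \<omega> * Z l \<omega>) = \<eta> ^ (2 * n) * fgn_cov (2 * H) (real k - real l)"
    if l: "l < 2 ^ n" for l
  proof -
    note * = fBm_increment_covariance[OF b dyadic_in_unit[OF k] dyadic_in_unit[OF l]]
    show "integrable M (\<lambda>\<omega>. Z k \<omega> * Z l \<omega>)" unfolding Z_def by (rule *(1))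
    have scale: "\<bar>(u - v) * h\<bar> powr (2 * H) = \<bar>u - v\<bar> powr (2 * H) * \<eta> ^ (2 * n)" for u v
      using h by (simp add: abs_mult powr_mult h_powr)
    have d: "(real k + 1) / 2 ^ n - real l / 2 ^ n = ((real k + 1) - real l) * h"
      "real k / 2 ^ n - (real l + 1) / 2 ^ n = (real k - (real l + 1)) * h"
      "(real k + 1) / 2 ^ n - (real l + 1) / 2 ^ n = (real k - real l) * h"
      "real k / 2 ^ n - real l / 2 ^ n = (real k - real l) * h"
      by (simp_all add: h_def field_simps)
    have e: "real k + 1 - real l = real k - real l + 1" "real k - (real l + 1) = real k - real l - 1" by simp_all
    show "expectation (\<lambda>\<omega>. Z k \<omega> * Z l \<omega>) = \<eta> ^ (2 * n) * fgn_cov (2 * H) (real k - real l)"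
      unfolding Z_def *(2) d scale unfolding e fgn_cov_def by (simp add: field_simps)
  qed
  then show "l < 2 ^ n \<Longrightarrow> integrable M (\<lambda>\<omega>. Z k \<omega> * Z l \<omega>)" by blast
  have "real k / 2 ^ n \<noteq> (real k + 1) / 2 ^ n" by simp
  then have gauss: "centred_gaussian_rv M (Z k)"
    using b dyadic_in_unit[OF k] unfolding fBm_1d_def Z_def
    by (intro centred_gaussian_process_increment) auto
  show "integrable M (\<lambda>\<omega>. Z k \<omega> ^ 4)" by (rule centred_gaussian_moments(2)[OF gauss])
  have "fgn_cov (2 * H) 0 = 1" by (simp add: fgn_cov_def)
  then have "expectation (\<lambda>\<omega>. Z k \<omega> ^ 2) = \<eta> ^ (2 * n)" using cov(2)[OF k] by (simp add: power2_eq_square)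
  then have "expectation (\<lambda>\<omega>. Z k \<omega> ^ 4) = 3 * \<eta> ^ (4 * n)"
    unfolding centred_gaussian_moments(3)[OF gauss] by (simp flip: power_mult)
  then show "expectation (\<lambda>\<omega>. Z k \<omega> ^ 4) \<le> 3 * (2 powr - H) ^ (4 * n)" by (simp add: \<eta>_def)
  have "(\<Sum>l<2 ^ n. \<bar>expectation (\<lambda>\<omega>. Z k \<omega> * Z l \<omega>)\<bar>)
      = (\<Sum>l<(2::nat) ^ n. \<eta> ^ (2 * n) * \<bar>fgn_cov (2 * H) (real k - real l)\<bar>)"
    by (intro sum.cong refl) (simp add: cov(2) abs_mult \<eta>_def)
  also have "\<dots> = \<eta> ^ (2 * n) * (\<Sum>l<(2::nat) ^ n. \<bar>fgn_cov (2 * H) (real k - real l)\<bar>)"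
    by (simp add: sum_distrib_left)
  also have "\<dots> \<le> \<eta> ^ (2 * n) * 3"
    using H by (intro mult_left_mono fgn_cov_row_sum) (auto simp: \<eta>_def)
  finally show "(\<Sum>l<2 ^ n. \<bar>expectation (\<lambda>\<omega>. Z k \<omega> * Z l \<omega>)\<bar>) \<le> 3 * (2 powr - H) ^ (2 * n)"
    by (simp add: \<eta>_def mult.commute)
qed

text \<open>
  Brownian increments meet the bounds of the rougher process, since \<open>2 * H < 1\<close> and lengths are at most
  \<open>1\<close>; increments over distinct cells are orthogonal.
\<close>

lemma BM_dyadic_increments:
  assumes w: "BM_1d M w" and H: "0 < H" "H < 1 / 2" and k: "k < 2 ^ n"
  defines "Z \<equiv> \<lambda>k \<omega>. w ((real k + 1) / 2 ^ n) \<omega> - w (real k / 2 ^ n) \<omega>"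
  shows "l < 2 ^ n \<Longrightarrow> integrable M (\<lambda>\<omega>. Z k \<omega> * Z l \<omega>)"
    and "integrable M (\<lambda>\<omega>. Z k \<omega> ^ 4)"
    and "expectation (\<lambda>\<omega>. Z k \<omega> ^ 4) \<le> 3 * (2 powr - H) ^ (4 * n)"
    and "(\<Sum>l<2 ^ n. \<bar>expectation (\<lambda>\<omega>. Z k \<omega> * Z l \<omega>)\<bar>) \<le> 3 * (2 powr - H) ^ (2 * n)"
proof -
  define \<sigma> :: real where "\<sigma> = sqrt (1 / 2 ^ n)"
  define \<eta> :: real where "\<eta> = 2 powr - H"
  have \<sigma>: "0 < \<sigma>" "\<sigma>\<^sup>2 = 1 / 2 ^ n" by (simp_all add: \<sigma>_def)
  have \<eta>: "\<sigma>\<^sup>2 \<le> \<eta> ^ (2 * n)"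
  proof -
    have "(2 :: real) powr - 1 \<le> 2 powr (- H * 2)" using H by (intro powr_mono) auto
    also have "\<dots> = \<eta>\<^sup>2" unfolding \<eta>_def by (simp add: powr_powr flip: powr_realpow)
    finally have "1 / 2 \<le> \<eta>\<^sup>2" by (simp add: powr_minus inverse_eq_divide)
    then have "(1 / 2) ^ n \<le> (\<eta>\<^sup>2) ^ n" by (intro power_mono) auto
    then show ?thesis unfolding \<sigma>(2) by (simp add: power_one_over flip: power_mult)
  qed
  have distr: "distributed M lborel (Z l) (\<lambda>x. ennreal (normal_density 0 \<sigma> x))" if l: "l < 2 ^ n" for l
  proof -
    have len: "(real l + 1) / 2 ^ n - real l / 2 ^ n = 1 / 2 ^ n" by (simp flip: diff_divide_distrib)
    have lt: "real l / 2 ^ n < (real l + 1) / 2 ^ n" by (simp add: divide_strict_right_mono)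
    have "\<forall>s t. 0 \<le> s \<and> s < t \<and> t \<le> 1 \<longrightarrow> distributed M lborel (\<lambda>\<omega>. w t \<omega> - w s \<omega>)
        (\<lambda>x. ennreal (normal_density 0 (sqrt (t - s)) x))"
      using w unfolding BM_1d_def by blast
    from this[rule_format, of "real l / 2 ^ n" "(real l + 1) / 2 ^ n"] dyadic_in_unit[OF l] lt
    show ?thesis unfolding Z_def \<sigma>_def len by simp
  qed
  note moments = centred_normal_moments[OF distr \<sigma>(1)]
  have meas: "Z l \<in> borel_measurable M" if "l < 2 ^ n" for l
    using distributed_measurable[OF distr[OF that]] by simp
  show int: "l < 2 ^ n \<Longrightarrow> integrable M (\<lambda>\<omega>. Z k \<omega> * Z l \<omega>)" for l
    using k by (intro integrable_product_of_squares meas moments(1))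
  show "integrable M (\<lambda>\<omega>. Z k \<omega> ^ 4)" by (rule moments(3)[OF k])
  have "\<sigma> ^ 4 \<le> \<eta> ^ (4 * n)"
    using power_mono[OF \<eta>, of 2] by (simp flip: power_mult)
  then show "expectation (\<lambda>\<omega>. Z k \<omega> ^ 4) \<le> 3 * (2 powr - H) ^ (4 * n)"
    unfolding moments(4)[OF k] by (simp add: \<eta>_def)
  have indep: "indep_vars (\<lambda>_. borel) Z {..<2 ^ n}"
  proof -
    have "strict_mono_on {..2 ^ n} (\<lambda>i. real i / 2 ^ n)"
      by (intro strict_mono_onI) (simp add: divide_strict_right_mono)
    moreover have "(\<lambda>i. real i / 2 ^ n) ` {..2 ^ n} \<subseteq> {0..1}" by auto
    moreover have "\<forall>N \<tau>. strict_mono_on {..N} \<tau> \<and> \<tau> ` {..N} \<subseteq> {0..1} \<longrightarrow>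
        indep_vars (\<lambda>_. borel) (\<lambda>i \<omega>. w (\<tau> (Suc i)) \<omega> - w (\<tau> i) \<omega>) {..<N}"
      using w unfolding BM_1d_def by blast
    ultimately have "indep_vars (\<lambda>_. borel) (\<lambda>i \<omega>. w (real (Suc i) / 2 ^ n) \<omega> - w (real i / 2 ^ n) \<omega>) {..<2 ^ n}"
      by blast
    then show ?thesis unfolding Z_def by (simp add: add.commute)
  qed
  have orth: "expectation (\<lambda>\<omega>. Z k \<omega> * Z l \<omega>) = 0" if l: "l < 2 ^ n" "l \<noteq> k" for l
  proof -
    have one: "integrable M (Z j) \<and> expectation (Z j) = 0" if "j < 2 ^ n" for j
      using normal_distributed_expectation[OF \<sigma>(1) distr[OF that]]
        distributed_integrable_var[OF distr[OF that]] integrable_normal_moment_nz_1[OF \<sigma>(1), of 0]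
      by simp
    have "indep_vars (\<lambda>_. borel) Z {k, l}" by (rule indep_vars_subset[OF indep]) (use k l in auto)
    then have "expectation (\<lambda>\<omega>. \<Prod>j\<in>{k, l}. Z j \<omega>) = (\<Prod>j\<in>{k, l}. expectation (Z j))"
      using one k l by (intro indep_vars_lebesgue_integral) auto
    then show ?thesis using one[OF k] l by simp
  qed
  have "(\<Sum>l<2 ^ n. \<bar>expectation (\<lambda>\<omega>. Z k \<omega> * Z l \<omega>)\<bar>)
      = (\<Sum>l<2 ^ n. if l = k then \<bar>expectation (\<lambda>\<omega>. Z k \<omega> * Z k \<omega>)\<bar> else 0)"
    by (intro sum.cong refl) (use orth in auto)
  also have "\<dots> = \<bar>expectation (\<lambda>\<omega>. Z k \<omega> * Z k \<omega>)\<bar>" using k by simp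
  also have "\<dots> = \<sigma>\<^sup>2" using moments(2)[OF k] by (simp add: power2_eq_square)
  also have "\<dots> \<le> 3 * \<eta> ^ (2 * n)" using \<eta> order_trans[OF zero_le_power2 \<eta>] by linarith
  finally show "(\<Sum>l<2 ^ n. \<bar>expectation (\<lambda>\<omega>. Z k \<omega> * Z l \<omega>)\<bar>) \<le> 3 * (2 powr - H) ^ (2 * n)"
    by (simp add: \<eta>_def)
qed

section \<open>Independence of the coordinates\<close>

text \<open>
  The \<open>\<sigma>\<close>-algebra of a process as a measurable space, so that the closure properties of measurable
  functions apply to functions of the process.
\<close>

definition process_space :: "(real \<Rightarrow> 'a \<Rightarrow> 'b::topological_space) \<Rightarrow> 'a measure" where
  "process_space X = sigma (space M) {X t -` A \<inter> space M | t A. t \<in> {0..1} \<and> A \<in> sets borel}"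

lemma sets_process_space: "sets (process_space X) = process_sigma M X"
  unfolding process_space_def process_sigma_def by (rule sets_measure_of) auto

lemma space_process_space: "space (process_space X) = space M"
  unfolding process_space_def by (rule space_measure_of) auto

lemma measurable_process_space:
  assumes "t \<in> {0..1}"
  shows "X t \<in> borel_measurable (process_space X)"
proof (rule measurableI)
  fix A :: "'b set" assume "A \<in> sets borel"
  then show "X t -` A \<inter> space (process_space X) \<in> sets (process_space X)"
    unfolding sets_process_space space_process_space process_sigma_def using assms
    by (intro sigma_sets.Basic) blast
qed simp

lemma sigma_sets_preimages_subset:
  fixes W :: "'a \<Rightarrow> real" and X :: "real \<Rightarrow> 'a \<Rightarrow> 'b::topological_space"
  assumes "W \<in> borel_measurable (process_space X)"
  shows "sigma_sets (space M) {W -` A \<inter> space M |A. A \<in> sets borel} \<subseteq> process_sigma M X"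
proof -
  have "{W -` A \<inter> space M |A. A \<in> sets borel} \<subseteq> sets (process_space X)"
    using measurable_sets[OF assms] by (auto simp: space_process_space)
  then have "sigma_sets (space (process_space X)) {W -` A \<inter> space M |A. A \<in> sets borel} \<subseteq> sets (process_space X)"
    by (rule sets.sigma_sets_subset)
  then show ?thesis by (simp add: sets_process_space space_process_space)
qed

lemma indep_processes_expectation_mult:
  fixes U V :: "'a \<Rightarrow> real"
  assumes ind: "indep_set (process_sigma M X) (process_sigma M Y)"
    and U: "U \<in> borel_measurable (process_space X)" and V: "V \<in> borel_measurable (process_space Y)"
    and int: "integrable M U" "integrable M V"
  shows "expectation (\<lambda>\<omega>. U \<omega> * V \<omega>) = expectation U * expectation V"
proof -
  have "indep_var borel U borel V"
    unfolding indep_var_eq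
  proof (intro conjI)
    show "random_variable borel U" "random_variable borel V" using int by auto
    show "indep_set (sigma_sets (space M) {U -` A \<inter> space M |A. A \<in> sets borel})
        (sigma_sets (space M) {V -` A \<inter> space M |A. A \<in> sets borel})"
      using ind sigma_sets_preimages_subset[OF U] sigma_sets_preimages_subset[OF V] unfolding indep_sets2_eq by blast
  qed
  then show ?thesis by (rule indep_var_lebesgue_integral[OF _ int])
qed

lemma process_sigma_component_subset:
  fixes X :: "real \<Rightarrow> 'a \<Rightarrow> real ^ 'd::finite"
  shows "process_sigma M (\<lambda>t \<omega>. X t \<omega> $ i) \<subseteq> process_sigma M X"
  unfolding process_sigma_def
proof (rule sigma_sets_mono', rule subsetI)
  fix S assume "S \<in> {(\<lambda>\<omega>. X t \<omega> $ i) -` A \<inter> space M |t A. t \<in> {0..1} \<and> A \<in> sets borel}"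
  then obtain t A where tA: "S = (\<lambda>\<omega>. X t \<omega> $ i) -` A \<inter> space M" "t \<in> {0..1}" "A \<in> sets borel" by blast
  have "(\<lambda>v :: real ^ 'd. v $ i) \<in> borel_measurable borel"
    by (intro borel_measurable_continuous_onI continuous_intros)
  from measurable_sets[OF this tA(3)] have "(\<lambda>v. v $ i) -` A \<in> sets (borel :: (real ^ 'd) measure)" by simp
  moreover have "S = X t -` ((\<lambda>v. v $ i) -` A) \<inter> space M" using tA(1) by auto
  ultimately show "S \<in> {X t -` A \<inter> space M |t A. t \<in> {0..1} \<and> A \<in> sets borel}" using tA(2) by blast
qed

lemma indep_set_commute: "indep_set A B \<Longrightarrow> indep_set B A"
  unfolding indep_sets2_eq by (metis Int_commute mult.commute)

lemma indep_sets_pair: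
  assumes "indep_sets F UNIV" "i \<noteq> j"
  shows "indep_set (F i) (F j)"
proof (rule indep_setI)
  show "F i \<subseteq> events" "F j \<subseteq> events" using assms(1) unfolding indep_sets_def by blast+
  fix A B assume "A \<in> F i" "B \<in> F j"
  then show "prob (A \<inter> B) = prob A * prob B"
    using indep_setsD[OF assms(1), of "{i, j}" "\<lambda>k. if k = i then A else B"] assms(2)
    by (simp add: Int_commute)
qed

text \<open>
  For coordinates of different processes, the \<open>\<sigma>\<close>-algebra of a coordinate is contained in that of the
  vector process.
\<close>

lemma mixed_components_independent:
  assumes b: "independent_components M b" and w: "independent_components M w"
    and bw: "independent_processes M b w" and "i \<noteq> j"
  shows "indep_set (process_sigma M (\<lambda>t \<omega>. vec_append (b t \<omega>) (w t \<omega>) $ i))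
    (process_sigma M (\<lambda>t \<omega>. vec_append (b t \<omega>) (w t \<omega>) $ j))"
proof -
  have cross: "indep_set (process_sigma M (\<lambda>t \<omega>. b t \<omega> $ i)) (process_sigma M (\<lambda>t \<omega>. w t \<omega> $ j))" for i j
    using bw process_sigma_component_subset[of b i] process_sigma_component_subset[of w j]
    unfolding independent_processes_def indep_sets2_eq by blast
  show ?thesis
  proof (cases i; cases j)
    fix i' j' assume "i = Inl i'" "j = Inl j'"
    then show ?thesis using indep_sets_pair[OF b[unfolded independent_components_def], of i' j'] \<open>i \<noteq> j\<close>
      by (simp add: vec_append_def)
  next
    fix i' j' assume "i = Inr i'" "j = Inr j'"
    then show ?thesis using indep_sets_pair[OF w[unfolded independent_components_def], of i' j'] \<open>i \<noteq> j\<close>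
      by (simp add: vec_append_def)
  next
    fix i' j' assume "i = Inl i'" "j = Inr j'"
    then show ?thesis using cross[of i' j'] by (simp add: vec_append_def)
  next
    fix i' j' assume "i = Inr i'" "j = Inl j'"
    then show ?thesis using indep_set_commute[OF cross[of j' i']] by (simp add: vec_append_def)
  qed
qed

end

section \<open>Mixed fractional Brownian motion\<close>

text \<open>
  The constant \<open>3\<close> serves both for the Gaussian fourth moment and for the row sums of the
  covariances.
\<close>

lemma (in prob_space) coordinate_increments:
  fixes y :: "real \<Rightarrow> 'a \<Rightarrow> real"
  assumes y: "fBm_1d M H y \<or> BM_1d M y" and H: "0 < H" "H < 1 / 2"
  defines "Z \<equiv> \<lambda>n k \<omega>. y ((real k + 1) / 2 ^ n) \<omega> - y (real k / 2 ^ n) \<omega>"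
  shows "t \<in> {0..1} \<Longrightarrow> y t \<in> borel_measurable M"
    and "k < 2 ^ n \<Longrightarrow> l < 2 ^ n \<Longrightarrow> integrable M (\<lambda>\<omega>. Z n k \<omega> * Z n l \<omega>)"
    and "k < 2 ^ n \<Longrightarrow> integrable M (\<lambda>\<omega>. Z n k \<omega> ^ 4)"
    and "k < 2 ^ n \<Longrightarrow> expectation (\<lambda>\<omega>. Z n k \<omega> ^ 4) \<le> 3 * (2 powr - H) ^ (4 * n)"
    and "k < 2 ^ n \<Longrightarrow>
      (\<Sum>l<2 ^ n. \<bar>expectation (\<lambda>\<omega>. Z n k \<omega> * Z n l \<omega>)\<bar>) \<le> 3 * (2 powr - H) ^ (2 * n)"
proof -
  show "y t \<in> borel_measurable M" if "t \<in> {0..1}"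
    using y
  proof
    assume "fBm_1d M H y"
    then show ?thesis
      using centred_gaussian_process_value[OF _ that, of M y]
      unfolding fBm_1d_def centred_gaussian_rv_def by blast
  next
    assume "BM_1d M y"
    then show ?thesis using that unfolding BM_1d_def by blast
  qed
  show "integrable M (\<lambda>\<omega>. Z n k \<omega> * Z n l \<omega>)" if "k < 2 ^ n" "l < 2 ^ n"
    unfolding Z_def using y fBm_dyadic_increments(1)[OF _ H that] BM_dyadic_increments(1)[OF _ H that] by blast
  show "integrable M (\<lambda>\<omega>. Z n k \<omega> ^ 4)" if "k < 2 ^ n"
    unfolding Z_def using y fBm_dyadic_increments(2)[OF _ H that] BM_dyadic_increments(2)[OF _ H that] by blast
  show "expectation (\<lambda>\<omega>. Z n k \<omega> ^ 4) \<le> 3 * (2 powr - H) ^ (4 * n)" if "k < 2 ^ n"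
    unfolding Z_def using y fBm_dyadic_increments(3)[OF _ H that] BM_dyadic_increments(3)[OF _ H that] by blast
  show "(\<Sum>l<2 ^ n. \<bar>expectation (\<lambda>\<omega>. Z n k \<omega> * Z n l \<omega>)\<bar>) \<le> 3 * (2 powr - H) ^ (2 * n)" if "k < 2 ^ n"
    unfolding Z_def using y fBm_dyadic_increments(4)[OF _ H that] BM_dyadic_increments(4)[OF _ H that] by blast
qed

lemma (in prob_space) mixed_increment_process:
  fixes b :: "real \<Rightarrow> 'a \<Rightarrow> real ^ 'd1::finite" and w :: "real \<Rightarrow> 'a \<Rightarrow> real ^ 'd2::finite"
  assumes H: "0 < H" "H < 1 / 2"
    and b: "fBm M H b" and w: "BM M w" and bw: "independent_processes M b w"
  shows "increment_process M (\<lambda>\<omega> t. vec_append (b t \<omega>) (w t \<omega>)) (2 powr - H) 3"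
proof -
  define y where "y i t \<omega> = vec_append (b t \<omega>) (w t \<omega>) $ i" for i t \<omega>
  have y: "fBm_1d M H (y i) \<or> BM_1d M (y i)" for i
  proof (cases i)
    case (Inl j)
    then have "y i = (\<lambda>t \<omega>. b t \<omega> $ j)" by (simp add: y_def[abs_def] vec_append_def)
    then show ?thesis using b unfolding fBm_def by simp
  next
    case (Inr j)
    then have "y i = (\<lambda>t \<omega>. w t \<omega> $ j)" by (simp add: y_def[abs_def] vec_append_def)
    then show ?thesis using w unfolding BM_def by simp
  qed
  note co = coordinate_increments[OF y H]
  let ?x = "\<lambda>\<omega> t. vec_append (b t \<omega>) (w t \<omega>)"
  have inc: "dyadic_inc (?x \<omega>) n k $ i
      = y i ((real k + 1) / 2 ^ n) \<omega> - y i (real k / 2 ^ n) \<omega>" for \<omega> n k i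
    by (simp add: dyadic_inc_def y_def)
  show ?thesis
  proof unfold_locales
    fix t :: real and i :: "'d1 + 'd2" assume "0 \<le> t" "t \<le> 1"
    then show "(\<lambda>\<omega>. vec_append (b t \<omega>) (w t \<omega>) $ i) \<in> borel_measurable M"
      using co(1)[of t i] unfolding y_def[abs_def] by simp
  next
    show "(0::real) < 2 powr - H" by simp
    show "2 powr - H \<le> 1" using H powr_mono[of "- H" 0 2] by simp
    show "(1::real) \<le> 3" by simp
  next
    fix k n and i :: "'d1 + 'd2" assume k: "k < (2::nat) ^ n"
    show "integrable M (\<lambda>\<omega>. (dyadic_inc (?x \<omega>) n k $ i) ^ 4)"
      unfolding inc by (rule co(3)[OF k])
    show "expectation (\<lambda>\<omega>. (dyadic_inc (?x \<omega>) n k $ i) ^ 4)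
        \<le> 3 * (2 powr - H) ^ (4 * n)"
      unfolding inc by (rule co(4)[OF k])
    show "(\<Sum>l<2 ^ n. \<bar>expectation (\<lambda>\<omega>. dyadic_inc (?x \<omega>) n k $ i
          * dyadic_inc (?x \<omega>) n l $ i)\<bar>) \<le> 3 * (2 powr - H) ^ (2 * n)"
      unfolding inc by (rule co(5)[OF k])
  next
    fix i j :: "'d1 + 'd2" and k k' l l' n :: nat
    assume "i \<noteq> j" and kl: "k < 2 ^ n" "k' < 2 ^ n" "l < 2 ^ n" "l' < 2 ^ n"
    have ind: "indep_set (process_sigma M (y i)) (process_sigma M (y j))"
      unfolding y_def[abs_def] using b w unfolding fBm_def BM_def
      by (intro mixed_components_independent bw \<open>i \<noteq> j\<close>) auto
    have meas: "(\<lambda>\<omega>. (y i ((real k + 1) / 2 ^ n) \<omega> - y i (real k / 2 ^ n) \<omega>)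
        * (y i ((real l + 1) / 2 ^ n) \<omega> - y i (real l / 2 ^ n) \<omega>)) \<in> borel_measurable (process_space (y i))"
      if "k < 2 ^ n" "l < 2 ^ n" for k l i
      by (intro borel_measurable_times borel_measurable_diff measurable_process_space dyadic_in_unit that)
    show "expectation (\<lambda>\<omega>. (dyadic_inc (?x \<omega>) n k $ i
          * dyadic_inc (?x \<omega>) n k' $ i)
        * (dyadic_inc (?x \<omega>) n l $ j
          * dyadic_inc (?x \<omega>) n l' $ j))
      = expectation (\<lambda>\<omega>. dyadic_inc (?x \<omega>) n k $ i
          * dyadic_inc (?x \<omega>) n k' $ i)
        * expectation (\<lambda>\<omega>. dyadic_inc (?x \<omega>) n l $ j
          * dyadic_inc (?x \<omega>) n l' $ j)"
      unfolding inc
      by (rule indep_processes_expectation_mult[OF ind meas[OF kl(1,2)] meas[OF kl(3,4)] co(2)[OF kl(1,2)] co(2)[OF kl(3,4)]])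
  qed
qed

theorem proposition2p1:
  fixes M :: "'w measure"
    and b :: "real \<Rightarrow> 'w \<Rightarrow> real ^ 'd1::finite"
    and w :: "real \<Rightarrow> 'w \<Rightarrow> real ^ 'd2::finite"
    and H p :: real
  assumes "prob_space M"
    and "1 / 3 < H" "H < 1 / 2"
    and "fBm M H b" "BM M w" "independent_processes M b w"
    and "2 < p" "p < 3" "H * p > 1"
  shows "\<exists>X :: 'w \<Rightarrow> real \<Rightarrow> real \<Rightarrow> ('d1 + 'd2) tensor2.
    (\<forall>(s, t) \<in> simplex01. (\<lambda>\<omega>. X \<omega> s t) \<in> borel_measurable M) \<and>
    (AE \<omega> in M.
       geometric_rough_path p (X \<omega>) \<and>
       (\<lambda>m. rp_dist p (smooth_lift (dyadic_interp m (\<lambda>t. vec_append (b t \<omega>) (w t \<omega>)))) (X \<omega>))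
         \<longlonglongrightarrow> 0 \<and>
       (\<forall>Y. geometric_rough_path p Y \<and>
            (\<lambda>m. rp_dist p (smooth_lift (dyadic_interp m (\<lambda>t. vec_append (b t \<omega>) (w t \<omega>)))) Y)
              \<longlonglongrightarrow> 0 \<longrightarrow>
            (\<forall>(s, t) \<in> simplex01. Y s t = X \<omega> s t)))"
proof -
  interpret prob_space M by fact
  interpret increment_process M "\<lambda>\<omega> t. vec_append (b t \<omega>) (w t \<omega>)" "2 powr - H" 3
    using assms by (intro mixed_increment_process) auto
  \<comment> \<open>Half of the surplus in \<open>H * p > 1\<close>.\<close>
  define \<delta> where "\<delta> = (H * p - 1) / 2"
  have "H * p < (1 / 2) * 3" using assms by (intro mult_strict_mono) auto
  moreover have \<delta>2: "2 * \<delta> = H * p - 1" by (simp add: \<delta>_def)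
  ultimately have \<delta>: "0 < \<delta>" "1 + \<delta> \<le> p" using assms by linarith+
  have "(1 + 2 * \<delta>) / p = H" unfolding \<delta>2 using assms by simp
  then have exponent: "2 powr - H \<le> 2 powr (- ((1 + 2 * \<delta>) / p))" by simp
  define X where "X \<omega> s t = lim (\<lambda>m. lift m \<omega> s t)" for \<omega> s t
  have smooth: "smooth_rough_path (lift m \<omega>)" for m \<omega>
    unfolding lift_def by (rule smooth_rough_path_smooth_lift[OF regular_path_dyadic_interp])
  have meas: "\<forall>(s, t) \<in> simplex01. (\<lambda>\<omega>. X \<omega> s t) \<in> borel_measurable M"
  proof clarify
    fix s t :: real assume "(s, t) \<in> simplex01"
    then have "0 \<le> s" "s \<le> t" "t \<le> 1" by (auto simp: simplex01_def)
    then show "(\<lambda>\<omega>. X \<omega> s t) \<in> borel_measurable M"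
      unfolding X_def by (intro borel_measurable_lim_metric measurable_lift)
  qed
  have "p \<le> 4" using assms by simp
  note rough = rough_path_lift[OF \<delta> \<open>p \<le> 4\<close> exponent]
  have ae: "AE \<omega> in M. rough_path p (X \<omega>) \<and> (\<lambda>m. rp_dist p (lift m \<omega>) (X \<omega>)) \<longlonglongrightarrow> 0"
    using AE_lift_converges[OF \<delta> \<open>p \<le> 4\<close> exponent] unfolding X_def[abs_def] .
  have concl: "geometric_rough_path p (X \<omega>) \<and> (\<lambda>m. rp_dist p (lift m \<omega>) (X \<omega>)) \<longlonglongrightarrow> 0 \<and>
      (\<forall>Y. geometric_rough_path p Y \<and> (\<lambda>m. rp_dist p (lift m \<omega>) Y) \<longlonglongrightarrow> 0 \<longrightarrow>
        (\<forall>(s, t) \<in> simplex01. Y s t = X \<omega> s t))"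
    if *: "rough_path p (X \<omega>) \<and> (\<lambda>m. rp_dist p (lift m \<omega>) (X \<omega>)) \<longlonglongrightarrow> 0" for \<omega>
  proof (intro conjI allI impI)
    show conv: "(\<lambda>m. rp_dist p (lift m \<omega>) (X \<omega>)) \<longlonglongrightarrow> 0" using * by blast
    show "geometric_rough_path p (X \<omega>)"
      unfolding geometric_rough_path_def
    proof (intro conjI allI impI)
      show "rough_path p (X \<omega>)" using * by blast
      fix \<epsilon> :: real assume "\<epsilon> > 0"
      then obtain m where "rp_dist p (lift m \<omega>) (X \<omega>) < \<epsilon>"
        using order_tendstoD(2)[OF conv] eventually_happens[of _ sequentially] by fastforce
      then show "\<exists>Y. smooth_rough_path Y \<and> rp_dist p Y (X \<omega>) < \<epsilon>" using smooth by blast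
    qed
    fix Y assume Y: "geometric_rough_path p Y \<and> (\<lambda>m. rp_dist p (lift m \<omega>) Y) \<longlonglongrightarrow> 0"
    show "\<forall>(s, t) \<in> simplex01. Y s t = X \<omega> s t"
    proof clarify
      fix s t :: real assume "(s, t) \<in> simplex01"
      then have st: "0 \<le> s" "s \<le> t" "t \<le> 1" by (auto simp: simplex01_def)
      have "0 < p" using assms by simp
      then show "Y s t = X \<omega> s t"
        by (rule rough_path_limit_unique[OF _ rough _ _ _ conv st])
          (use Y * in \<open>auto simp: geometric_rough_path_def\<close>)
    qed
  qed
  have "AE \<omega> in M. geometric_rough_path p (X \<omega>) \<and> (\<lambda>m. rp_dist p (lift m \<omega>) (X \<omega>)) \<longlonglongrightarrow> 0 \<and>
      (\<forall>Y. geometric_rough_path p Y \<and> (\<lambda>m. rp_dist p (lift m \<omega>) Y) \<longlonglongrightarrow> 0 \<longrightarrow>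
        (\<forall>(s, t) \<in> simplex01. Y s t = X \<omega> s t))"
    using ae by (rule AE_mp) (intro AE_I2 impI concl)
  with meas show ?thesis unfolding lift_def by (intro exI[of _ X] conjI)
qed

end
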